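(* Let $W$ be a reflexive Banach space with a scaling $(u,t)\mapsto u_t$ with exponent $s>0$, and let $I$ and $\mathcal M$ be as in the context. Let $\Phi$ be a $C^1$-functional on $W$. Let $A_0$ and $B_0$ be disjoint nonempty closed symmetric subsets of $\mathcal M$ such that $$i(A_0)=i(\mathcal M\setminus B_0)<\infty,$$ let $R>0$, and let $$X=\{u_t:u\in A_0,\ 0\le t\le R\},\qquad A=\{u_R:u\in A_0\},\qquad B=\{u_t:u\in B_0,\ t\ge0\}.$$ Assume that $$\sup_{u\in A}\Phi(u)\le\inf_{u\in B}\Phi(u),\qquad \sup_{u\in X}\Phi(u)<\infty.$$ Let $\Gamma=\{\gamma\in C(X,W):\gamma(X)\text{ is closed and }\gamma|_A=\mathrm{id}\}$ and set $$c:=\inf_{\gamma\in\Gamma}\ \sup_{u\in\gamma(X)}\Phi(u).$$ If $\Phi$ satisfies the $(\mathrm{PS})_c$ condition, then $c$ is a critical value of $\Phi$.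
   Context: A scaling on a reflexive (real) Banach space $W$ is a continuous map $W\times[0,\infty)\to W$, $(u,t)\mapsto u_t$, such that: $(u_{t_1})_{t_2}=u_{t_1t_2}$ for all $u\in W$, $t_1,t_2\ge0$; $(\tau u)_t=\tau u_t$ for all $u\in W$, $\tau\in\mathbb R$, $t\ge0$; $u_0=0$ and $u_1=u$ for all $u\in W$; $u_t$ is bounded on bounded sets in $W\times[0,\infty)$; and there is $s>0$ (fixed from now on) with $\|u_t\|=O(t^s)$ as $t\to\infty$, uniformly in $u$ on bounded sets. $I\in C(W,\mathbb R)$ is an even functional satisfying $I(u_t)=t^sI(u)$ for all $u\in W$, $t\ge0$, and $I(u)>0$ for all $u\in W\setminus\{0\}$. Set $\mathcal M=\{u\in W:I(u)=1\}$. It is assumed that $\mathcal M$ is bounded and that each ray $\{tu:t\ge0\}$, $u\ne0$, starting from the origin intersects $\mathcal M$ at exactly one point. Cohomological index (Fadell–Rabinowitz): for a symmetric set $A\subset W\setminus\{0\}$ (i.e. $-A=A$), let $\overline A=A/\mathbb Z_2$ be the quotient identifying $u$ and $-u$, let $f:\overline A\to\mathbb{RP}^\infty$ be its classifying map and $f^*:H^*(\mathbb{RP}^\infty)\to H^*(\overline A)$ the induced homomorphism of Alexander–Spanier cohomology rings with $\mathbb Z_2$ coefficients. Then $i(\emptyset)=0$ and, for $A\ne\emptyset$, $i(A)=\sup\{m\ge1: f^*(\omega^{m-1})\ne0\}$, where $\omega\in H^1(\mathbb{RP}^\infty)$ is the generator of $H^*(\mathbb{RP}^\infty)=\mathbb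 Z_2[\omega]$. $\Phi$ satisfies the $(\mathrm{PS})_c$ condition if every sequence $(u_j)\subset W$ with $\Phi(u_j)\to c$ and $\Phi'(u_j)\to0$ in $W^*$ has a convergent subsequence. *)

theory Defs
  imports
    "HOL-Analysis.Analysis"
    "HOL-Library.Z2"
    "HOL-Library.Extended_Nat"
    "HOL-Library.Extended_Real"
begin

section \<open>Alexander--Spanier cohomology with coefficients in the two-element field\<close>

text \<open>
  A \<open>q\<close>-cochain on \<open>X\<close> is a function on \<open>(q + 1)\<close>-tuples of points of \<open>X\<close>, given here by its values
  on the lists of length \<open>q + 1\<close>. The values on all other lists carry no information: two functions
  that differ only there differ by a locally zero cochain and so have the same class.
\<close>

definition as_locally_zero :: "'a topology \<Rightarrow> nat \<Rightarrow> ('a list \<Rightarrow> bit) \<Rightarrow> bool" where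
  "as_locally_zero X q \<phi> \<longleftrightarrow>
     (\<exists>\<U>. (\<forall>U\<in>\<U>. openin X U) \<and> \<Union>\<U> = topspace X \<and>
          (\<forall>U\<in>\<U>. \<forall>xs. length xs = Suc q \<and> set xs \<subseteq> U \<longrightarrow> \<phi> xs = 0))"

text \<open>The signs of the alternating sum are immaterial in characteristic two.\<close>

definition as_delta :: "('a list \<Rightarrow> bit) \<Rightarrow> 'a list \<Rightarrow> bit" where
  "as_delta \<phi> xs = (\<Sum>i<length xs. \<phi> (take i xs @ drop (Suc i) xs))"

text \<open>
  Cocycles and coboundaries of the quotient complex of all cochains by the locally zero ones, pulled
  back to the level of cochains. As there are no cochains of negative degree, the coboundaries of
  degree 0 are just the locally zero cochains.
\<close>

definition as_cocycles :: "'a topology \<Rightarrow> nat \<Rightarrow> ('a list \<Rightarrow> bit) set" where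
  "as_cocycles X q = {\<phi>. as_locally_zero X (Suc q) (as_delta \<phi>)}"

definition as_coboundaries :: "'a topology \<Rightarrow> nat \<Rightarrow> ('a list \<Rightarrow> bit) set" where
  "as_coboundaries X q =
     {\<phi>. if q = 0 then as_locally_zero X q \<phi>
          else \<exists>\<psi>. as_locally_zero X q (\<lambda>xs. \<phi> xs - as_delta \<psi> xs)}"

definition as_rel :: "'a topology \<Rightarrow> nat \<Rightarrow> (('a list \<Rightarrow> bit) \<times> ('a list \<Rightarrow> bit)) set" where
  "as_rel X q = {(\<phi>, \<psi>). \<phi> \<in> as_cocycles X q \<and> \<psi> \<in> as_cocycles X q \<and>
                          (\<lambda>xs. \<phi> xs - \<psi> xs) \<in> as_coboundaries X q}"

definition as_cohomology :: "'a topology \<Rightarrow> nat \<Rightarrow> ('a list \<Rightarrow> bit) set set" where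
  "as_cohomology X q = as_cocycles X q // as_rel X q"

definition as_zero :: "'a topology \<Rightarrow> nat \<Rightarrow> ('a list \<Rightarrow> bit) set" where
  "as_zero X q = as_rel X q `` {\<lambda>xs. 0}"

definition as_one :: "'a topology \<Rightarrow> ('a list \<Rightarrow> bit) set" where
  "as_one X = as_rel X 0 `` {\<lambda>xs. 1}"

text \<open>
  Front face times back face on representatives, \<open>a\<close> having degree \<open>p\<close> and \<open>b\<close> degree \<open>q\<close>. The products
  of all pairs of representatives are cohomologous, so the image below is a single class; likewise
  for the induced homomorphism \<open>as_induced X q f\<close>, from degree \<open>q\<close> of the target of \<open>f\<close> to degree \<open>q\<close>
  of the source \<open>X\<close>.
\<close>

definition as_cup ::
  "'a topology \<Rightarrow> nat \<Rightarrow> nat \<Rightarrow> ('a list \<Rightarrow> bit) set \<Rightarrow> ('a list \<Rightarrow> bit) set \<Rightarrow> ('a list \<Rightarrow> bit) set" where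
  "as_cup X p q a b =
     as_rel X (p + q) `` {\<lambda>xs. \<phi> (take (Suc p) xs) * \<psi> (drop p xs) | \<phi> \<psi>. \<phi> \<in> a \<and> \<psi> \<in> b}"

definition as_induced ::
  "'a topology \<Rightarrow> nat \<Rightarrow> ('a \<Rightarrow> 'b) \<Rightarrow> ('b list \<Rightarrow> bit) set \<Rightarrow> ('a list \<Rightarrow> bit) set" where
  "as_induced X q f a = as_rel X q `` {\<lambda>xs. \<phi> (map f xs) | \<phi>. \<phi> \<in> a}"

text \<open>Powers of a class of degree one; the \<open>m\<close>-th power has degree \<open>m\<close>.\<close>

primrec as_power :: "'a topology \<Rightarrow> ('a list \<Rightarrow> bit) set \<Rightarrow> nat \<Rightarrow> ('a list \<Rightarrow> bit) set" where
  "as_power X a 0 = as_one X"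
| "as_power X a (Suc m) = as_cup X m 1 (as_power X a m) a"


section \<open>Infinite real projective space\<close>

text \<open>The quotient topology on the set of pairs \<open>{x, - x}\<close>.\<close>

definition antipodal_quotient :: "'a::uminus topology \<Rightarrow> 'a set topology" where
  "antipodal_quotient X =
     topology (\<lambda>V. V \<subseteq> (\<lambda>x. {x, - x}) ` topspace X \<and>
                   openin X {x \<in> topspace X. {x, - x} \<in> V})"

lemma openin_antipodal_quotient:
  "openin (antipodal_quotient X) V \<longleftrightarrow>
     V \<subseteq> (\<lambda>x. {x, - x}) ` topspace X \<and> openin X {x \<in> topspace X. {x, - x} \<in> V}"
proof -
  let ?P = "\<lambda>V. V \<subseteq> (\<lambda>x. {x, - x}) ` topspace X \<and> openin X {x \<in> topspace X. {x, - x} \<in> V}"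
  have "istopology ?P"
    unfolding istopology_def
  proof (intro conjI allI impI)
    fix S T assume S: "?P S" and T: "?P T"
    then show "S \<inter> T \<subseteq> (\<lambda>x. {x, - x}) ` topspace X" by blast
    have "{x \<in> topspace X. {x, - x} \<in> S \<inter> T} =
          {x \<in> topspace X. {x, - x} \<in> S} \<inter> {x \<in> topspace X. {x, - x} \<in> T}" by blast
    then show "openin X {x \<in> topspace X. {x, - x} \<in> S \<inter> T}"
      using S T by (simp only: openin_Int)
  next
    fix K assume K: "\<forall>S\<in>K. ?P S"
    then show "\<Union>K \<subseteq> (\<lambda>x. {x, - x}) ` topspace X" by blast
    have "{x \<in> topspace X. {x, - x} \<in> \<Union>K} = (\<Union>S\<in>K. {x \<in> topspace X. {x, - x} \<in> S})" by blast
    moreover have "openin X (\<Union>S\<in>K. {x \<in> topspace X. {x, - x} \<in> S})"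
      using K by (intro openin_Union) blast
    ultimately show "openin X {x \<in> topspace X. {x, - x} \<in> \<Union>K}" by (simp only:)
  qed
  then show ?thesis
    unfolding antipodal_quotient_def by (simp only: topology_inverse')
qed

text \<open>The infinite sphere, with the direct limit topology of the finite-dimensional spheres.\<close>

definition infinite_sphere :: "(nat \<Rightarrow> real) topology" where
  "infinite_sphere =
     topology (\<lambda>U. U \<subseteq> (\<Union>n. topspace (nsphere n)) \<and>
                   (\<forall>n. openin (nsphere n) (U \<inter> topspace (nsphere n))))"

lemma openin_infinite_sphere:
  "openin infinite_sphere U \<longleftrightarrow>
     U \<subseteq> (\<Union>n. topspace (nsphere n)) \<and>
     (\<forall>n. openin (nsphere n) (U \<inter> topspace (nsphere n)))"
proof -
  let ?P = "\<lambda>U. U \<subseteq> (\<Union>n. topspace (nsphere n)) \<and>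
                (\<forall>n. openin (nsphere n) (U \<inter> topspace (nsphere n)))"
  have "istopology ?P"
    unfolding istopology_def
  proof (intro conjI allI impI)
    fix S T assume S: "?P S" and T: "?P T"
    then show "S \<inter> T \<subseteq> (\<Union>n. topspace (nsphere n))" by blast
    fix n
    have "S \<inter> T \<inter> topspace (nsphere n) =
          (S \<inter> topspace (nsphere n)) \<inter> (T \<inter> topspace (nsphere n))" by blast
    then show "openin (nsphere n) (S \<inter> T \<inter> topspace (nsphere n))"
      using S T by (simp only: openin_Int)
  next
    fix K assume K: "\<forall>S\<in>K. ?P S"
    then show "\<Union>K \<subseteq> (\<Union>n. topspace (nsphere n))" by blast
    fix n
    have "\<Union>K \<inter> topspace (nsphere n) = (\<Union>S\<in>K. S \<inter> topspace (nsphere n))" by blast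
    moreover have "openin (nsphere n) (\<Union>S\<in>K. S \<inter> topspace (nsphere n))"
      using K by (intro openin_Union) blast
    ultimately show "openin (nsphere n) (\<Union>K \<inter> topspace (nsphere n))" by (simp only:)
  qed
  then show ?thesis
    unfolding infinite_sphere_def by (simp only: topology_inverse')
qed

definition RP_infinity :: "(nat \<Rightarrow> real) set topology" where
  "RP_infinity = antipodal_quotient infinite_sphere"

text \<open>The generator: the only nonzero class of degree one.\<close>

definition RP_omega :: "((nat \<Rightarrow> real) set list \<Rightarrow> bit) set" where
  "RP_omega = (THE a. a \<in> as_cohomology RP_infinity 1 \<and> a \<noteq> as_zero RP_infinity 1)"


section \<open>The cohomological index of Fadell and Rabinowitz\<close>

definition symmetric_set :: "'a::uminus set \<Rightarrow> bool" where
  "symmetric_set A \<longleftrightarrow> uminus ` A = A"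

text \<open>
  A map from the orbit space of \<open>A\<close> to \<open>RP_infinity\<close> classifies the double cover of the orbit space by
  \<open>A\<close> if it is covered by a bundle map, that is, by a continuous odd map from \<open>A\<close> to the infinite
  sphere. Such maps exist and are unique up to homotopy, since \<open>A\<close> is metrizable and misses 0;
  hence the choice of the classifying map in the index is immaterial.
\<close>

definition classifying_map ::
  "'a::real_normed_vector set \<Rightarrow> ('a set \<Rightarrow> (nat \<Rightarrow> real) set) \<Rightarrow> bool" where
  "classifying_map A f \<longleftrightarrow>
     continuous_map (antipodal_quotient (top_of_set A)) RP_infinity f \<and>
     (\<exists>F. continuous_map (top_of_set A) infinite_sphere F \<and>
          (\<forall>u\<in>A. F (- u) = - F u) \<and>
          (\<forall>u\<in>A. f {u, - u} = {F u, - F u}))"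

definition cohomological_index :: "'a::real_normed_vector set \<Rightarrow> enat" where
  "cohomological_index A =
     (if A = {} then 0
      else Sup {enat m | m. m \<ge> 1 \<and>
             (\<exists>f. classifying_map A f \<and>
                  as_induced (antipodal_quotient (top_of_set A)) (m - 1) f
                    (as_power RP_infinity RP_omega (m - 1))
                  \<noteq> as_zero (antipodal_quotient (top_of_set A)) (m - 1))})"


section \<open>Scalings and scaled functionals on a reflexive space\<close>

text \<open>Surjectivity of the canonical embedding into the bidual of the space \<open>'a\<close>.\<close>

definition reflexive_space :: "'a::real_normed_vector itself \<Rightarrow> bool" where
  "reflexive_space _ \<longleftrightarrow>
     (\<forall>\<Xi> :: ('a \<Rightarrow>\<^sub>L real) \<Rightarrow>\<^sub>L real. \<exists>x. \<forall>f. blinfun_apply \<Xi> f = blinfun_apply f x)"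

text \<open>Only the values \<open>\<sigma> u t\<close> with \<open>t \<ge> 0\<close> are relevant.\<close>

definition is_scaling :: "('a::real_normed_vector \<Rightarrow> real \<Rightarrow> 'a) \<Rightarrow> real \<Rightarrow> bool" where
  "is_scaling \<sigma> s \<longleftrightarrow>
     continuous_on (UNIV \<times> {0..}) (\<lambda>(u, t). \<sigma> u t) \<and>
     (\<forall>u. \<forall>t1\<ge>0. \<forall>t2\<ge>0. \<sigma> (\<sigma> u t1) t2 = \<sigma> u (t1 * t2)) \<and>
     (\<forall>u \<tau>. \<forall>t\<ge>0. \<sigma> (\<tau> *\<^sub>R u) t = \<tau> *\<^sub>R \<sigma> u t) \<and>
     (\<forall>u. \<sigma> u 0 = 0 \<and> \<sigma> u 1 = u) \<and>
     (\<forall>S. S \<subseteq> UNIV \<times> {0..} \<and> bounded S \<longrightarrow> bounded ((\<lambda>(u, t). \<sigma> u t) ` S)) \<and>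
     s > 0 \<and>
     (\<forall>S. bounded S \<longrightarrow> (\<exists>C. \<forall>\<^sub>F t in at_top. \<forall>u\<in>S. norm (\<sigma> u t) \<le> C * t powr s))"

definition scaled_functional ::
  "('a::real_normed_vector \<Rightarrow> real \<Rightarrow> 'a) \<Rightarrow> real \<Rightarrow> ('a \<Rightarrow> real) \<Rightarrow> bool" where
  "scaled_functional \<sigma> s I \<longleftrightarrow>
     continuous_on UNIV I \<and>
     (\<forall>u. I (- u) = I u) \<and>
     (\<forall>u. \<forall>t\<ge>0. I (\<sigma> u t) = t powr s * I u) \<and>
     (\<forall>u. u \<noteq> 0 \<longrightarrow> I u > 0)"

definition unit_level :: "('a \<Rightarrow> real) \<Rightarrow> 'a set" where
  "unit_level I = {u. I u = 1}"

definition meets_rays_once :: "'a::real_vector set \<Rightarrow> bool" where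
  "meets_rays_once M \<longleftrightarrow> (\<forall>u. u \<noteq> 0 \<longrightarrow> (\<exists>!v. v \<in> {t *\<^sub>R u | t. t \<ge> 0} \<inter> M))"


section \<open>Minimax levels and critical values\<close>

definition C1_functional ::
  "('a::real_normed_vector \<Rightarrow> real) \<Rightarrow> ('a \<Rightarrow> ('a \<Rightarrow>\<^sub>L real)) \<Rightarrow> bool" where
  "C1_functional \<Phi> \<Phi>' \<longleftrightarrow>
     (\<forall>u. (\<Phi> has_derivative blinfun_apply (\<Phi>' u)) (at u)) \<and> continuous_on UNIV \<Phi>'"

text \<open>
  Levels are extended reals because a minimax level is an infimum of suprema that may be infinite;
  at a finite level this is the usual condition, and a critical value is always finite.
\<close>

definition PS_condition ::
  "('a::real_normed_vector \<Rightarrow> real) \<Rightarrow> ('a \<Rightarrow> ('a \<Rightarrow>\<^sub>L real)) \<Rightarrow> ereal \<Rightarrow> bool" where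
  "PS_condition \<Phi> \<Phi>' c \<longleftrightarrow>
     (\<forall>u :: nat \<Rightarrow> 'a.
        (\<lambda>j. ereal (\<Phi> (u j))) \<longlonglongrightarrow> c \<and> (\<lambda>j. \<Phi>' (u j)) \<longlonglongrightarrow> 0 \<longrightarrow>
        (\<exists>l r. strict_mono r \<and> (u \<circ> r) \<longlonglongrightarrow> l))"

definition critical_value ::
  "('a::real_normed_vector \<Rightarrow> real) \<Rightarrow> ('a \<Rightarrow> ('a \<Rightarrow>\<^sub>L real)) \<Rightarrow> ereal \<Rightarrow> bool" where
  "critical_value \<Phi> \<Phi>' c \<longleftrightarrow> (\<exists>u. ereal (\<Phi> u) = c \<and> \<Phi>' u = 0)"

definition admissible_maps :: "'a::topological_space set \<Rightarrow> 'a set \<Rightarrow> ('a \<Rightarrow> 'a) set" where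
  "admissible_maps X A =
     {\<gamma>. continuous_on X \<gamma> \<and> closed (\<gamma> ` X) \<and> (\<forall>u\<in>A. \<gamma> u = u)}"

definition minimax_level ::
  "('a::topological_space \<Rightarrow> real) \<Rightarrow> 'a set \<Rightarrow> 'a set \<Rightarrow> ereal" where
  "minimax_level \<Phi> X A = (INF \<gamma>\<in>admissible_maps X A. SUP u\<in>\<gamma> ` X. ereal (\<Phi> u))"

end

theory Submission
  imports Defs
begin

text \<open>
  The level \<open>c\<close> is bounded below by the values of \<open>\<Phi>\<close> on \<open>B\<close> because the image of every competing map
  meets \<open>B\<close>, and a level with this property that were regular could be lowered by a deformation.

  \<^emph>\<open>Linking.\<close> Suppose that \<open>\<gamma>\<close> fixes \<open>A\<close> and that its image misses \<open>B\<close>, hence also the origin.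
  Projecting along the orbits of the scaling onto \<open>M\<close> turns \<open>\<gamma>\<close> into a map with values in
  \<open>Y = M - B0\<close>; along the cone \<open>X\<close> over \<open>A0\<close> it joins the inclusion of \<open>A0\<close> into \<open>Y\<close> to a constant.
  This null-homotopy is not equivariant, and that is the point: a symmetric set that can be contracted
  inside a larger one of finite index has strictly smaller index
  (\<open>index_not_preserved_by_nullhomotopic_inclusion\<close>).
  In the classical argument the null-homotopy and its reflection together map the suspension of \<open>A0\<close>
  into \<open>Y\<close>. Here the same fact comes from the transfer of the double cover of the orbit space.
  On the cover the characteristic class \<open>w\<close> becomes the coboundary of a function \<open>G\<close> with
  \<open>G (- u) = G u + 1\<close>. If \<open>w\<close> to the power \<open>k + 1\<close> is the coboundary of \<open>\<psi>\<close> on the orbit space of \<open>Y\<close>,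
  then \<open>z = G dG ... dG + \<psi>\<close> is a cocycle on \<open>Y\<close>, and the sum of \<open>z\<close> and its reflection is the pullback
  of the \<open>k\<close>-th power of \<open>w\<close>. On \<open>A0\<close> homotopy invariance makes \<open>z\<close> the coboundary of some \<open>\<eta>\<close>, and
  \<open>\<eta>\<close> plus its reflection descends to the orbit space of \<open>A0\<close>
  (\<open>nullhomotopic_cup_power_vanishes\<close>).

  All cohomology is computed with explicit cochains. Homotopy invariance on a metric
  space (\<open>homotopic_cohomologous\<close>) is a prism construction whose subdivision of the unit interval varies
  from point to point. The generator of the degree-one cohomology of infinite projective space is
  identified by holonomy along an explicit contraction of the infinite sphere (\<open>RP_omega_class\<close>), and
  classifying maps exist because every open cover of a normed space has a countable system of discrete
  families of bump functions (\<open>bump_system_exists\<close>, \<open>exists_odd_map_to_sphere\<close>).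

  \<^emph>\<open>Deformation.\<close> If \<open>c\<close> is regular, the Palais--Smale condition bounds the derivative from below near the
  level \<open>c\<close>, and there is a locally Lipschitz field \<open>V\<close> whose negative points downhill. Instead of solving an
  ordinary differential equation one follows polygons: from \<open>x\<close> move to \<open>x - \<tau> x *\<^sub>R V x\<close>, with a step length
  \<open>\<tau>\<close> so small that a step is a Lipschitz homeomorphism. Polygons never get stuck, so they define a
  continuous deformation; it moves a band around the level \<open>c\<close> below \<open>c\<close> and maps closed sets to closed
  sets (\<open>closed_flow_image\<close>, \<open>deformation\<close>).

  \<^emph>\<open>Conclusion.\<close> If \<open>\<Phi>\<close> stays strictly below \<open>c\<close> on \<open>A\<close>, deforming an almost optimal map contradicts
  the choice of \<open>c\<close>. Otherwise the supremum over \<open>A\<close>, the infimum over \<open>B\<close> and \<open>c\<close> coincide. Then the outer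
  half of the cone is used as a collar, on which the points of \<open>A\<close> flow down for a time that decreases to
  zero at the rim. The resulting map still fixes \<open>A\<close>, but it takes values below \<open>c\<close> except on \<open>A\<close>
  itself, which is disjoint from \<open>B\<close>. So its image misses \<open>B\<close>, contrary to the linking.
\<close>

section \<open>Cochains modulo two\<close>

text \<open>
  The sums below are rearranged as sums in a field; rewriting them into bit operations would block that.
\<close>

declare add_bit_eq_xor [simp del] mult_bit_eq_and [simp del]

lemma bit_add_self [simp]: "x + x = (0::bit)"
  by (cases x) auto

lemma bit_add_self_left [simp]: "x + (x + y) = (y::bit)"
  by (simp flip: add.assoc)

lemma bit_add_eq_0_iff: "x + y = 0 \<longleftrightarrow> x = (y::bit)"
  by (cases x; cases y) auto

lemma sum_bit_add: "(\<Sum>i<n. f i + f (Suc i)) = f 0 + (f n :: bit)"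
  by (induction n) (auto simp: ac_simps)

lemma as_delta_Nil [simp]: "as_delta \<phi> [] = 0"
  by (simp add: as_delta_def)

text \<open>
  Splitting off the first face allows identities between cochains to be proved by induction on the list,
  with the first argument fixed in the induction hypothesis.
\<close>

lemma as_delta_Cons: "as_delta \<phi> (x # xs) = \<phi> xs + as_delta (\<lambda>ys. \<phi> (x # ys)) xs"
  by (simp add: as_delta_def lessThan_Suc_eq_insert_0 sum.reindex zero_notin_Suc_image)

lemma as_delta_singleton [simp]: "as_delta \<phi> [x] = \<phi> []"
  by (simp add: as_delta_Cons)

lemma as_delta_pair [simp]: "as_delta \<phi> [x, y] = \<phi> [y] + \<phi> [x]"
  by (simp add: as_delta_Cons)

lemma as_delta_cong:
  assumes "\<And>ys. \<lbrakk>length ys = length xs - 1; set ys \<subseteq> set xs\<rbrakk> \<Longrightarrow> \<phi> ys = \<psi> ys"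
  shows "as_delta \<phi> xs = as_delta \<psi> xs"
  unfolding as_delta_def
proof (rule sum.cong)
  fix i assume "i \<in> {..<length xs}"
  moreover have "set (take i xs @ drop (Suc i) xs) \<subseteq> set xs"
    using set_take_subset set_drop_subset by fastforce
  ultimately show "\<phi> (take i xs @ drop (Suc i) xs) = \<psi> (take i xs @ drop (Suc i) xs)"
    by (intro assms) auto
qed simp

lemma as_delta_add: "as_delta (\<lambda>xs. \<phi> xs + \<psi> xs) xs = as_delta \<phi> xs + as_delta \<psi> xs"
  by (simp add: as_delta_def sum.distrib)

lemma as_delta_sum: "as_delta (\<lambda>xs. \<Sum>j\<in>J. \<phi> j xs) xs = (\<Sum>j\<in>J. as_delta (\<phi> j) xs)"
  by (simp add: as_delta_def sum.swap [of _ J])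

lemma as_delta_zero [simp]: "as_delta (\<lambda>xs. 0) xs = 0"
  by (simp add: as_delta_def)

lemma as_delta_mult_left: "as_delta (\<lambda>xs. c * \<phi> xs) xs = c * as_delta \<phi> xs"
  by (simp add: as_delta_def sum_distrib_left)

lemma as_delta_map: "as_delta (\<lambda>xs. \<phi> (map f xs)) xs = as_delta \<phi> (map f xs)"
  by (simp add: as_delta_def take_map drop_map)

lemma as_delta_delta: "as_delta (as_delta \<phi>) xs = 0"
proof (induction xs arbitrary: \<phi>)
  case (Cons x xs)
  then show ?case by (simp add: as_delta_Cons as_delta_add)
qed simp

definition cup :: "nat \<Rightarrow> ('a list \<Rightarrow> bit) \<Rightarrow> ('a list \<Rightarrow> bit) \<Rightarrow> 'a list \<Rightarrow> bit" where
  "cup p \<phi> \<psi> xs = \<phi> (take (Suc p) xs) * \<psi> (drop p xs)"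

text \<open>
  The Leibniz rule. The last face of the front part and the first face of the back part give the same
  term twice, which cancels.
\<close>

lemma as_delta_cup:
  "length xs \<ge> p + 2 \<Longrightarrow>
     as_delta (cup p \<phi> \<psi>) xs = cup (Suc p) (as_delta \<phi>) \<psi> xs + cup p \<phi> (as_delta \<psi>) xs"
proof (induction p arbitrary: xs \<phi>)
  case 0
  then obtain x y zs where "xs = x # y # zs"
    by (cases xs; cases "tl xs") auto
  then show ?case
    by (simp add: cup_def as_delta_Cons as_delta_add as_delta_mult_left algebra_simps)
next
  case (Suc p)
  then obtain x ys where xs: "xs = x # ys"
    by (cases xs) auto
  have *: "(\<lambda>ys. cup (Suc p) \<phi> \<psi> (x # ys)) = cup p (\<lambda>ys. \<phi> (x # ys)) \<psi>"
    by (simp add: cup_def fun_eq_iff)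
  have "as_delta (cup (Suc p) \<phi> \<psi>) xs =
      cup (Suc p) \<phi> \<psi> ys + as_delta (cup p (\<lambda>ys. \<phi> (x # ys)) \<psi>) ys"
    by (simp add: xs as_delta_Cons *)
  also have "\<dots> = cup (Suc p) \<phi> \<psi> ys + cup (Suc p) (as_delta (\<lambda>ys. \<phi> (x # ys))) \<psi> ys
       + cup p (\<lambda>ys. \<phi> (x # ys)) (as_delta \<psi>) ys"
    using Suc.prems by (subst Suc.IH) (auto simp: xs add.assoc)
  also have "\<dots> = cup (Suc (Suc p)) (as_delta \<phi>) \<psi> xs + cup (Suc p) \<phi> (as_delta \<psi>) xs"
    by (simp add: cup_def xs as_delta_Cons [of \<phi>] distrib_right)
  finally show ?case .
qed

text \<open>
  The prism over the simplex \<open>xs\<close> between its images under \<open>f\<close> and \<open>g\<close>: the sum of \<open>z\<close> over the lists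
  that follow \<open>f\<close> up to some vertex and \<open>g\<close> from this vertex on.
\<close>

primrec prism :: "('a \<Rightarrow> 'b) \<Rightarrow> ('a \<Rightarrow> 'b) \<Rightarrow> ('b list \<Rightarrow> bit) \<Rightarrow> 'a list \<Rightarrow> bit" where
  "prism f g z [] = 0"
| "prism f g z (x # xs) = z (f x # g x # map g xs) + prism f g (\<lambda>ys. z (f x # ys)) xs"

lemma prism_add: "prism f g (\<lambda>ys. z ys + z' ys) xs = prism f g z xs + prism f g z' xs"
  by (induction xs arbitrary: z z') (auto simp: ac_simps)

lemma prism_cong:
  assumes "\<And>x. x \<in> set xs \<Longrightarrow> f x = f' x" "\<And>x. x \<in> set xs \<Longrightarrow> g x = g' x"
  shows "prism f g z xs = prism f' g' z xs"
  using assms by (induction xs arbitrary: z) (auto cong: map_cong)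

lemma prism_eq_0:
  assumes "\<And>ys. \<lbrakk>length ys = Suc (length xs); set ys \<subseteq> f ` set xs \<union> g ` set xs\<rbrakk> \<Longrightarrow> z ys = 0"
  shows "prism f g z xs = 0"
  using assms
proof (induction xs arbitrary: z)
  case (Cons x xs)
  have "prism f g (\<lambda>ys. z (f x # ys)) xs = 0"
    by (rule Cons.IH, rule Cons.prems) auto
  moreover have "z (f x # g x # map g xs) = 0"
    by (rule Cons.prems) auto
  ultimately show ?case by simp
qed simp

text \<open>
  The boundary of a prism consists of its bottom, its top and the prism over the boundary.
\<close>

lemma prism_homotopy:
  "as_delta (prism f g z) xs + prism f g (as_delta z) xs = z (map f xs) + z (map g xs)"
proof (induction xs arbitrary: z)
  case (Cons x xs)
  have "as_delta (prism f g z) (x # xs) =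
      prism f g z xs + as_delta (\<lambda>ys. z (f x # g x # ys)) (map g xs)
        + as_delta (prism f g (\<lambda>ys. z (f x # ys))) xs"
    by (simp add: as_delta_Cons as_delta_add as_delta_map [symmetric] add.assoc)
  moreover have "prism f g (as_delta z) (x # xs) =
      z (g x # map g xs) + z (f x # map g xs) + as_delta (\<lambda>ys. z (f x # g x # ys)) (map g xs)
        + prism f g z xs + prism f g (as_delta (\<lambda>ys. z (f x # ys))) xs"
    by (simp add: as_delta_Cons prism_add add.assoc)
  moreover have "(p + d + u) + (b + c + d + p + v) = b + c + (u + v)" for p d u b c v :: bit
    by (simp add: ac_simps)
  ultimately have "as_delta (prism f g z) (x # xs) + prism f g (as_delta z) (x # xs) =
      z (g x # map g xs) + z (f x # map g xs)
        + (as_delta (prism f g (\<lambda>ys. z (f x # ys))) xs + prism f g (as_delta (\<lambda>ys. z (f x # ys))) xs)"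
    by (simp only:)
  then show ?case
    by (simp only: Cons.IH [of "\<lambda>ys. z (f x # ys)"]) (simp add: ac_simps)
qed simp

text \<open>
  Near the diagonal: \<open>P\<close> holds for all lists of length \<open>n\<close> inside some neighbourhood of each point.
  This is the form in which the open covers of the definition of locally zero cochains are used.
\<close>

definition nearly :: "'a topology \<Rightarrow> nat \<Rightarrow> ('a list \<Rightarrow> bool) \<Rightarrow> bool" where
  "nearly X n P \<longleftrightarrow>
     (\<forall>x\<in>topspace X. \<exists>U. openin X U \<and> x \<in> U \<and>
        (\<forall>xs. length xs = n \<longrightarrow> set xs \<subseteq> U \<longrightarrow> P xs))"

lemma nearlyE:
  assumes "nearly X n P" "x \<in> topspace X"
  obtains U where "openin X U" "x \<in> U" "\<forall>xs. length xs = n \<longrightarrow> set xs \<subseteq> U \<longrightarrow> P xs"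
  using assms unfolding nearly_def by meson

lemma nearlyI:
  assumes "\<And>x. x \<in> topspace X \<Longrightarrow> \<exists>U. openin X U \<and> x \<in> U \<and> (\<forall>xs. length xs = n \<longrightarrow> set xs \<subseteq> U \<longrightarrow> P xs)"
  shows "nearly X n P"
  unfolding nearly_def by (intro ballI assms)

lemma as_locally_zero_iff_nearly: "as_locally_zero X q \<phi> \<longleftrightarrow> nearly X (Suc q) (\<lambda>xs. \<phi> xs = 0)"
proof
  assume "as_locally_zero X q \<phi>"
  then show "nearly X (Suc q) (\<lambda>xs. \<phi> xs = 0)"
    unfolding as_locally_zero_def nearly_def by blast
next
  assume *: "nearly X (Suc q) (\<lambda>xs. \<phi> xs = 0)"
  let ?U = "{U. openin X U \<and> (\<forall>xs. length xs = Suc q \<and> set xs \<subseteq> U \<longrightarrow> \<phi> xs = 0)}"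
  have "\<Union>?U = topspace X"
  proof
    show "\<Union>?U \<subseteq> topspace X" by (auto dest: openin_subset)
    show "topspace X \<subseteq> \<Union>?U"
    proof
      fix x assume "x \<in> topspace X"
      then obtain U where "openin X U" "x \<in> U" "\<forall>xs. length xs = Suc q \<and> set xs \<subseteq> U \<longrightarrow> \<phi> xs = 0"
        using nearlyE [OF *] by metis
      then show "x \<in> \<Union>?U" by (intro UnionI [of U]) simp_all
    qed
  qed
  then show "as_locally_zero X q \<phi>"
    unfolding as_locally_zero_def by (intro exI [of _ ?U] conjI) simp_all
qed

lemma nearly_mono:
  assumes "nearly X n P" "\<And>xs. \<lbrakk>length xs = n; set xs \<subseteq> topspace X; P xs\<rbrakk> \<Longrightarrow> Q xs"
  shows "nearly X n Q"
proof (rule nearlyI)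
  fix x assume "x \<in> topspace X"
  from nearlyE [OF assms(1) this] obtain U
    where U: "openin X U" "x \<in> U" "\<forall>xs. length xs = n \<longrightarrow> set xs \<subseteq> U \<longrightarrow> P xs" .
  have "Q xs" if "length xs = n" "set xs \<subseteq> U" for xs
    using that U openin_subset [OF U(1)] by (intro assms(2)) auto
  then show "\<exists>U. openin X U \<and> x \<in> U \<and> (\<forall>xs. length xs = n \<longrightarrow> set xs \<subseteq> U \<longrightarrow> Q xs)"
    using U by (intro exI [of _ U]) simp
qed

lemma nearly_conj:
  assumes "nearly X n P" "nearly X n Q"
  shows "nearly X n (\<lambda>xs. P xs \<and> Q xs)"
proof (rule nearlyI)
  fix x assume x: "x \<in> topspace X"
  from nearlyE [OF assms(1) x] obtain U
    where U: "openin X U" "x \<in> U" "\<forall>xs. length xs = n \<longrightarrow> set xs \<subseteq> U \<longrightarrow> P xs" .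
  from nearlyE [OF assms(2) x] obtain V
    where V: "openin X V" "x \<in> V" "\<forall>xs. length xs = n \<longrightarrow> set xs \<subseteq> V \<longrightarrow> Q xs" .
  show "\<exists>U. openin X U \<and> x \<in> U \<and> (\<forall>xs. length xs = n \<longrightarrow> set xs \<subseteq> U \<longrightarrow> P xs \<and> Q xs)"
    using U V by (intro exI [of _ "U \<inter> V"]) (simp add: openin_Int)
qed

lemma nearly_faces:
  assumes "nearly X n P" "\<And>xs. length xs = m \<Longrightarrow> length (r xs) = n" "\<And>xs. set (r xs) \<subseteq> set xs"
  shows "nearly X m (\<lambda>xs. P (r xs))"
proof (rule nearlyI)
  fix x assume "x \<in> topspace X"
  from nearlyE [OF assms(1) this] obtain U
    where U: "openin X U" "x \<in> U" "\<forall>xs. length xs = n \<longrightarrow> set xs \<subseteq> U \<longrightarrow> P xs" .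
  have "P (r xs)" if "length xs = m" "set xs \<subseteq> U" for xs
    using that U assms(2) [of xs] assms(3) [of xs] by simp
  then show "\<exists>U. openin X U \<and> x \<in> U \<and> (\<forall>xs. length xs = m \<longrightarrow> set xs \<subseteq> U \<longrightarrow> P (r xs))"
    using U by (intro exI [of _ U]) simp
qed

lemma nearly_pullback:
  assumes "nearly Y n P" "continuous_map X Y f"
  shows "nearly X n (\<lambda>xs. P (map f xs))"
proof (rule nearlyI)
  fix x assume x: "x \<in> topspace X"
  then have "f x \<in> topspace Y"
    using continuous_map_image_subset_topspace [OF assms(2)] by auto
  from nearlyE [OF assms(1) this] obtain U
    where U: "openin Y U" "f x \<in> U" "\<forall>xs. length xs = n \<longrightarrow> set xs \<subseteq> U \<longrightarrow> P xs" .
  let ?V = "{x \<in> topspace X. f x \<in> U}"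
  have "openin X ?V"
    using openin_continuous_map_preimage [OF assms(2) U(1)] .
  moreover have "P (map f xs)" if "length xs = n" "set xs \<subseteq> ?V" for xs
  proof -
    have "set (map f xs) \<subseteq> U" using that by auto
    then show ?thesis using U(3) that by simp
  qed
  ultimately show "\<exists>U. openin X U \<and> x \<in> U \<and> (\<forall>xs. length xs = n \<longrightarrow> set xs \<subseteq> U \<longrightarrow> P (map f xs))"
    using x U by (intro exI [of _ ?V]) simp
qed

lemma cocycles_iff: "\<phi> \<in> as_cocycles X q \<longleftrightarrow> nearly X (q + 2) (\<lambda>xs. as_delta \<phi> xs = 0)"
  by (simp add: as_cocycles_def as_locally_zero_iff_nearly)

text \<open>
  In degree 0 there are no coboundaries. The condition \<open>\<eta> [] = 0\<close> makes \<open>as_delta \<eta>\<close> vanish on lists of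
  length one, so that degree 0 needs no separate treatment; in positive degrees the value at the empty
  list does not enter the coboundary.
\<close>

definition cohomologous :: "'a topology \<Rightarrow> nat \<Rightarrow> ('a list \<Rightarrow> bit) \<Rightarrow> ('a list \<Rightarrow> bit) \<Rightarrow> bool" where
  "cohomologous X q \<phi> \<psi> \<longleftrightarrow>
     (\<exists>\<eta>. \<eta> [] = 0 \<and> nearly X (Suc q) (\<lambda>xs. \<phi> xs + \<psi> xs = as_delta \<eta> xs))"

lemma cohomologousI:
  "\<eta> [] = 0 \<Longrightarrow> nearly X (Suc q) (\<lambda>xs. \<phi> xs + \<psi> xs = as_delta \<eta> xs) \<Longrightarrow> cohomologous X q \<phi> \<psi>"
  unfolding cohomologous_def by (intro exI conjI)

lemma cohomologousE:
  assumes "cohomologous X q \<phi> \<psi>"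
  obtains \<eta> where "\<eta> [] = 0" "nearly X (Suc q) (\<lambda>xs. \<phi> xs + \<psi> xs = as_delta \<eta> xs)"
  using assms unfolding cohomologous_def by (elim exE conjE)

lemma coboundaries_iff: "(\<lambda>xs. \<phi> xs - \<psi> xs) \<in> as_coboundaries X q \<longleftrightarrow> cohomologous X q \<phi> \<psi>"
proof (cases "q = 0")
  case True
  have "as_delta \<eta> xs = 0" if "\<eta> [] = 0" "length xs = 1" for \<eta> :: "'a list \<Rightarrow> bit" and xs
    using that by (cases xs) auto
  then show ?thesis
    using True unfolding as_coboundaries_def cohomologous_def as_locally_zero_iff_nearly
    by (auto elim!: nearly_mono intro!: exI [of _ "\<lambda>xs. 0"])
next
  case False
  have *: "as_delta (\<lambda>xs. if xs = [] then 0 else \<eta> xs) xs = as_delta \<eta> xs"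
    if "length xs = Suc q" for \<eta> :: "'a list \<Rightarrow> bit" and xs
    using that False by (intro as_delta_cong) auto
  show ?thesis
  proof
    assume "(\<lambda>xs. \<phi> xs - \<psi> xs) \<in> as_coboundaries X q"
    then obtain \<eta> where \<eta>: "nearly X (Suc q) (\<lambda>xs. \<phi> xs + \<psi> xs + as_delta \<eta> xs = 0)"
      using False by (auto simp: as_coboundaries_def as_locally_zero_iff_nearly)
    show "cohomologous X q \<phi> \<psi>"
      unfolding cohomologous_def
      by (intro exI [of _ "\<lambda>xs. if xs = [] then 0 else \<eta> xs"] conjI nearly_mono [OF \<eta>])
        (use * in \<open>auto simp: bit_add_eq_0_iff\<close>)
  next
    assume "cohomologous X q \<phi> \<psi>"
    then show "(\<lambda>xs. \<phi> xs - \<psi> xs) \<in> as_coboundaries X q"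
      using False by (auto simp: as_coboundaries_def as_locally_zero_iff_nearly
          cohomologous_def bit_add_eq_0_iff)
  qed
qed

lemma cohomologous_refl: "cohomologous X q \<phi> \<phi>"
  unfolding cohomologous_def by (intro exI [of _ "\<lambda>xs. 0"]) (auto simp: nearly_def)

lemma cohomologous_nearly:
  "nearly X (Suc q) (\<lambda>xs. \<phi> xs = \<psi> xs) \<Longrightarrow> cohomologous X q \<phi> \<psi>"
  unfolding cohomologous_def by (intro exI [of _ "\<lambda>xs. 0"]) (auto elim!: nearly_mono)

lemma cohomologous_eq:
  "(\<And>xs. \<lbrakk>length xs = Suc q; set xs \<subseteq> topspace X\<rbrakk> \<Longrightarrow> \<phi> xs = \<psi> xs) \<Longrightarrow> cohomologous X q \<phi> \<psi>"
  by (rule cohomologous_nearly, rule nearlyI, rule exI [of _ "topspace X"]) simp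

lemma cohomologous_sym: "cohomologous X q \<phi> \<psi> \<Longrightarrow> cohomologous X q \<psi> \<phi>"
  unfolding cohomologous_def by (simp add: add.commute)

lemma cohomologous_add:
  assumes "cohomologous X q \<phi> \<psi>" "cohomologous X q \<phi>' \<psi>'"
  shows "cohomologous X q (\<lambda>xs. \<phi> xs + \<phi>' xs) (\<lambda>xs. \<psi> xs + \<psi>' xs)"
proof -
  from cohomologousE [OF assms(1)] obtain \<eta>
    where \<eta>: "\<eta> [] = 0" "nearly X (Suc q) (\<lambda>xs. \<phi> xs + \<psi> xs = as_delta \<eta> xs)" .
  from cohomologousE [OF assms(2)] obtain \<eta>'
    where \<eta>': "\<eta>' [] = 0" "nearly X (Suc q) (\<lambda>xs. \<phi>' xs + \<psi>' xs = as_delta \<eta>' xs)" .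
  show ?thesis
    by (rule cohomologousI [of "\<lambda>xs. \<eta> xs + \<eta>' xs"], simp add: \<eta> \<eta>',
        rule nearly_mono [OF nearly_conj [OF \<eta>(2) \<eta>'(2)]], elim conjE, drule sym, drule sym,
        simp add: as_delta_add ac_simps)
qed

lemma cohomologous_trans [trans]:
  assumes "cohomologous X q \<phi> \<psi>" "cohomologous X q \<psi> \<theta>"
  shows "cohomologous X q \<phi> \<theta>"
proof -
  have "cohomologous X q (\<lambda>xs. \<phi> xs + \<psi> xs) (\<lambda>xs. \<psi> xs + \<theta> xs)"
    using assms by (rule cohomologous_add)
  then show ?thesis
    by (simp add: cohomologous_def ac_simps)
qed

lemma cohomologous_pullback:
  assumes "cohomologous Y q \<phi> \<psi>" "continuous_map X Y f"
  shows "cohomologous X q (\<lambda>xs. \<phi> (map f xs)) (\<lambda>xs. \<psi> (map f xs))"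
proof -
  from cohomologousE [OF assms(1)] obtain \<eta>
    where \<eta>: "\<eta> [] = 0" "nearly Y (Suc q) (\<lambda>xs. \<phi> xs + \<psi> xs = as_delta \<eta> xs)" .
  show ?thesis
    by (rule cohomologousI [of "\<lambda>xs. \<eta> (map f xs)"], simp add: \<eta>,
        rule nearly_mono [OF nearly_pullback [OF \<eta>(2) assms(2)]], simp only: as_delta_map)
qed

lemma cocycle_pullback:
  assumes "\<phi> \<in> as_cocycles Y q" "continuous_map X Y f"
  shows "(\<lambda>xs. \<phi> (map f xs)) \<in> as_cocycles X q"
  using nearly_pullback [OF assms(1) [unfolded cocycles_iff] assms(2)]
  by (simp add: cocycles_iff as_delta_map)

lemma cocycle_zero [simp]: "(\<lambda>xs. 0) \<in> as_cocycles X q"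
  by (auto simp: cocycles_iff nearly_def)

lemma cocycle_one: "(\<lambda>xs. 1) \<in> as_cocycles X 0"
  by (auto simp: cocycles_iff nearly_def as_delta_def)

text \<open>
  Both factors are evaluated on sublists, and sublists of small lists are small.
\<close>

lemma cocycle_cup:
  assumes "\<phi> \<in> as_cocycles X p" "\<psi> \<in> as_cocycles X q"
  shows "cup p \<phi> \<psi> \<in> as_cocycles X (p + q)"
proof -
  have 1: "nearly X (p + q + 2) (\<lambda>xs. as_delta \<phi> (take (p + 2) xs) = 0)"
    by (rule nearly_faces [OF assms(1) [unfolded cocycles_iff]]) (auto dest: in_set_takeD)
  have 2: "nearly X (p + q + 2) (\<lambda>xs. as_delta \<psi> (drop p xs) = 0)"
    by (rule nearly_faces [OF assms(2) [unfolded cocycles_iff]]) (auto dest: in_set_dropD)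
  show ?thesis
    unfolding cocycles_iff
    by (rule nearly_mono [OF nearly_conj [OF 1 2]]) (auto simp: as_delta_cup, simp add: cup_def)
qed

text \<open>
  One factor is changed at a time; by the Leibniz rule the product of a cocycle and a primitive is a
  primitive of the product. In degree 0 cohomologous cocycles agree near the diagonal.
\<close>

lemma cohomologous_cup:
  assumes "cohomologous X p \<phi> \<phi>'" "cohomologous X q \<psi> \<psi>'"
    and "\<phi> \<in> as_cocycles X p" "\<psi>' \<in> as_cocycles X q"
  shows "cohomologous X (p + q) (cup p \<phi> \<psi>) (cup p \<phi>' \<psi>')"
proof -
  from cohomologousE [OF assms(1)] obtain \<alpha>
    where \<alpha>: "\<alpha> [] = 0" "nearly X (Suc p) (\<lambda>xs. \<phi> xs + \<phi>' xs = as_delta \<alpha> xs)" .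
  from cohomologousE [OF assms(2)] obtain \<beta>
    where \<beta>: "\<beta> [] = 0" "nearly X (Suc q) (\<lambda>xs. \<psi> xs + \<psi>' xs = as_delta \<beta> xs)" .
  have 1: "nearly X (Suc (p + q)) (\<lambda>xs. \<phi> (take (Suc p) xs) + \<phi>' (take (Suc p) xs) = as_delta \<alpha> (take (Suc p) xs))"
    by (rule nearly_faces [OF \<alpha>(2)]) (auto dest: in_set_takeD)
  have 2: "nearly X (Suc (p + q)) (\<lambda>xs. \<psi> (drop p xs) + \<psi>' (drop p xs) = as_delta \<beta> (drop p xs))"
    by (rule nearly_faces [OF \<beta>(2)]) (auto dest: in_set_dropD)
  have c1: "cohomologous X (p + q) (cup p \<phi> \<psi>) (cup p \<phi> \<psi>')"
  proof (cases "q = 0")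
    case True
    have "nearly X (Suc (p + q)) (\<lambda>xs. cup p \<phi> \<psi> xs = cup p \<phi> \<psi>' xs)"
    proof (rule nearly_mono [OF 2])
      fix xs :: "'a list"
      assume "length xs = Suc (p + q)" and *: "\<psi> (drop p xs) + \<psi>' (drop p xs) = as_delta \<beta> (drop p xs)"
      then have "length (drop p xs) = 1" using True by simp
      then have "as_delta \<beta> (drop p xs) = 0" using \<beta>(1) by (cases "drop p xs") auto
      with * show "cup p \<phi> \<psi> xs = cup p \<phi> \<psi>' xs" by (simp add: cup_def bit_add_eq_0_iff)
    qed
    then show ?thesis by (rule cohomologous_nearly)
  next
    case False
    have 3: "nearly X (Suc (p + q)) (\<lambda>xs. as_delta \<phi> (take (p + 2) xs) = 0)"
      using False
      by (intro nearly_faces [OF assms(3) [unfolded cocycles_iff]]) (auto dest: in_set_takeD)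
    have "nearly X (Suc (p + q)) (\<lambda>xs. cup p \<phi> \<psi> xs + cup p \<phi> \<psi>' xs = as_delta (cup p \<phi> \<beta>) xs)"
    proof (rule nearly_mono [OF nearly_conj [OF 2 3]])
      fix xs :: "'a list"
      assume "length xs = Suc (p + q)"
        and *: "\<psi> (drop p xs) + \<psi>' (drop p xs) = as_delta \<beta> (drop p xs) \<and> as_delta \<phi> (take (p + 2) xs) = 0"
      then have "as_delta (cup p \<phi> \<beta>) xs = cup p \<phi> (as_delta \<beta>) xs"
        using False by (subst as_delta_cup) (auto, simp add: cup_def)
      with * show "cup p \<phi> \<psi> xs + cup p \<phi> \<psi>' xs = as_delta (cup p \<phi> \<beta>) xs"
        by (simp add: cup_def flip: distrib_left)
    qed
    then show ?thesis
      by (rule cohomologousI [rotated]) (simp add: cup_def \<beta>(1))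
  qed
  have c2: "cohomologous X (p + q) (cup p \<phi> \<psi>') (cup p \<phi>' \<psi>')"
  proof (cases p)
    case 0
    have "nearly X (Suc (p + q)) (\<lambda>xs. cup p \<phi> \<psi>' xs = cup p \<phi>' \<psi>' xs)"
    proof (rule nearly_mono [OF 1])
      fix xs :: "'a list"
      assume "length xs = Suc (p + q)"
       and *: "\<phi> (take (Suc p) xs) + \<phi>' (take (Suc p) xs) = as_delta \<alpha> (take (Suc p) xs)"
      then have "length (take (Suc p) xs) = 1" using 0 by simp
      then have "as_delta \<alpha> (take (Suc p) xs) = 0" using \<alpha>(1) by (cases "take (Suc p) xs") auto
      with * show "cup p \<phi> \<psi>' xs = cup p \<phi>' \<psi>' xs" by (simp add: cup_def bit_add_eq_0_iff)
    qed
    then show ?thesis by (rule cohomologous_nearly)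
  next
    case (Suc p')
    have 3: "nearly X (Suc (p + q)) (\<lambda>xs. as_delta \<psi>' (drop p' xs) = 0)"
      using Suc
      by (intro nearly_faces [OF assms(4) [unfolded cocycles_iff]]) (auto dest: in_set_dropD)
    have "nearly X (Suc (p + q)) (\<lambda>xs. cup p \<phi> \<psi>' xs + cup p \<phi>' \<psi>' xs = as_delta (cup p' \<alpha> \<psi>') xs)"
    proof (rule nearly_mono [OF nearly_conj [OF 1 3]])
      fix xs :: "'a list"
      assume "length xs = Suc (p + q)"
        and *: "\<phi> (take (Suc p) xs) + \<phi>' (take (Suc p) xs) = as_delta \<alpha> (take (Suc p) xs)
                \<and> as_delta \<psi>' (drop p' xs) = 0"
      then have "as_delta (cup p' \<alpha> \<psi>') xs = cup p (as_delta \<alpha>) \<psi>' xs"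
        using Suc by (subst as_delta_cup) (auto, simp add: cup_def)
      with * show "cup p \<phi> \<psi>' xs + cup p \<phi>' \<psi>' xs = as_delta (cup p' \<alpha> \<psi>') xs"
        by (simp add: cup_def flip: distrib_right)
    qed
    then show ?thesis
      by (rule cohomologousI [rotated]) (simp add: cup_def \<alpha>(1))
  qed
  show ?thesis using c1 c2 by (rule cohomologous_trans)
qed

definition as_class :: "'a topology \<Rightarrow> nat \<Rightarrow> ('a list \<Rightarrow> bit) \<Rightarrow> ('a list \<Rightarrow> bit) set" where
  "as_class X q \<phi> = as_rel X q `` {\<phi>}"

lemma as_rel_iff:
  "(\<phi>, \<psi>) \<in> as_rel X q \<longleftrightarrow>
     \<phi> \<in> as_cocycles X q \<and> \<psi> \<in> as_cocycles X q \<and> cohomologous X q \<phi> \<psi>"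
  by (simp add: as_rel_def coboundaries_iff del: minus_bit_def)

lemma mem_as_class_iff:
  "\<psi> \<in> as_class X q \<phi> \<longleftrightarrow>
     \<phi> \<in> as_cocycles X q \<and> \<psi> \<in> as_cocycles X q \<and> cohomologous X q \<phi> \<psi>"
  by (simp add: as_class_def as_rel_iff)

lemma as_zero_eq: "as_zero X q = as_class X q (\<lambda>xs. 0)"
  by (simp add: as_zero_def as_class_def)

lemma as_class_eq_iff:
  assumes "\<phi> \<in> as_cocycles X q" "\<psi> \<in> as_cocycles X q"
  shows "as_class X q \<phi> = as_class X q \<psi> \<longleftrightarrow> cohomologous X q \<phi> \<psi>"
proof
  assume "as_class X q \<phi> = as_class X q \<psi>"
  then show "cohomologous X q \<phi> \<psi>"
    using assms cohomologous_refl cohomologous_sym by (metis mem_as_class_iff)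
next
  assume "cohomologous X q \<phi> \<psi>"
  then show "as_class X q \<phi> = as_class X q \<psi>"
    using assms cohomologous_trans cohomologous_sym unfolding set_eq_iff mem_as_class_iff by metis
qed

text \<open>
  Products and induced maps are defined through all pairs of representatives; saturating such a set of
  mutually cohomologous cocycles gives a single class.
\<close>

lemma as_rel_Image_eq_class:
  assumes "\<phi> \<in> S" "\<phi> \<in> as_cocycles X q" "\<And>\<psi>. \<psi> \<in> S \<Longrightarrow> cohomologous X q \<phi> \<psi>"
  shows "as_rel X q `` S = as_class X q \<phi>"
  using assms cohomologous_trans unfolding set_eq_iff mem_as_class_iff Image_iff as_rel_iff by metis

lemma as_cohomology_eq: "as_cohomology X q = as_class X q ` as_cocycles X q"
  by (auto simp: as_cohomology_def quotient_def as_class_def)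

lemma as_cup_class:
  assumes "\<phi> \<in> as_cocycles X p" "\<psi> \<in> as_cocycles X q"
  shows "as_cup X p q (as_class X p \<phi>) (as_class X q \<psi>) = as_class X (p + q) (cup p \<phi> \<psi>)"
  unfolding as_cup_def
proof (rule as_rel_Image_eq_class)
  show "cup p \<phi> \<psi> \<in> {\<lambda>xs. \<phi>' (take (Suc p) xs) * \<psi>' (drop p xs) |\<phi>' \<psi>'. \<phi>' \<in> as_class X p \<phi> \<and> \<psi>' \<in> as_class X q \<psi>}"
    unfolding mem_Collect_eq
    by (intro exI [of _ \<phi>] exI [of _ \<psi>])
      (use assms in \<open>simp add: mem_as_class_iff cohomologous_refl cup_def fun_eq_iff\<close>)
  show "cup p \<phi> \<psi> \<in> as_cocycles X (p + q)"
    using assms by (rule cocycle_cup)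
  fix \<theta> assume "\<theta> \<in> {\<lambda>xs. \<phi>' (take (Suc p) xs) * \<psi>' (drop p xs) |\<phi>' \<psi>'. \<phi>' \<in> as_class X p \<phi> \<and> \<psi>' \<in> as_class X q \<psi>}"
  then obtain \<phi>' \<psi>' where "\<theta> = cup p \<phi>' \<psi>'" "\<phi>' \<in> as_class X p \<phi>" "\<psi>' \<in> as_class X q \<psi>"
    by (auto simp: cup_def fun_eq_iff)
  then show "cohomologous X (p + q) (cup p \<phi> \<psi>) \<theta>"
    by (simp add: mem_as_class_iff cohomologous_cup)
qed

lemma as_induced_class:
  assumes "\<phi> \<in> as_cocycles Y q" "continuous_map X Y f"
  shows "as_induced X q f (as_class Y q \<phi>) = as_class X q (\<lambda>xs. \<phi> (map f xs))"
  unfolding as_induced_def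
proof (rule as_rel_Image_eq_class)
  show "(\<lambda>xs. \<phi> (map f xs)) \<in> as_cocycles X q"
    using assms by (rule cocycle_pullback)
qed (use assms in \<open>auto simp: mem_as_class_iff intro: cohomologous_refl cohomologous_pullback\<close>)

primrec cup_power :: "('a list \<Rightarrow> bit) \<Rightarrow> nat \<Rightarrow> 'a list \<Rightarrow> bit" where
  "cup_power \<phi> 0 = (\<lambda>xs. 1)"
| "cup_power \<phi> (Suc m) = cup m (cup_power \<phi> m) \<phi>"

lemma cocycle_cup_power: "\<phi> \<in> as_cocycles X 1 \<Longrightarrow> cup_power \<phi> m \<in> as_cocycles X m"
  using cocycle_cup [of _ X _ \<phi> 1] by (induction m) (auto simp: cocycle_one)

lemma as_power_class:
  "\<phi> \<in> as_cocycles X 1 \<Longrightarrow> as_power X (as_class X 1 \<phi>) m = as_class X m (cup_power \<phi> m)"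
  using as_cup_class [of _ X _ \<phi> 1] cocycle_cup_power [of \<phi> X]
  by (induction m) (auto simp: as_one_def as_class_def [symmetric])

lemma cohomologous_cup_power:
  assumes "cohomologous X 1 \<phi> \<psi>" "\<phi> \<in> as_cocycles X 1" "\<psi> \<in> as_cocycles X 1"
  shows "cohomologous X m (cup_power \<phi> m) (cup_power \<psi> m)"
proof (induction m)
  case (Suc m)
  then show ?case
    using cohomologous_cup [OF Suc assms(1) cocycle_cup_power assms(3)] assms by simp
qed (simp add: cohomologous_refl)

lemma cup_power_map:
  "cup_power (\<lambda>ys. \<phi> (map f ys)) m xs = cup_power \<phi> m (map f xs)"
  by (induction m arbitrary: xs) (auto simp: cup_def take_map drop_map)

lemma cup_power_cong:
  assumes "\<And>ys. \<lbrakk>length ys = 2; set ys \<subseteq> set xs\<rbrakk> \<Longrightarrow> \<phi> ys = \<psi> ys" "length xs = Suc m"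
  shows "cup_power \<phi> m xs = cup_power \<psi> m xs"
  using assms
proof (induction m arbitrary: xs)
  case (Suc m)
  have "cup_power \<phi> m (take (Suc m) xs) = cup_power \<psi> m (take (Suc m) xs)"
    using Suc.prems by (intro Suc.IH) (auto dest!: in_set_takeD)
  moreover have "\<phi> (drop m xs) = \<psi> (drop m xs)"
    using Suc.prems by (intro Suc.prems) (auto dest: in_set_dropD)
  ultimately show ?case by (simp add: cup_def)
qed simp

section \<open>Homotopy invariance\<close>

text \<open>
  If \<open>Q x r\<close> says that something holds on the ball of radius \<open>r\<close> about \<open>x\<close>, then the supremum of the
  admissible radii is a 1-Lipschitz function of the centre. This provides scales that vary slowly even
  where no uniform scale exists.
\<close>

lemma Lipschitz_radius:
  fixes S :: "'a::metric_space set" and Q :: "'a \<Rightarrow> real \<Rightarrow> bool"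
  assumes pos: "\<And>x. x \<in> S \<Longrightarrow> \<exists>r>0. Q x r"
    and mono: "\<And>x y r r'. \<lbrakk>x \<in> S; y \<in> S; Q x r; 0 < r'; dist x y + r' \<le> r\<rbrakk> \<Longrightarrow> Q y r'"
  obtains d :: "'a \<Rightarrow> real"
  where "\<And>x. x \<in> S \<Longrightarrow> 0 < d x" "\<And>x. x \<in> S \<Longrightarrow> Q x (d x)"
    "\<And>x y. \<lbrakk>x \<in> S; y \<in> S\<rbrakk> \<Longrightarrow> \<bar>d x - d y\<bar> \<le> dist x y"
proof -
  define T where "T x = {r. 0 < r \<and> r \<le> 1 \<and> Q x r}" for x
  (* The supremum itself need not be admissible, half of it is. *)
  define d where "d x = Sup (T x) / 2" for x
  have bdd: "bdd_above (T x)" for x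
    by (auto simp: T_def bdd_above_def)
  have ne: "T x \<noteq> {}" if x: "x \<in> S" for x
  proof -
    obtain r where "r > 0" "Q x r" using pos [OF x] by blast
    then have "min r 1 \<in> T x"
      using mono [OF x x, of r "min r 1"] by (auto simp: T_def)
    then show ?thesis by blast
  qed
  have pos_d: "0 < d x" if x: "x \<in> S" for x
  proof -
    obtain r where r: "r \<in> T x" using ne [OF x] by blast
    have "0 < r" using r by (simp add: T_def)
    also have "r \<le> Sup (T x)" by (rule cSup_upper [OF r bdd])
    finally show "0 < d x" by (simp add: d_def)
  qed
  have Q: "Q x (d x)" if x: "x \<in> S" for x
  proof -
    have "d x < Sup (T x)" using pos_d [OF x] by (simp add: d_def)
    then obtain r where r: "r \<in> T x" "d x < r"
      using less_cSup_iff [OF ne [OF x] bdd] by blast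
    then show ?thesis
      using mono [OF x x, of r "d x"] pos_d [OF x] by (auto simp: T_def)
  qed
  have half: "Sup (T x) \<le> Sup (T y) + dist x y" if x: "x \<in> S" and y: "y \<in> S" for x y
  proof (rule cSup_least [OF ne [OF x]])
    fix r assume r: "r \<in> T x"
    show "r \<le> Sup (T y) + dist x y"
    proof (cases "r \<le> dist x y")
      case True
      then show ?thesis using pos_d [OF y] by (simp add: d_def)
    next
      case False
      then have "r - dist x y \<in> T y"
        using r mono [OF x y, of r "r - dist x y"] zero_le_dist [of x y]
        by (simp add: T_def del: zero_le_dist)
      then have "r - dist x y \<le> Sup (T y)" by (rule cSup_upper [OF _ bdd])
      then show ?thesis by simp
    qed
  qed
  have "\<bar>d x - d y\<bar> \<le> dist x y" if "x \<in> S" "y \<in> S" for x y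
    using half [OF that] half [OF that(2,1)] unfolding d_def by (simp add: dist_commute)
  with pos_d Q show ?thesis by (rule that)
qed

text \<open>
  A Lebesgue number for the homotopy over each point: \<open>h\<close> maps the box of size \<open>d x\<close> about \<open>(x, t)\<close> into
  a set on which \<open>P\<close> holds. Compactness of the interval makes \<open>d x\<close> positive.
\<close>

lemma homotopy_subdivision:
  fixes S :: "'a::metric_space set" and h :: "'a \<times> real \<Rightarrow> 'b"
  assumes h: "continuous_map (top_of_set (S \<times> {0..1})) Y h" and P: "nearly Y n P"
  obtains d :: "'a \<Rightarrow> real"
  where "\<And>x. x \<in> S \<Longrightarrow> 0 < d x" "\<And>x y. \<lbrakk>x \<in> S; y \<in> S\<rbrakk> \<Longrightarrow> \<bar>d x - d y\<bar> \<le> dist x y"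
    "\<And>x t xs. \<lbrakk>x \<in> S; t \<in> {0..1}; length xs = n;
        set xs \<subseteq> h ` {(y, u). y \<in> S \<and> u \<in> {0..1} \<and> dist x y < d x \<and> \<bar>t - u\<bar> < d x}\<rbrakk> \<Longrightarrow> P xs"
proof -
  define N where "N x t r = {(y, u). y \<in> S \<and> u \<in> {0..1::real} \<and> dist x y < r \<and> \<bar>t - u\<bar> < r}" for x t r
  define Q where "Q x r \<longleftrightarrow> (\<forall>t\<in>{0..1::real}. \<forall>xs. length xs = n \<longrightarrow> set xs \<subseteq> h ` N x t r \<longrightarrow> P xs)" for x r
  have pos: "\<exists>r>0. Q x r" if x: "x \<in> S" for x
  proof -
    have "\<exists>r>0. \<forall>xs. length xs = n \<longrightarrow> set xs \<subseteq> h ` N x t (2 * r) \<longrightarrow> P xs" if t: "t \<in> {0..1}" for t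
    proof -
      have xt: "(x, t) \<in> S \<times> {0..1}" using x t by simp
      then have "h (x, t) \<in> topspace Y"
        using continuous_map_image_subset_topspace [OF h] by auto
      from nearlyE [OF P this] obtain U
        where U: "openin Y U" "h (x, t) \<in> U" "\<forall>xs. length xs = n \<longrightarrow> set xs \<subseteq> U \<longrightarrow> P xs" .
      have "openin (top_of_set (S \<times> {0..1})) {p \<in> S \<times> {0..1}. h p \<in> U}"
        using openin_continuous_map_preimage [OF h U(1)] by simp
      then obtain e where e: "e > 0" "ball (x, t) e \<inter> S \<times> {0..1} \<subseteq> {p \<in> S \<times> {0..1}. h p \<in> U}"
        using xt U(2) unfolding openin_contains_ball by blast
      have "N x t (2 * (e / 4)) \<subseteq> ball (x, t) e \<inter> S \<times> {0..1}"
      proof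
        fix p assume "p \<in> N x t (2 * (e / 4))"
        then obtain y u where p: "p = (y, u)" "y \<in> S" "u \<in> {0..1}" "dist x y < e / 2" "\<bar>t - u\<bar> < e / 2"
          by (auto simp: N_def)
        have "dist (x, t) (y, u) \<le> dist x y + \<bar>t - u\<bar>"
          by (simp add: dist_Pair_Pair sqrt_sum_squares_le_sum_abs dist_real_def order_trans [OF sqrt_sum_squares_le_sum_abs])
        then show "p \<in> ball (x, t) e \<inter> S \<times> {0..1}" using p by auto
      qed
      then have "h ` N x t (2 * (e / 4)) \<subseteq> U" using e(2) by blast
      then have "P xs" if "length xs = n" "set xs \<subseteq> h ` N x t (2 * (e / 4))" for xs
        using U(3) order_trans [OF that(2)] that(1) by blast
      with e(1) show ?thesis by (intro exI [of _ "e / 4"]) simp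
    qed
    then obtain r where r: "\<And>t. t \<in> {0..1} \<Longrightarrow> r t > 0"
      "\<And>t xs. \<lbrakk>t \<in> {0..1}; length xs = n; set xs \<subseteq> h ` N x t (2 * r t)\<rbrakk> \<Longrightarrow> P xs"
      by metis
    have "compact {0..1::real}" by simp
    moreover have "{0..1} \<subseteq> (\<Union>t\<in>{0..1}. ball t (r t))" using r(1) by fastforce
    ultimately obtain F where F: "F \<subseteq> {0..1}" "finite F" "{0..1} \<subseteq> (\<Union>t\<in>F. ball t (r t))"
      using compactE_image [of "{0..1}" "{0..1}" "\<lambda>t. ball t (r t)"] by (metis open_ball)
    define \<rho> where "\<rho> = Min (r ` F)"
    have ne: "F \<noteq> {}" using F(3) by auto
    have "\<rho> > 0" using F ne r(1) by (auto simp: \<rho>_def)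
    moreover have "Q x \<rho>"
      unfolding Q_def
    proof (intro ballI allI impI)
      fix t xs assume t: "t \<in> {0..1}" and xs: "length xs = n" "set xs \<subseteq> h ` N x t \<rho>"
      obtain t' where t': "t' \<in> F" "\<bar>t' - t\<bar> < r t'" using F(3) t by (auto simp: dist_real_def)
      have "\<rho> \<le> r t'" using t' F(2) by (simp add: \<rho>_def)
      then have "N x t \<rho> \<subseteq> N x t' (2 * r t')" using t' r(1) [of t'] F(1) by (auto simp: N_def)
      then show "P xs" using r(2) [of t' xs] t' F(1) xs by blast
    qed
    ultimately show ?thesis by blast
  qed
  have mono: "Q y r'" if "x \<in> S" "y \<in> S" "Q x r" "0 < r'" "dist x y + r' \<le> r" for x y r r'
  proof -
    have "N y t r' \<subseteq> N x t r" for t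
    proof
      fix p assume "p \<in> N y t r'"
      then obtain z u where p: "p = (z, u)" "z \<in> S" "u \<in> {0..1}" "dist y z < r'" "\<bar>t - u\<bar> < r'"
        by (auto simp: N_def)
      have "dist x z \<le> dist x y + dist y z" by (rule dist_triangle)
      then have "dist x z < r" "\<bar>t - u\<bar> < r" using p that(5) zero_le_dist [of x y] by linarith+
      then show "p \<in> N x t r" using p unfolding N_def by simp
    qed
    then show ?thesis using that(3) unfolding Q_def by (meson image_mono order_trans)
  qed
  show ?thesis
  proof (rule Lipschitz_radius [of S Q])
    show "\<exists>r>0. Q x r" if "x \<in> S" for x
      using that by (rule pos)
    show "Q y r'" if "x \<in> S" "y \<in> S" "Q x r" "0 < r'" "dist x y + r' \<le> r" for x y r r'
      using that by (rule mono)
    fix d :: "'a \<Rightarrow> real"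
    assume d: "\<And>x. x \<in> S \<Longrightarrow> 0 < d x" "\<And>x. x \<in> S \<Longrightarrow> Q x (d x)"
      "\<And>x y. \<lbrakk>x \<in> S; y \<in> S\<rbrakk> \<Longrightarrow> \<bar>d x - d y\<bar> \<le> dist x y"
    show ?thesis
      by (rule that [of d]) (use d in \<open>auto simp: Q_def N_def\<close>)
  qed
qed

text \<open>
  Over a point \<open>x\<close> the interval is cut into pieces of length \<open>d x / 4\<close>, and the prisms between
  consecutive cuts are added up. The number of pieces depends on \<open>x\<close>; pieces beyond the end of the
  interval are degenerate and all contribute the same value, so an even number of them contributes
  nothing modulo two. Hence any sufficiently large even number of pieces gives the same cochain \<open>\<eta>\<close>,
  and near each point one number serves all small simplices.
\<close>

proposition homotopic_cohomologous:
  fixes S :: "'a::metric_space set" and h :: "'a \<times> real \<Rightarrow> 'b"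
  assumes h: "continuous_map (top_of_set (S \<times> {0..1})) Y h" and z: "z \<in> as_cocycles Y q"
  shows "cohomologous (top_of_set S) q
           (\<lambda>xs. z (map (\<lambda>x. h (x, 0)) xs)) (\<lambda>xs. z (map (\<lambda>x. h (x, 1)) xs))"
proof -
  obtain d where d_pos: "\<And>x. x \<in> S \<Longrightarrow> 0 < d x"
    and d_lip: "\<And>x y. \<lbrakk>x \<in> S; y \<in> S\<rbrakk> \<Longrightarrow> \<bar>d x - d y\<bar> \<le> dist x y"
    and d: "\<And>x t xs. \<lbrakk>x \<in> S; t \<in> {0..1}; length xs = q + 2;
        set xs \<subseteq> h ` {(y, u). y \<in> S \<and> u \<in> {0..1} \<and> dist x y < d x \<and> \<bar>t - u\<bar> < d x}\<rbrakk> \<Longrightarrow> as_delta z xs = 0"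
    using homotopy_subdivision [OF h z [unfolded cocycles_iff]] by blast
  define t where "t j x = min 1 (real j * (d x / 4))" for j x
  define a where "a j x = h (x, t j x)" for j x
  define D where "D N xs = (\<Sum>j<N. prism (a j) (a (Suc j)) z xs)" for N :: nat and xs
  define enough where "enough M xs \<longleftrightarrow> (\<forall>x\<in>set xs. 1 \<le> real (2 * M) * (d x / 4))" for M xs
  (* The two additional prisms coincide, as all their vertices lie over the end of the interval. *)
  have D_step: "D (2 * Suc M) xs = D (2 * M) xs" if "set xs \<subseteq> S" "enough M xs" for M xs
  proof -
    have "t j x = 1" if "x \<in> set xs" "2 * M \<le> j" for j x
    proof -
      have "1 \<le> real (2 * M) * (d x / 4)"
        using \<open>enough M xs\<close> that(1) unfolding enough_def by blast
      also have "\<dots> \<le> real j * (d x / 4)"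
        using that d_pos [of x] \<open>set xs \<subseteq> S\<close> by (intro mult_right_mono) auto
      finally show ?thesis by (simp add: t_def)
    qed
    then have "prism (a (2 * M)) (a (Suc (2 * M))) z xs = prism (a (Suc (2 * M))) (a (Suc (Suc (2 * M)))) z xs"
      by (intro prism_cong) (simp_all add: a_def)
    then show ?thesis
      by (simp add: D_def add.assoc)
  qed
  have D_stable: "D (2 * M') xs = D (2 * M) xs"
    if "set xs \<subseteq> S" "enough M xs" "M \<le> M'" for M M' xs
    using that(3)
  proof (induction M' rule: dec_induct)
    case (step m)
    have "enough m xs"
      unfolding enough_def
    proof
      fix x assume x: "x \<in> set xs"
      have "1 \<le> real (2 * M) * (d x / 4)" using that(2) x unfolding enough_def by blast
      also have "\<dots> \<le> real (2 * m) * (d x / 4)"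
        using step x that(1) d_pos [of x] by (intro mult_right_mono) auto
      finally show "1 \<le> real (2 * m) * (d x / 4)" .
    qed
    then show ?case using D_step [OF that(1)] step by simp
  qed simp
  define \<eta> where "\<eta> xs = D (2 * (LEAST M. enough M xs)) xs" for xs
  have \<eta>: "\<eta> xs = D (2 * M) xs" if "set xs \<subseteq> S" "enough M xs" for M xs
    unfolding \<eta>_def
    by (rule D_stable [symmetric, OF that(1)]) (use that(2) in \<open>auto intro: LeastI Least_le\<close>)
  have nil: "\<eta> [] = 0"
    by (simp add: \<eta>_def D_def)
  have "nearly (top_of_set S) (Suc q)
     (\<lambda>xs. z (map (\<lambda>x. h (x, 0)) xs) + z (map (\<lambda>x. h (x, 1)) xs) = as_delta \<eta> xs)"
  proof (rule nearlyI)
    fix x0 assume "x0 \<in> topspace (top_of_set S)"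
    then have x0: "x0 \<in> S" by simp
    note dx0 = d_pos [OF x0]
    obtain M :: nat where M: "8 / d x0 \<le> real M" using real_arch_simple by blast
    have "0 < 8 / d x0" using dx0 by simp
    then have M0: "real M > 0" using M by linarith
    have M1: "1 \<le> real (2 * M) * (d x0 / 2 / 4)"
      using M dx0 by (simp add: field_simps)
    (* A change of d by less than \<rho> moves each of the first 2 * M cuts by at most d x0 / 4. *)
    define \<rho> where "\<rho> = min (d x0 / 2) (d x0 / (2 * real M))"
    have \<rho>: "\<rho> > 0" using dx0 M0 by (simp add: \<rho>_def)
    have dx: "d x0 / 2 \<le> d x" "\<bar>d x0 - d x\<bar> < \<rho>" "dist x0 x < d x0" if "x \<in> S" "dist x0 x < \<rho>" for x
    proof -
      show *: "\<bar>d x0 - d x\<bar> < \<rho>" using d_lip [OF x0 that(1)] that(2) by linarith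
      show "d x0 / 2 \<le> d x" using * unfolding \<rho>_def by linarith
      show "dist x0 x < d x0" using that dx0 unfolding \<rho>_def by linarith
    qed
    have tj: "\<bar>t j x - t j x0\<bar> \<le> d x0 / 4" if x: "x \<in> S" "dist x0 x < \<rho>" and "j \<le> 2 * M" for j x
    proof -
      have "\<bar>t j x - t j x0\<bar> \<le> \<bar>real j * (d x / 4) - real j * (d x0 / 4)\<bar>"
        unfolding t_def by linarith
      also have "\<dots> = real j * (\<bar>d x0 - d x\<bar> / 4)"
        by (simp add: abs_mult abs_minus_commute flip: right_diff_distrib diff_divide_distrib)
      also have "\<dots> \<le> real (2 * M) * ((d x0 / (2 * real M)) / 4)"
        using that(3) dx(2) [OF x] unfolding \<rho>_def by (intro mult_mono) auto
      also have "\<dots> = d x0 / 4" using M0 by simp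
      finally show ?thesis .
    qed
    have t_step: "\<bar>t (Suc j) x0 - t j x0\<bar> \<le> d x0 / 4" for j
    proof -
      have "real (Suc j) * (d x0 / 4) = real j * (d x0 / 4) + d x0 / 4"
        by (simp add: algebra_simps add_divide_distrib)
      then show ?thesis using dx0 unfolding t_def by linarith
    qed
    have t01: "t j x \<in> {0..1}" if "x \<in> S" for j x
      using d_pos [OF that] by (simp add: t_def)
    have "z (map (\<lambda>x. h (x, 0)) xs) + z (map (\<lambda>x. h (x, 1)) xs) = as_delta \<eta> xs"
      if len: "length xs = Suc q" and sub: "set xs \<subseteq> S \<inter> ball x0 \<rho>" for xs
    proof -
      have en: "enough M ys" if "set ys \<subseteq> set xs" for ys
        unfolding enough_def
      proof
        fix x assume "x \<in> set ys"
        then have x: "x \<in> S" "dist x0 x < \<rho>" using that sub by auto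
        show "1 \<le> real (2 * M) * (d x / 4)"
          using M1 dx(1) [OF x] mult_left_mono [of "d x0 / 2 / 4" "d x / 4" "real (2 * M)"] by simp
      qed
      have "as_delta \<eta> xs = as_delta (D (2 * M)) xs"
        using en sub by (intro as_delta_cong \<eta>) auto
      also have "\<dots> = (\<Sum>j<2 * M. as_delta (prism (a j) (a (Suc j)) z) xs)"
        unfolding D_def by (rule as_delta_sum)
      also have "\<dots> = (\<Sum>j<2 * M. z (map (a j) xs) + z (map (a (Suc j)) xs))"
      proof (rule sum.cong)
        fix j assume "j \<in> {..<2 * M}"
        then have j: "j \<le> 2 * M" "Suc j \<le> 2 * M" by auto
        have "prism (a j) (a (Suc j)) (as_delta z) xs = 0"
        proof (rule prism_eq_0, rule d [OF x0 t01 [OF x0, of j]])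
          fix ys assume ys: "length ys = Suc (length xs)" "set ys \<subseteq> a j ` set xs \<union> a (Suc j) ` set xs"
          show "length ys = q + 2" using ys len by simp
          let ?N = "{(y, u). y \<in> S \<and> u \<in> {0..1} \<and> dist x0 y < d x0 \<and> \<bar>t j x0 - u\<bar> < d x0}"
          have "a j x \<in> h ` ?N \<and> a (Suc j) x \<in> h ` ?N" if "x \<in> set xs" for x
          proof -
            have x: "x \<in> S" "dist x0 x < \<rho>" using that sub by auto
            have "\<bar>t j x0 - t j x\<bar> < d x0" "\<bar>t j x0 - t (Suc j) x\<bar> < d x0"
              using tj [OF x j(1)] tj [OF x j(2)] t_step [of j] dx0 by linarith+
            then have "(x, t j x) \<in> ?N" "(x, t (Suc j) x) \<in> ?N"
              using x dx(3) [OF x] t01 [OF x(1)] by auto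
            then show ?thesis unfolding a_def by blast
          qed
          then show "set ys \<subseteq> h ` ?N" using ys(2) by blast
        qed
        then show "as_delta (prism (a j) (a (Suc j)) z) xs = z (map (a j) xs) + z (map (a (Suc j)) xs)"
          using prism_homotopy [of "a j" "a (Suc j)" z xs] by simp
      qed simp
      also have "\<dots> = z (map (a 0) xs) + z (map (a (2 * M)) xs)"
        by (rule sum_bit_add)
      also have "map (a 0) xs = map (\<lambda>x. h (x, 0)) xs"
        by (simp add: a_def t_def)
      also have "map (a (2 * M)) xs = map (\<lambda>x. h (x, 1)) xs"
        using en [of xs] by (simp add: a_def t_def enough_def)
      finally show ?thesis by simp
    qed
    moreover have "openin (top_of_set S) (S \<inter> ball x0 \<rho>)" by (simp add: openin_open_Int)
    ultimately show "\<exists>U. openin (top_of_set S) U \<and> x0 \<in> U \<and> (\<forall>xs. length xs = Suc q \<longrightarrow> set xs \<subseteq> U \<longrightarrow>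
        z (map (\<lambda>x. h (x, 0)) xs) + z (map (\<lambda>x. h (x, 1)) xs) = as_delta \<eta> xs)"
      using x0 \<rho> by (intro exI [of _ "S \<inter> ball x0 \<rho>"]) simp
  qed
  with nil show ?thesis by (rule cohomologousI)
qed

text \<open>
  On lists of equal points a cochain has a single value \<open>c\<close>. In odd degrees the cocycle condition is an
  odd multiple of \<open>c\<close>, so \<open>c = 0\<close>; in even degrees \<open>c\<close> is its own coboundary.
\<close>

lemma constant_map_cohomologous_zero:
  assumes z: "z \<in> as_cocycles Y q" and "q > 0" and p: "p \<in> topspace Y"
  shows "cohomologous X q (\<lambda>xs. z (map (\<lambda>x. p) xs)) (\<lambda>xs. 0)"
proof -
  from nearlyE [OF z [unfolded cocycles_iff] p] obtain U
    where "p \<in> U" "\<forall>xs. length xs = q + 2 \<longrightarrow> set xs \<subseteq> U \<longrightarrow> as_delta z xs = 0" .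
  then have "as_delta z (replicate (q + 2) p) = 0" by (auto simp: set_replicate_conv_if)
  moreover have "as_delta z (replicate (q + 2) p) = (\<Sum>i<q + 2. z (replicate (Suc q) p))"
    unfolding as_delta_def
  proof (rule sum.cong)
    fix i assume "i \<in> {..<q + 2}"
    then have "min i (q + 2) + (q + 2 - Suc i) = Suc q" by auto
    then have "take i (replicate (q + 2) p) @ drop (Suc i) (replicate (q + 2) p) = replicate (Suc q) p"
      by (simp only: take_replicate drop_replicate flip: replicate_add)
    then show "z (take i (replicate (q + 2) p) @ drop (Suc i) (replicate (q + 2) p)) = z (replicate (Suc q) p)"
      by (simp only:)
  qed (simp only: length_replicate)
  ultimately have *: "(\<Sum>i<q + 2. z (replicate (Suc q) p)) = 0" by simp
  show ?thesis
  proof (cases "even q")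
    case True
    define c where "c = z (replicate (Suc q) p)"
    have sum_c: "(\<Sum>i<n. c) = (if even n then 0 else c)" for n :: nat
      by (induction n) auto
    show ?thesis
    proof (rule cohomologousI [of "\<lambda>xs. if xs = [] then 0 else c"])
      show "nearly X (Suc q) (\<lambda>xs. z (map (\<lambda>x. p) xs) + 0 = as_delta (\<lambda>xs. if xs = [] then 0 else c) xs)"
      proof (rule nearlyI, rule exI [of _ "topspace X"], safe)
        fix xs assume len: "length xs = Suc q"
        have "as_delta (\<lambda>xs. if xs = [] then 0 else c) xs = as_delta (\<lambda>xs. c) xs"
          using len \<open>q > 0\<close> by (intro as_delta_cong) auto
        also have "\<dots> = c"
          using sum_c [of "Suc q"] True by (simp add: as_delta_def len)
        finally show "z (map (\<lambda>x. p) xs) + 0 = as_delta (\<lambda>xs. if xs = [] then 0 else c) xs"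
          by (simp add: map_replicate_const len c_def)
      qed auto
    qed simp
  next
    case False
    have sum_c: "(\<Sum>i<n. c) = (if even n then 0 else c)" for n :: nat and c :: bit
      by (induction n) auto
    have "z (replicate (Suc q) p) = 0" using * False by (simp only: sum_c) simp
    then show ?thesis
      by (intro cohomologous_eq) (simp add: map_replicate_const)
  qed
qed

corollary convex_cocycle_cohomologous_zero:
  fixes C :: "'a::real_normed_vector set"
  assumes "convex C" "continuous_map (top_of_set C) Y k" "z \<in> as_cocycles Y q" "q > 0"
  shows "cohomologous (top_of_set C) q (\<lambda>xs. z (map k xs)) (\<lambda>xs. 0)"
proof (cases "C = {}")
  case True
  then show ?thesis by (intro cohomologous_nearly nearlyI) simp
next
  case False
  then obtain p where p: "p \<in> C" by blast
  let ?h = "\<lambda>(x, t). t *\<^sub>R p + (1 - t) *\<^sub>R x"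
  have "continuous_map (top_of_set (C \<times> {0..1})) (top_of_set C) ?h"
    using p convexD [OF assms(1)]
    by (auto simp: case_prod_unfold intro!: continuous_intros)
  then have "continuous_map (top_of_set (C \<times> {0..1})) Y (k \<circ> ?h)"
    using assms(2) by (rule continuous_map_compose)
  from homotopic_cohomologous [OF this assms(3)]
  have "cohomologous (top_of_set C) q (\<lambda>xs. z (map k xs)) (\<lambda>xs. z (map (\<lambda>x. k p) xs))"
    by (simp add: comp_def)
  also have "cohomologous (top_of_set C) q (\<lambda>xs. z (map (\<lambda>x. k p) xs)) (\<lambda>xs. 0)"
    using continuous_map_image_subset_topspace [OF assms(2)] p
    by (intro constant_map_cohomologous_zero [OF assms(3,4)]) auto
  finally show ?thesis .
qed

section \<open>Antipodal quotients and spheres\<close>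

definition orbit :: "'a::uminus \<Rightarrow> 'a set" where
  "orbit x = {x, - x}"

text \<open>
  The orbit map of the antipodal action. It is used for the infinite sphere, which is not a subspace of a
  normed space, and for symmetric subsets of a normed space.
\<close>

locale antipodal_space =
  fixes X :: "'a::uminus topology"
  assumes neg_neg: "- (- x) = (x :: 'a)"
    and neg_cont: "continuous_map X X uminus"
begin

lemma neg_topspace: "- x \<in> topspace X \<longleftrightarrow> x \<in> topspace X"
  using continuous_map_image_subset_topspace [OF neg_cont] neg_neg by (metis image_subset_iff)

lemma orbit_neg [simp]: "orbit (- x) = orbit (x :: 'a)"
  by (auto simp: orbit_def neg_neg)

lemma orbit_eq_iff: "orbit x = orbit y \<longleftrightarrow> x = y \<or> x = - (y :: 'a)"
  unfolding orbit_def by (metis doubleton_eq_iff neg_neg)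

lemma openin_quotient:
  "openin (antipodal_quotient X) V \<longleftrightarrow>
     V \<subseteq> orbit ` topspace X \<and> openin X {x \<in> topspace X. orbit x \<in> V}"
  by (simp add: openin_antipodal_quotient orbit_def)

lemma topspace_quotient: "topspace (antipodal_quotient X) = orbit ` topspace X"
proof
  show "topspace (antipodal_quotient X) \<subseteq> orbit ` topspace X"
    using openin_quotient openin_topspace by blast
  have "openin (antipodal_quotient X) (orbit ` topspace X)"
    unfolding openin_quotient by (auto intro: back_subst [of "openin X", OF openin_topspace])
  then show "orbit ` topspace X \<subseteq> topspace (antipodal_quotient X)" by (rule openin_subset)
qed

lemma continuous_map_orbit: "continuous_map X (antipodal_quotient X) orbit"
  unfolding continuous_map_def using openin_quotient topspace_quotient by auto

lemma openin_orbit_image: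
  assumes U: "openin X U"
  shows "openin (antipodal_quotient X) (orbit ` U)"
  unfolding openin_quotient
proof
  have sub: "U \<subseteq> topspace X" using U by (rule openin_subset)
  then show "orbit ` U \<subseteq> orbit ` topspace X" by blast
  have "{x \<in> topspace X. orbit x \<in> orbit ` U} = U \<union> {x \<in> topspace X. - x \<in> U}"
  proof (intro set_eqI iffI)
    fix x assume "x \<in> {x \<in> topspace X. orbit x \<in> orbit ` U}"
    then obtain u where u: "x \<in> topspace X" "u \<in> U" "orbit x = orbit u" by blast
    then have "x = u \<or> x = - u" by (simp add: orbit_eq_iff)
    then show "x \<in> U \<union> {x \<in> topspace X. - x \<in> U}" using u neg_neg by auto
  next
    fix x assume "x \<in> U \<union> {x \<in> topspace X. - x \<in> U}"
    then show "x \<in> {x \<in> topspace X. orbit x \<in> orbit ` U}"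
      using sub orbit_neg [of x] by (metis (mono_tags, lifting) Un_iff imageI mem_Collect_eq subsetD)
  qed
  then show "openin X {x \<in> topspace X. orbit x \<in> orbit ` U}"
    using openin_continuous_map_preimage [OF neg_cont U] U by (simp add: openin_Un)
qed

text \<open>
  The orbit map is open, so small lists of orbits lift to small lists of points.
\<close>

lemma nearly_descend:
  assumes "nearly X n (\<lambda>xs. P (map orbit xs))"
  shows "nearly (antipodal_quotient X) n P"
proof (rule nearlyI)
  fix y assume "y \<in> topspace (antipodal_quotient X)"
  then obtain x where x: "x \<in> topspace X" "y = orbit x" by (auto simp: topspace_quotient)
  from nearlyE [OF assms x(1)] obtain U
    where U: "openin X U" "x \<in> U" "\<forall>xs. length xs = n \<longrightarrow> set xs \<subseteq> U \<longrightarrow> P (map orbit xs)" .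
  have "P ys" if "length ys = n" "set ys \<subseteq> orbit ` U" for ys
  proof -
    have "ys \<in> lists (orbit ` U)" using that(2) by auto
    then obtain xs where "ys = map orbit xs" "set xs \<subseteq> U"
      unfolding lists_image by auto
    then show ?thesis using U(3) that(1) by simp
  qed
  then show "\<exists>U. openin (antipodal_quotient X) U \<and> y \<in> U \<and> (\<forall>xs. length xs = n \<longrightarrow> set xs \<subseteq> U \<longrightarrow> P xs)"
    using openin_orbit_image [OF U(1)] U(2) x(2) by (intro exI [of _ "orbit ` U"]) simp
qed

text \<open>
  A cochain that is invariant under the simultaneous change of all signs is in general not a cochain of
  orbits, since the signs of the individual orbits can be chosen independently. Close points select one
  of the two consistent choices, and by invariance it does not matter which.
\<close>

lemma invariant_cochain_descends:
  assumes near: "nearly X 2 (\<lambda>xs. close (hd xs) (last xs))"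
    and excl: "\<And>x y. \<lbrakk>x \<in> topspace X; y \<in> topspace X; close x y\<rbrakk> \<Longrightarrow> \<not> close x (- y)"
    and sym: "\<And>x y. \<lbrakk>x \<in> topspace X; y \<in> topspace X; close x y\<rbrakk> \<Longrightarrow> close (- x) (- y)"
    and inv: "\<And>xs. set xs \<subseteq> topspace X \<Longrightarrow> F (map uminus xs) = F xs"
  obtains F' where "nearly X n (\<lambda>xs. F' (map orbit xs) = F xs)"
proof
  define lift where "lift ys xs \<longleftrightarrow> map orbit xs = ys \<and> set xs \<subseteq> topspace X \<and> (\<forall>x\<in>set xs. close (hd xs) x)" for ys xs
  have lift_unique: "xs' = xs \<or> xs' = map uminus xs" if l: "lift ys xs" "lift ys xs'" for ys xs xs'
  proof (cases "xs = []")
    case True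
    then show ?thesis using l by (auto simp: lift_def)
  next
    case False
    have len: "length xs' = length xs" using l by (metis lift_def length_map)
    then have ne: "xs' \<noteq> []" using False by auto
    have top: "set xs \<subseteq> topspace X" "set xs' \<subseteq> topspace X" using l by (auto simp: lift_def)
    have pt: "xs' ! i = xs ! i \<or> xs' ! i = - (xs ! i)" if "i < length xs" for i
    proof -
      have "orbit (xs' ! i) = orbit (xs ! i)" using l len that by (metis lift_def nth_map)
      then show ?thesis by (simp add: orbit_eq_iff)
    qed
    have cl: "close (hd xs) (xs ! i)" "close (hd xs') (xs' ! i)" "xs ! i \<in> topspace X" "xs' ! i \<in> topspace X"
      if "i < length xs" for i
      using l len that top by (auto simp: lift_def)
    have hd_top: "hd xs \<in> topspace X" using False top by auto
    have "hd xs' = hd xs \<or> hd xs' = - hd xs" using pt [of 0] False ne by (simp add: hd_conv_nth)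
    then show ?thesis
    proof
      assume h: "hd xs' = hd xs"
      have "xs' ! i = xs ! i" if "i < length xs" for i
        using pt [OF that] cl [OF that] excl [OF hd_top cl(3) [OF that] cl(1) [OF that]] h by metis
      then show ?thesis using len by (metis nth_equalityI)
    next
      assume h: "hd xs' = - hd xs"
      have "xs' ! i = - (xs ! i)" if "i < length xs" for i
      proof (rule ccontr)
        assume "xs' ! i \<noteq> - (xs ! i)"
        then have eq: "xs' ! i = xs ! i" using pt [OF that] by blast
        have "close (- hd xs) (- (xs ! i))" using sym [OF hd_top cl(3) [OF that] cl(1) [OF that]] .
        moreover have "close (- hd xs) (xs ! i)" using cl(2) [OF that] h eq by simp
        ultimately show False
          using excl [of "- hd xs" "- (xs ! i)"] hd_top cl(3) [OF that] neg_topspace neg_neg by metis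
      qed
      then have "xs' = map uminus xs" using len by (intro nth_equalityI) auto
      then show ?thesis ..
    qed
  qed
  define F' where "F' ys = F (SOME xs. lift ys xs)" for ys
  have F': "F' ys = F xs" if l: "lift ys xs" for ys xs
  proof -
    have "lift ys (SOME xs. lift ys xs)" using l by (rule someI)
    with l have "(SOME xs. lift ys xs) = xs \<or> (SOME xs. lift ys xs) = map uminus xs"
      by (rule lift_unique)
    moreover have "set xs \<subseteq> topspace X" using l by (simp add: lift_def)
    ultimately show ?thesis using inv unfolding F'_def by metis
  qed
  show "nearly X n (\<lambda>xs. F' (map orbit xs) = F xs)"
  proof (rule nearlyI)
    fix x assume "x \<in> topspace X"
    from nearlyE [OF near this] obtain U
      where U: "openin X U" "x \<in> U" "\<forall>xs. length xs = 2 \<longrightarrow> set xs \<subseteq> U \<longrightarrow> close (hd xs) (last xs)" .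
    have cl: "close a b" if "a \<in> U" "b \<in> U" for a b
      using U(3) [rule_format, of "[a, b]"] that by simp
    have "F' (map orbit xs) = F xs" if "set xs \<subseteq> U" for xs
    proof (rule F')
      have "close (hd xs) b" if b: "b \<in> set xs" for b
      proof -
        have "xs \<noteq> []" using b by auto
        then have "hd xs \<in> set xs" by simp
        then show ?thesis using b \<open>set xs \<subseteq> U\<close> by (intro cl) auto
      qed
      then show "lift (map orbit xs) xs"
        using \<open>set xs \<subseteq> U\<close> openin_subset [OF U(1)] by (auto simp: lift_def)
    qed
    then show "\<exists>U. openin X U \<and> x \<in> U \<and> (\<forall>xs. length xs = n \<longrightarrow> set xs \<subseteq> U \<longrightarrow> F' (map orbit xs) = F xs)"
      using U by (intro exI [of _ U]) simp
  qed
qed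

lemma exists_odd_function:
  obtains G :: "'a \<Rightarrow> bit" where "\<And>x. - x \<noteq> x \<Longrightarrow> G (- x) = G x + 1"
proof
  define rep where "rep x = (SOME y. y \<in> orbit x)" for x :: 'a
  have rep: "rep x = x \<or> rep x = - x" for x
  proof -
    have "rep x \<in> orbit x" unfolding rep_def by (rule someI [of _ x]) (simp add: orbit_def)
    then show ?thesis by (simp add: orbit_def)
  qed
  have rep_neg: "rep (- x) = rep x" for x by (simp add: rep_def)
  show "(if rep (- x) = - x then 1 else 0) = (if rep x = x then 1 else 0) + (1 :: bit)" if "- x \<noteq> x" for x
    using rep [of x] that by (auto simp: rep_neg)
qed

end

lemma nearly_delta:
  assumes "nearly X n (\<lambda>xs. \<phi> xs = \<psi> xs)"
  shows "nearly X (Suc n) (\<lambda>xs. as_delta \<phi> xs = as_delta \<psi> xs)"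
proof (rule nearlyI)
  fix x assume "x \<in> topspace X"
  from nearlyE [OF assms this] obtain U
    where U: "openin X U" "x \<in> U" "\<forall>xs. length xs = n \<longrightarrow> set xs \<subseteq> U \<longrightarrow> \<phi> xs = \<psi> xs" .
  have "as_delta \<phi> xs = as_delta \<psi> xs" if "length xs = Suc n" "set xs \<subseteq> U" for xs
    by (rule as_delta_cong) (use U(3) that in auto)
  then show "\<exists>U. openin X U \<and> x \<in> U \<and> (\<forall>xs. length xs = Suc n \<longrightarrow> set xs \<subseteq> U \<longrightarrow> as_delta \<phi> xs = as_delta \<psi> xs)"
    using U by (intro exI [of _ U]) simp
qed

lemma nearly_pairE:
  assumes "nearly (top_of_set C) 2 P" "a \<in> C"
  shows "\<forall>\<^sub>F b in at a within C. P [a, b]"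
proof -
  from nearlyE [OF assms(1)] assms(2) obtain U
    where U: "openin (top_of_set C) U" "a \<in> U" "\<forall>xs. length xs = 2 \<longrightarrow> set xs \<subseteq> U \<longrightarrow> P xs" by auto
  from U(1) obtain T where T: "open T" "U = C \<inter> T" by (auto simp: openin_open)
  have "\<forall>\<^sub>F b in at a within C. b \<in> T \<and> b \<in> C"
    using T U(2) by (auto simp: eventually_at_topological)
  then show ?thesis
    by eventually_elim (use U T in auto)
qed

lemma nearly_constant_on_connected:
  fixes f :: "'a::topological_space \<Rightarrow> 'b"
  assumes "nearly (top_of_set C) 2 (\<lambda>xs. f (hd xs) = f (last xs))" "connected C" "a \<in> C" "b \<in> C"
  shows "f a = f b"
  using assms(2-4)
proof (rule connected_local_const)
  show "\<forall>a\<in>C. \<forall>\<^sub>F b in at a within C. f a = f b"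
    using nearly_pairE [OF assms(1)] by simp
qed

lemma topspace_nsphere: "topspace (nsphere n) = {x. (\<Sum>i\<le>n. (x i)\<^sup>2) = 1 \<and> (\<forall>i>n. x i = 0)}"
  by (simp add: nsphere)

lemma continuous_map_nsphereI:
  assumes "\<And>i. continuous_map X euclideanreal (\<lambda>x. f x i)" "f \<in> topspace X \<rightarrow> topspace (nsphere n)"
  shows "continuous_map X (nsphere n) f"
  using assms unfolding nsphere continuous_map_in_subtopology continuous_map_componentwise_UNIV by auto

lemma nsphere_mono: "m \<le> n \<Longrightarrow> topspace (nsphere m) \<subseteq> topspace (nsphere n)"
proof
  fix x assume mn: "m \<le> n" and x: "x \<in> topspace (nsphere m)"
  have "(\<Sum>i\<le>m. (x i)\<^sup>2) = (\<Sum>i\<le>n. (x i)\<^sup>2)"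
    using mn x by (intro sum.mono_neutral_left) (auto simp: topspace_nsphere)
  then show "x \<in> topspace (nsphere n)" using mn x by (auto simp: topspace_nsphere)
qed

lemma continuous_map_nsphere_inclusion: "m \<le> n \<Longrightarrow> continuous_map (nsphere m) (nsphere n) (\<lambda>x. x)"
  by (rule continuous_map_nsphereI) (use nsphere_mono continuous_map_nsphere_projection in auto)

lemma continuous_map_nsphere_neg: "continuous_map (nsphere n) (nsphere n) uminus"
proof (rule continuous_map_nsphereI)
  show "continuous_map (nsphere n) euclideanreal (\<lambda>x. (- x) i)" for i
    using continuous_map_minus [OF continuous_map_nsphere_projection [of n i]] by simp
qed (auto simp: topspace_nsphere)

lemma topspace_infinite_sphere: "topspace infinite_sphere = (\<Union>n. topspace (nsphere n))"
proof
  show "topspace infinite_sphere \<subseteq> (\<Union>n. topspace (nsphere n))"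
    using openin_topspace [of infinite_sphere] unfolding openin_infinite_sphere by blast
  have "(\<Union>m. topspace (nsphere m)) \<inter> topspace (nsphere n) = topspace (nsphere n)" for n by blast
  then have "openin infinite_sphere (\<Union>n. topspace (nsphere n))"
    unfolding openin_infinite_sphere by simp
  then show "(\<Union>n. topspace (nsphere n)) \<subseteq> topspace infinite_sphere" by (rule openin_subset)
qed

lemma infinite_sphere_nsphere: "x \<in> topspace infinite_sphere \<Longrightarrow> \<exists>n. x \<in> topspace (nsphere n)"
  by (simp add: topspace_infinite_sphere)

lemma continuous_map_into_infinite_sphere: "continuous_map (nsphere n) infinite_sphere (\<lambda>x. x)"
  unfolding continuous_map_def topspace_infinite_sphere
proof (intro conjI allI impI)
  fix U assume "openin infinite_sphere U"
  then have "openin (nsphere n) (U \<inter> topspace (nsphere n))" by (simp add: openin_infinite_sphere)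
  then show "openin (nsphere n) {x \<in> topspace (nsphere n). x \<in> U}" by (simp add: Int_def conj_commute)
qed auto

lemma continuous_map_from_infinite_sphere:
  assumes "\<And>n. continuous_map (nsphere n) Y f"
  shows "continuous_map infinite_sphere Y f"
  unfolding continuous_map_def
proof (intro conjI allI impI)
  show "f \<in> topspace infinite_sphere \<rightarrow> topspace Y"
    using continuous_map_image_subset_topspace [OF assms] by (fastforce simp: topspace_infinite_sphere)
  fix U assume U: "openin Y U"
  show "openin infinite_sphere {x \<in> topspace infinite_sphere. f x \<in> U}"
    unfolding openin_infinite_sphere
  proof (intro conjI allI)
    fix n
    have "{x \<in> topspace infinite_sphere. f x \<in> U} \<inter> topspace (nsphere n) = {x \<in> topspace (nsphere n). f x \<in> U}"
      by (auto simp: topspace_infinite_sphere)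
    then show "openin (nsphere n) ({x \<in> topspace infinite_sphere. f x \<in> U} \<inter> topspace (nsphere n))"
      using openin_continuous_map_preimage [OF assms U] by simp
  qed (auto simp: topspace_infinite_sphere)
qed

lemma continuous_map_infinite_sphere_neg: "continuous_map infinite_sphere infinite_sphere uminus"
  using continuous_map_compose [OF continuous_map_nsphere_neg continuous_map_into_infinite_sphere]
  by (intro continuous_map_from_infinite_sphere) (simp add: comp_def)

interpretation infinite_sphere: antipodal_space infinite_sphere
  by standard (auto simp: continuous_map_infinite_sphere_neg)

definition unit :: "(nat \<Rightarrow> real) \<Rightarrow> nat \<Rightarrow> real" where
  "unit v = (\<lambda>i. v i / sqrt (\<Sum>j | v j \<noteq> 0. (v j)\<^sup>2))"

lemma sum_support:
  fixes v f :: "nat \<Rightarrow> real"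
  assumes "\<And>i. i > m \<Longrightarrow> v i = 0"
  shows "(\<Sum>j | v j \<noteq> 0. v j * f j) = (\<Sum>j\<le>m. v j * f j)"
proof (rule sum.mono_neutral_left)
  show "{j. v j \<noteq> 0} \<subseteq> {..m}"
  proof
    fix j assume "j \<in> {j. v j \<noteq> 0}"
    then show "j \<in> {..m}" using assms [of j] by (cases "j \<le> m") auto
  qed
qed auto

lemma unit_eq:
  assumes "\<And>i. i > m \<Longrightarrow> v i = 0"
  shows "unit v = (\<lambda>i. v i / sqrt (\<Sum>j\<le>m. (v j)\<^sup>2))"
  using sum_support [of m v v] assms by (simp add: unit_def power2_eq_square)

lemma unit_in_nsphere:
  assumes "\<And>i. i > m \<Longrightarrow> v i = 0" "v k \<noteq> 0"
  shows "unit v \<in> topspace (nsphere m)"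
proof -
  have "k \<le> m" using assms by (meson not_le)
  then have "(\<Sum>j\<le>m. (v j)\<^sup>2) \<noteq> 0" using assms(2) by (auto simp: sum_nonneg_eq_0_iff)
  moreover have "0 \<le> (\<Sum>j\<le>m. (v j)\<^sup>2)" by (simp add: sum_nonneg)
  ultimately show ?thesis
    using assms(1) by (simp add: unit_eq [OF assms(1)] topspace_nsphere power_divide flip: sum_divide_distrib)
qed

lemma unit_id: "x \<in> topspace (nsphere n) \<Longrightarrow> unit x = x"
  by (subst unit_eq [of n]) (auto simp: topspace_nsphere)

lemma unit_minus: "unit (- v) = - unit v"
  by (auto simp: unit_def)

text \<open>
  The bound \<open>m\<close> on the support is what places the values in one finite-dimensional sphere, where
  continuity can be checked by coordinates.
\<close>

lemma continuous_map_unit: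
  assumes f: "\<And>i. continuous_map X euclideanreal (\<lambda>x. f x i)"
    and supp: "\<And>x i. \<lbrakk>x \<in> topspace X; i > m\<rbrakk> \<Longrightarrow> f x i = 0"
    and nz: "\<And>x. x \<in> topspace X \<Longrightarrow> \<exists>i. f x i \<noteq> 0"
  shows "continuous_map X (nsphere m) (\<lambda>x. unit (f x))"
proof (rule continuous_map_nsphereI)
  show "(\<lambda>x. unit (f x)) \<in> topspace X \<rightarrow> topspace (nsphere m)"
  proof
    fix x assume x: "x \<in> topspace X"
    then obtain k where "f x k \<noteq> 0" using nz by blast
    then show "unit (f x) \<in> topspace (nsphere m)" by (rule unit_in_nsphere [rotated]) (rule supp [OF x])
  qed
  show "continuous_map X euclideanreal (\<lambda>x. unit (f x) i)" for i
  proof (rule continuous_map_eq)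
    show "continuous_map X euclideanreal (\<lambda>x. f x i / sqrt (\<Sum>j\<le>m. (f x j)\<^sup>2))"
    proof (intro continuous_intros f)
      show "sqrt (\<Sum>j\<le>m. (f x j)\<^sup>2) \<noteq> 0" if x: "x \<in> topspace X" for x
      proof -
        obtain k where k: "f x k \<noteq> 0" using nz x by blast
        then have "k \<le> m" using supp [OF x, of k] by (cases "k \<le> m") auto
        then show ?thesis using k by (auto simp: sum_nonneg_eq_0_iff)
      qed
    qed auto
    show "f x i / sqrt (\<Sum>j\<le>m. (f x j)\<^sup>2) = unit (f x) i" if "x \<in> topspace X" for x
      using unit_eq [of m "f x"] supp that by simp
  qed
qed

definition pole :: "nat \<Rightarrow> real" where
  "pole i = (if i = 0 then 1 else 0)"

text \<open>
  A path from \<open>x\<close> through a multiple of its shift to the pole. If \<open>m\<close> is the last index with \<open>x m \<noteq> 0\<close>,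
  then for \<open>0 < t < 1\<close> only the shift contributes to the coordinate \<open>m + 1\<close>; so the path misses the
  origin without any case distinction on \<open>x\<close>, at the price of one more dimension.
\<close>

definition contract_raw :: "(nat \<Rightarrow> real) \<Rightarrow> real \<Rightarrow> nat \<Rightarrow> real" where
  "contract_raw x t = (\<lambda>i. (1 - t) * x i + t * (1 - t) * (if i = 0 then 0 else x (i - 1)) + t * pole i)"

definition contract :: "(nat \<Rightarrow> real) \<Rightarrow> real \<Rightarrow> nat \<Rightarrow> real" where
  "contract x t = unit (contract_raw x t)"

lemma contract_raw_nonzero:
  assumes x: "x \<in> topspace (nsphere n)" and t: "0 \<le> t" "t \<le> 1"
  shows "\<exists>i. contract_raw x t i \<noteq> 0"
proof -
  have fin: "finite {i. x i \<noteq> 0}"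
    by (rule finite_subset [of _ "{..n}"]) (use x in \<open>auto simp: topspace_nsphere not_le [symmetric]\<close>)
  have ne: "{i. x i \<noteq> 0} \<noteq> {}"
  proof
    assume "{i. x i \<noteq> 0} = {}"
    then have "x i = 0" for i by auto
    then show False using x by (simp add: topspace_nsphere)
  qed
  define m where "m = Max {i. x i \<noteq> 0}"
  have m: "x m \<noteq> 0" using Max_in [OF fin ne] by (simp add: m_def)
  have "x (Suc m) = 0"
  proof (rule ccontr)
    assume "x (Suc m) \<noteq> 0"
    then have "Suc m \<le> m" unfolding m_def using fin by (intro Max_ge) auto
    then show False by simp
  qed
  consider "t = 0" | "t = 1" | "0 < t" "t < 1" using t by linarith
  then show ?thesis
  proof cases
    case 1
    then show ?thesis using m by (auto simp: contract_raw_def)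
  next
    case 2
    then show ?thesis by (intro exI [of _ 0]) (simp add: contract_raw_def pole_def)
  next
    case 3
    then show ?thesis using m \<open>x (Suc m) = 0\<close>
      by (intro exI [of _ "Suc m"]) (simp add: contract_raw_def pole_def)
  qed
qed

lemma pole_in_nsphere: "pole \<in> topspace (nsphere n)"
  using in_topspace_nsphere [of n] by (simp add: pole_def [abs_def])

lemma contract_0: "x \<in> topspace (nsphere n) \<Longrightarrow> contract x 0 = x"
  by (simp add: contract_def contract_raw_def unit_id)

lemma contract_1: "contract x 1 = pole"
  using unit_id [OF pole_in_nsphere] by (simp add: contract_def contract_raw_def)

lemma continuous_map_contract:
  fixes k :: "'a::topological_space \<Rightarrow> nat \<Rightarrow> real"
  assumes k: "continuous_map (top_of_set C) (nsphere n) k"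
  shows "continuous_map (top_of_set (C \<times> {0..1})) (nsphere (Suc n)) (\<lambda>(a, t). contract (k a) t)"
proof -
  have kC: "k a \<in> topspace (nsphere n)" if "a \<in> C" for a
    using continuous_map_image_subset_topspace [OF k] that by auto
  have ki: "continuous_on C (\<lambda>a. k a i)" for i
    using continuous_map_compose [OF k continuous_map_nsphere_projection [of n i]] by (simp add: comp_def)
  have ki': "continuous_on (C \<times> {0..1}) (\<lambda>p. k (fst p) i)" for i
    by (rule continuous_on_compose2 [OF ki]) (auto intro!: continuous_intros)
  have "continuous_map (top_of_set (C \<times> {0..1})) (nsphere (Suc n)) (\<lambda>p. unit (contract_raw (k (fst p)) (snd p)))"
  proof (rule continuous_map_unit)
    show "continuous_map (top_of_set (C \<times> {0..1})) euclideanreal (\<lambda>p. contract_raw (k (fst p)) (snd p) i)" for i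
      unfolding contract_raw_def continuous_map_iff_continuous
      by (cases "i = 0") (auto intro!: continuous_intros ki')
    show "contract_raw (k (fst p)) (snd p) i = 0" if "p \<in> topspace (top_of_set (C \<times> {0..1}))" "Suc n < i" for p i
      using kC [of "fst p"] that by (auto simp: contract_raw_def topspace_nsphere pole_def)
    show "\<exists>i. contract_raw (k (fst p)) (snd p) i \<noteq> 0" if "p \<in> topspace (top_of_set (C \<times> {0..1}))" for p
      using that kC [of "fst p"] contract_raw_nonzero [of "k (fst p)" n "snd p"] by auto
  qed
  then show ?thesis by (simp add: contract_def case_prod_unfold)
qed

lemma continuous_map_contract_path:
  assumes "x \<in> topspace (nsphere n)"
  shows "continuous_map (top_of_set {0..1}) (nsphere (Suc n)) (contract x)"
proof -
  have k: "continuous_map (top_of_set {0::real}) (nsphere n) (\<lambda>a. x)" using assms by simp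
  have "continuous_map (top_of_set {0..1}) (top_of_set ({0::real} \<times> {0..1})) (\<lambda>t. (0::real, t::real))"
    by (auto intro!: continuous_intros)
  from continuous_map_compose [OF this continuous_map_contract [OF k]] show ?thesis
    by (simp add: comp_def)
qed

text \<open>
  The sphere is a retract of the set of nonzero vectors, which is open in a Euclidean space.
\<close>

lemma locally_path_connected_nsphere: "locally_path_connected_space (nsphere n)"
proof -
  let ?E = "Euclidean_space (Suc n)"
  let ?D = "{x \<in> topspace ?E. (\<Sum>i\<le>n. (x i)\<^sup>2) \<in> {0<..}}"
  have coord: "continuous_map ?E euclideanreal (\<lambda>x. x i)" for i
    unfolding Euclidean_space_def
    by (intro continuous_map_from_subtopology continuous_map_product_projection) simp
  have cont: "continuous_map ?E euclideanreal (\<lambda>x. \<Sum>i\<le>n. (x i)\<^sup>2)"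
    by (intro continuous_intros coord) auto
  have op: "openin ?E ?D"
    by (rule openin_continuous_map_preimage [OF cont]) simp
  have topD: "topspace (subtopology ?E ?D) = ?D" by auto
  have "retraction_map (subtopology ?E ?D) (nsphere n) unit"
    unfolding retraction_map_def retraction_maps_def
  proof (intro exI conjI)
    show "continuous_map (subtopology ?E ?D) (nsphere n) unit"
    proof (rule continuous_map_unit [where f = "\<lambda>x. x"])
      show "continuous_map (subtopology ?E ?D) euclideanreal (\<lambda>x. x i)" for i
        by (rule continuous_map_from_subtopology [OF coord])
      show "x i = 0" if "x \<in> topspace (subtopology ?E ?D)" "n < i" for x i
        using that by (auto simp: topspace_Euclidean_space)
      show "\<exists>i. x i \<noteq> 0" if "x \<in> topspace (subtopology ?E ?D)" for x
      proof (rule ccontr)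
        assume "\<nexists>i. x i \<noteq> 0"
        then show False using that by simp
      qed
    qed
    show "continuous_map (nsphere n) (subtopology ?E ?D) (\<lambda>x. x)"
      unfolding nsphere_def
      by (auto simp: continuous_map_in_subtopology continuous_map_from_subtopology topspace_Euclidean_space)
    show "\<forall>x\<in>topspace (nsphere n). unit x = x" using unit_id by blast
  qed
  moreover have "locally_path_connected_space (subtopology ?E ?D)"
    by (rule locally_path_connected_space_open_subset [OF locally_path_connected_Euclidean_space op])
  ultimately show ?thesis by (rule locally_path_connected_space_retraction_map_image)
qed

section \<open>The degree-one cohomology of infinite projective space\<close>

lemma list2E:
  assumes "length xs = 2"
  obtains a b where "xs = [a, b]"
  using assms by (auto simp: numeral_2_eq_2 length_Suc_conv)

text \<open>
  A primitive on the cover that takes the same value at \<open>x\<close> and \<open>- x\<close> is a primitive on the orbit space.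
\<close>

lemma (in antipodal_space) even_primitive_cohomologous_zero:
  assumes g: "nearly X 2 (\<lambda>xs. \<phi> (map orbit xs) = g (hd xs) + g (last xs))"
    and even: "\<And>x. x \<in> topspace X \<Longrightarrow> g (- x) = g x"
  shows "cohomologous (antipodal_quotient X) 1 \<phi> (\<lambda>xs. 0)"
proof -
  define \<eta> where "\<eta> ys = (if ys = [] then 0 else g (SOME x. x \<in> hd ys))" for ys :: "'a set list"
  have \<eta>: "\<eta> [orbit x] = g x" if "x \<in> topspace X" for x
  proof -
    have "(SOME y. y \<in> orbit x) \<in> orbit x" by (rule someI [of _ x]) (simp add: orbit_def)
    then have "(SOME y. y \<in> orbit x) = x \<or> (SOME y. y \<in> orbit x) = - x" by (simp add: orbit_def)
    then show ?thesis using even [OF that] unfolding \<eta>_def by auto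
  qed
  show ?thesis
  proof (rule cohomologousI [of \<eta>])
    show "nearly (antipodal_quotient X) (Suc 1) (\<lambda>xs. \<phi> xs + 0 = as_delta \<eta> xs)"
    proof (rule nearly_descend)
      have "nearly X 2 (\<lambda>xs. \<phi> (map orbit xs) + 0 = as_delta \<eta> (map orbit xs))"
      proof (rule nearly_mono [OF g])
        fix xs :: "'a list"
        assume xs: "length xs = 2" "set xs \<subseteq> topspace X"
          and "\<phi> (map orbit xs) = g (hd xs) + g (last xs)"
        moreover from xs(1) obtain a b where "xs = [a, b]" by (rule list2E)
        ultimately show "\<phi> (map orbit xs) + 0 = as_delta \<eta> (map orbit xs)" by (simp add: \<eta> add.commute)
      qed
      then show "nearly X (Suc 1) (\<lambda>xs. \<phi> (map orbit xs) + 0 = as_delta \<eta> (map orbit xs))"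
        by (simp add: numeral_2_eq_2)
    qed
  qed (simp add: \<eta>_def)
qed

definition primitive_on :: "'a::topological_space set \<Rightarrow> ('a \<Rightarrow> 'b) \<Rightarrow> ('b list \<Rightarrow> bit) \<Rightarrow> ('a \<Rightarrow> bit) \<Rightarrow> bool" where
  "primitive_on C k \<phi> f \<longleftrightarrow>
     nearly (top_of_set C) 2 (\<lambda>xs. \<phi> (map k xs) = f (hd xs) + f (last xs))"

lemma exists_primitive:
  fixes C :: "'a::real_normed_vector set"
  assumes "convex C" "continuous_map (top_of_set C) Y k" "\<phi> \<in> as_cocycles Y 1"
  obtains f where "primitive_on C k \<phi> f"
proof -
  have "cohomologous (top_of_set C) 1 (\<lambda>xs. \<phi> (map k xs)) (\<lambda>xs. 0)"
    using assms by (intro convex_cocycle_cohomologous_zero) auto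
  from cohomologousE [OF this] obtain \<eta>
    where \<eta>: "nearly (top_of_set C) (Suc 1) (\<lambda>xs. \<phi> (map k xs) + 0 = as_delta \<eta> xs)" .
  have "primitive_on C k \<phi> (\<lambda>a. \<eta> [a])"
    unfolding primitive_on_def
  proof (rule nearly_mono [OF \<eta> [unfolded Suc_1 One_nat_def [symmetric] numeral_2_eq_2 [symmetric]], simplified])
    fix xs :: "'a list"
    assume "length xs = 2" and "\<phi> (map k xs) = as_delta \<eta> xs"
    moreover from this(1) obtain a b where "xs = [a, b]" by (rule list2E)
    ultimately show "\<phi> (map k xs) = \<eta> [hd xs] + \<eta> [last xs]" by (simp add: add.commute)
  qed
  then show ?thesis by (rule that)
qed

lemma primitive_restrict:
  assumes "primitive_on C k \<phi> f" "continuous_map (top_of_set C') (top_of_set C) j"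
  shows "primitive_on C' (\<lambda>a. k (j a)) \<phi> (\<lambda>a. f (j a))"
  unfolding primitive_on_def
proof (rule nearly_mono [OF nearly_pullback [OF assms(1) [unfolded primitive_on_def] assms(2)]])
  fix xs :: "'c list"
  assume "length xs = 2" and *: "\<phi> (map k (map j xs)) = f (hd (map j xs)) + f (last (map j xs))"
  then have "xs \<noteq> []" by auto
  then show "\<phi> (map (\<lambda>a. k (j a)) xs) = f (j (hd xs)) + f (j (last xs))"
    using * by (simp add: hd_map last_map comp_def)
qed

lemma primitive_cong:
  assumes "primitive_on C k \<phi> f" "\<And>a. a \<in> C \<Longrightarrow> k a = k' a" "\<And>a. a \<in> C \<Longrightarrow> f a = f' a"
  shows "primitive_on C k' \<phi> f'"
  unfolding primitive_on_def
proof (rule nearly_mono [OF assms(1) [unfolded primitive_on_def]])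
  fix xs :: "'a list"
  assume xs: "length xs = 2" "set xs \<subseteq> topspace (top_of_set C)" and "\<phi> (map k xs) = f (hd xs) + f (last xs)"
  moreover have "map k xs = map k' xs" using xs assms(2) by (auto intro: map_cong)
  moreover have "hd xs \<in> C" "last xs \<in> C"
    using xs by (cases xs; auto)+
  ultimately show "\<phi> (map k' xs) = f' (hd xs) + f' (last xs)" using assms(3) by simp
qed

text \<open>
  Two primitives differ by a locally constant function.
\<close>

lemma primitive_unique:
  assumes "primitive_on C k \<phi> f" "primitive_on C k \<phi> f'" "connected C" "a \<in> C" "b \<in> C"
  shows "f a + f b = f' a + f' b"
proof -
  have "nearly (top_of_set C) 2 (\<lambda>xs. f (hd xs) + f' (hd xs) = f (last xs) + f' (last xs))"
  proof (rule nearly_mono [OF nearly_conj [OF assms(1,2) [unfolded primitive_on_def]]])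
    fix xs :: "'a list"
    assume "\<phi> (map k xs) = f (hd xs) + f (last xs) \<and> \<phi> (map k xs) = f' (hd xs) + f' (last xs)"
    then have "f (hd xs) + f (last xs) = f' (hd xs) + f' (last xs)" by metis
    then show "f (hd xs) + f' (hd xs) = f (last xs) + f' (last xs)"
      by (cases "f (hd xs)"; cases "f (last xs)"; cases "f' (hd xs)"; cases "f' (last xs)") auto
  qed
  from nearly_constant_on_connected [where f = "\<lambda>x. f x + f' x", OF this assms(3-5)]
  show ?thesis
    by (cases "f a"; cases "f b"; cases "f' a"; cases "f' b") auto
qed

lemma cocycle_degenerate:
  assumes "\<phi> \<in> as_cocycles Y 1" "y \<in> topspace Y"
  shows "\<phi> [y, y] = 0"
proof -
  from nearlyE [OF assms(1) [unfolded cocycles_iff] assms(2)] obtain U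
    where U: "y \<in> U" "\<forall>xs. length xs = 1 + 2 \<longrightarrow> set xs \<subseteq> U \<longrightarrow> as_delta \<phi> xs = 0" .
  have "as_delta \<phi> [y, y, y] = 0" using U by simp
  then show ?thesis by (simp add: as_delta_Cons)
qed

text \<open>
  The value of \<open>\<phi>\<close> along the path that contracts \<open>x\<close> to the pole, which is a candidate for a primitive of
  \<open>\<phi>\<close> on the sphere.
\<close>

definition holonomy :: "((nat \<Rightarrow> real) list \<Rightarrow> bit) \<Rightarrow> (nat \<Rightarrow> real) \<Rightarrow> bit" where
  "holonomy \<phi> x = (SOME v. \<exists>f. primitive_on {0..1} (contract x) \<phi> f \<and> v = f 0 + f 1)"

lemma holonomy_eq:
  assumes "primitive_on {0..1} (contract x) \<phi> f"
  shows "holonomy \<phi> x = f 0 + f 1"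
proof -
  have "\<exists>f. primitive_on {0..1} (contract x) \<phi> f \<and> holonomy \<phi> x = f 0 + f 1"
    unfolding holonomy_def by (rule someI [of _ "f 0 + f 1"]) (use assms in blast)
  then obtain f' where f': "primitive_on {0..1} (contract x) \<phi> f'" "holonomy \<phi> x = f' 0 + f' 1" by blast
  then show ?thesis using primitive_unique [OF f'(1) assms, of 0 1] by simp
qed

text \<open>
  Contracting the whole path sweeps out a square. The pullback of \<open>\<phi>\<close> to the square has a primitive, and the
  edge opposite to the path is constant, so the holonomy agrees along the path with that
  primitive up to a constant.
\<close>

lemma holonomy_primitive_on_path:
  assumes \<phi>: "\<phi> \<in> as_cocycles infinite_sphere 1"
    and \<gamma>: "continuous_map (top_of_set {0..1::real}) (nsphere n) \<gamma>"
  shows "primitive_on {0..1} \<gamma> \<phi> (\<lambda>r. holonomy \<phi> (\<gamma> r))"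
proof -
  let ?I = "{0..1::real}"
  let ?k = "\<lambda>(r, t). contract (\<gamma> r) t"
  have "continuous_map (top_of_set (?I \<times> ?I)) infinite_sphere ?k"
    using continuous_map_compose [OF continuous_map_contract [OF \<gamma>] continuous_map_into_infinite_sphere]
    by (simp add: comp_def)
  then obtain f where f: "primitive_on (?I \<times> ?I) ?k \<phi> f"
    using exists_primitive [OF _ _ \<phi>] convex_Times [of ?I ?I] by (metis convex_real_interval(5))
  have \<gamma>_top: "\<gamma> r \<in> topspace (nsphere n)" if "r \<in> ?I" for r
    using continuous_map_image_subset_topspace [OF \<gamma>] that by auto
  have hol: "holonomy \<phi> (\<gamma> r) = f (r, 0) + f (r, 1)" if "r \<in> ?I" for r
  proof -
    have "continuous_map (top_of_set ?I) (top_of_set (?I \<times> ?I)) (\<lambda>t. (r, t))"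
      using that by (auto intro!: continuous_intros)
    from primitive_restrict [OF f this] show ?thesis by (simp add: holonomy_eq)
  qed
  have "continuous_map (top_of_set ?I) (top_of_set (?I \<times> ?I)) (\<lambda>r. (r, 1))"
    by (auto intro!: continuous_intros)
  from primitive_restrict [OF f this]
  have end1: "primitive_on ?I (\<lambda>r. pole) \<phi> (\<lambda>r. f (r, 1))" by (simp add: contract_1)
  have "primitive_on ?I (\<lambda>r. pole) \<phi> (\<lambda>r. 0)"
  proof -
    have "pole \<in> topspace infinite_sphere" using pole_in_nsphere by (auto simp: topspace_infinite_sphere)
    then have z: "\<phi> [pole, pole] = 0" by (rule cocycle_degenerate [OF \<phi>])
    have "\<phi> (map (\<lambda>r. pole) xs) = 0" if "length xs = 2" for xs :: "real list"
    proof -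
      obtain a b where "xs = [a, b]" using \<open>length xs = 2\<close> by (rule list2E)
      then show ?thesis using z by simp
    qed
    then show ?thesis unfolding primitive_on_def by (intro nearlyI exI [of _ ?I]) auto
  qed
  then have const: "f (r, 1) = f (0, 1)" if "r \<in> ?I" for r
    using primitive_unique [OF end1, of "\<lambda>r. 0" r 0] that by (simp add: bit_add_eq_0_iff)
  have "continuous_map (top_of_set ?I) (top_of_set (?I \<times> ?I)) (\<lambda>r. (r, 0))"
    by (auto intro!: continuous_intros)
  from primitive_restrict [OF f this]
  have "primitive_on ?I (\<lambda>r. contract (\<gamma> r) 0) \<phi> (\<lambda>r. f (r, 0))" by simp
  then have f0: "primitive_on ?I \<gamma> \<phi> (\<lambda>r. f (r, 0))"
    by (rule primitive_cong) (use \<gamma>_top contract_0 in auto)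
  have "primitive_on ?I \<gamma> \<phi> (\<lambda>r. f (r, 0) + f (0, 1))"
    unfolding primitive_on_def
    by (rule nearly_mono [OF f0 [unfolded primitive_on_def]]) (simp add: ac_simps)
  then show ?thesis
  proof (rule primitive_cong)
    show "f (r, 0) + f (0, 1) = holonomy \<phi> (\<gamma> r)" if "r \<in> ?I" for r
      by (simp only: hol [OF that] const [OF that])
  qed simp
qed

lemma holonomy_along_path:
  assumes \<phi>: "\<phi> \<in> as_cocycles infinite_sphere 1"
    and U: "\<And>xs. \<lbrakk>length xs = 3; set xs \<subseteq> U\<rbrakk> \<Longrightarrow> as_delta \<phi> xs = 0" "U \<subseteq> topspace infinite_sphere"
    and path: "path_component_of (subtopology (nsphere n) U) x y"
  shows "\<phi> [x, y] = holonomy \<phi> x + holonomy \<phi> y"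
proof -
  let ?I = "{0..1::real}"
  obtain \<gamma> where \<gamma>: "continuous_map (top_of_set ?I) (subtopology (nsphere n) U) \<gamma>" "\<gamma> 0 = x" "\<gamma> 1 = y"
    using path by (auto simp: path_component_of_def pathin_def)
  have \<gamma>n: "continuous_map (top_of_set ?I) (nsphere n) \<gamma>"
    using \<gamma>(1) by (simp add: continuous_map_in_subtopology)
  have \<gamma>U: "\<gamma> r \<in> U" if "r \<in> ?I" for r
    using \<gamma>(1) that by (auto simp: continuous_map_in_subtopology)
  have 1: "primitive_on ?I \<gamma> \<phi> (\<lambda>r. holonomy \<phi> (\<gamma> r))"
    by (rule holonomy_primitive_on_path [OF \<phi> \<gamma>n])
  have 2: "primitive_on ?I \<gamma> \<phi> (\<lambda>r. \<phi> [\<gamma> 0, \<gamma> r])"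
    unfolding primitive_on_def
  proof (rule nearlyI, rule exI [of _ ?I], intro conjI allI impI)
    fix xs assume xs: "length xs = 2" "set xs \<subseteq> ?I"
    from xs(1) obtain a b where ab: "xs = [a, b]" by (rule list2E)
    have "as_delta \<phi> [\<gamma> 0, \<gamma> a, \<gamma> b] = 0"
      using xs \<gamma>U by (intro U(1)) (auto simp: ab)
    then show "\<phi> (map \<gamma> xs) = \<phi> [\<gamma> 0, \<gamma> (hd xs)] + \<phi> [\<gamma> 0, \<gamma> (last xs)]"
      by (simp add: ab as_delta_Cons bit_add_eq_0_iff add.commute)
  qed auto
  have "\<phi> [x, x] = 0"
    using \<gamma>U [of 0] U(2) \<gamma>(2) by (intro cocycle_degenerate [OF \<phi>]) auto
  then show ?thesis
    using primitive_unique [OF 1 2, of 0 1] \<gamma> by simp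
qed

text \<open>
  The infinite sphere is simply connected. Continuity of the holonomy is awkward in the direct limit
  topology; it suffices to know it along paths, provided that small neighbourhoods can be chosen in
  which any two points are joined by a path in a finite-dimensional sphere.
\<close>

proposition infinite_sphere_degree_one:
  assumes \<phi>: "\<phi> \<in> as_cocycles infinite_sphere 1"
  shows "nearly infinite_sphere 2 (\<lambda>xs. \<phi> xs = holonomy \<phi> (hd xs) + holonomy \<phi> (last xs))"
proof (rule nearlyI)
  fix x assume x: "x \<in> topspace infinite_sphere"
  from nearlyE [OF \<phi> [unfolded cocycles_iff] x] obtain U where U: "openin infinite_sphere U" "x \<in> U"
    and "\<forall>xs. length xs = 1 + 2 \<longrightarrow> set xs \<subseteq> U \<longrightarrow> as_delta \<phi> xs = 0" .
  then have dU: "as_delta \<phi> xs = 0" if "length xs = 3" "set xs \<subseteq> U" for xs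
    using that by simp
  have Utop: "U \<subseteq> topspace infinite_sphere" using U(1) by (rule openin_subset)
  define P where "P n = path_component_of_set (subtopology (nsphere n) U) x" for n
  have PU: "P n \<subseteq> U \<inter> topspace (nsphere n)" for n
    using path_component_of_subset_topspace [of "subtopology (nsphere n) U" x] by (auto simp: P_def)
  have P_mono: "P m \<subseteq> P n" if "m \<le> n" for m n
  proof -
    have "continuous_map (subtopology (nsphere m) U) (subtopology (nsphere n) U) (\<lambda>x. x)"
      using continuous_map_nsphere_inclusion [OF that]
      by (auto simp: continuous_map_in_subtopology continuous_map_from_subtopology)
    then show ?thesis
      unfolding P_def path_component_of_def using pathin_compose by (fastforce simp: comp_def)
  qed
  have P_open: "openin (nsphere n) (P n)" for n
  proof (cases "x \<in> topspace (nsphere n)")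
    case True
    have "openin (nsphere n) (U \<inter> topspace (nsphere n))"
      using U(1) by (simp add: openin_infinite_sphere)
    then have "openin (nsphere n) (path_component_of_set (subtopology (nsphere n) (U \<inter> topspace (nsphere n))) x)"
      using locally_path_connected_nsphere [of n] True U(2)
      unfolding locally_path_connected_space_eq_open_path_component_of by blast
    moreover have "subtopology (nsphere n) (U \<inter> topspace (nsphere n)) = subtopology (nsphere n) U"
      by (metis Int_commute subtopology_restrict)
    ultimately show ?thesis by (simp add: P_def)
  next
    case False
    then have "P n = {}"
      unfolding P_def using path_component_of_eq_empty [of "subtopology (nsphere n) U" x] by simp
    then show ?thesis by simp
  qed
  (* The components in the individual spheres increase with the dimension, so their union is open in
   the direct limit. *)
  define V where "V = (\<Union>n. P n)"
  have "openin infinite_sphere V"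
    unfolding openin_infinite_sphere
  proof (intro conjI allI)
    show "V \<subseteq> (\<Union>n. topspace (nsphere n))" using PU by (auto simp: V_def)
    fix n
    have "V \<inter> topspace (nsphere n) = (\<Union>m\<in>{n..}. {y \<in> topspace (nsphere n). y \<in> P m})"
    proof
      show "V \<inter> topspace (nsphere n) \<subseteq> (\<Union>m\<in>{n..}. {y \<in> topspace (nsphere n). y \<in> P m})"
      proof
        fix y assume "y \<in> V \<inter> topspace (nsphere n)"
        then obtain m where "y \<in> P m" "y \<in> topspace (nsphere n)" by (auto simp: V_def)
        then show "y \<in> (\<Union>m\<in>{n..}. {y \<in> topspace (nsphere n). y \<in> P m})"
          using P_mono [of m "max m n"] by (intro UN_I [of "max m n"]) auto
      qed
    qed (auto simp: V_def)
    moreover have "openin (nsphere n) {y \<in> topspace (nsphere n). y \<in> P m}" if "n \<le> m" for m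
      using openin_continuous_map_preimage [OF continuous_map_nsphere_inclusion [OF that] P_open] .
    ultimately show "openin (nsphere n) (V \<inter> topspace (nsphere n))" by auto
  qed
  moreover have "x \<in> V"
  proof -
    obtain n where "x \<in> topspace (nsphere n)" using infinite_sphere_nsphere [OF x] by blast
    then have "x \<in> P n" using U(2) by (simp add: P_def path_component_of_refl)
    then show ?thesis by (auto simp: V_def)
  qed
  moreover have "\<phi> xs = holonomy \<phi> (hd xs) + holonomy \<phi> (last xs)" if "length xs = 2" "set xs \<subseteq> V" for xs
  proof -
    obtain a b where ab: "xs = [a, b]" using \<open>length xs = 2\<close> by (rule list2E)
    have hol: "\<phi> [x, y] = holonomy \<phi> x + holonomy \<phi> y" "y \<in> U" if y: "y \<in> V" for y
    proof -
      obtain n where n: "y \<in> P n" using y by (auto simp: V_def)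
      then show "y \<in> U" using PU by blast
      show "\<phi> [x, y] = holonomy \<phi> x + holonomy \<phi> y"
        by (rule holonomy_along_path [OF \<phi> dU Utop, where n = n]) (use n in \<open>auto simp: P_def\<close>)
    qed
    have "as_delta \<phi> [x, a, b] = 0"
      using U(2) hol(2) that by (intro dU) (auto simp: ab)
    then have "\<phi> [a, b] = \<phi> [x, a] + \<phi> [x, b]"
      by (simp add: as_delta_Cons bit_add_eq_0_iff add.commute)
    also have "\<dots> = holonomy \<phi> a + holonomy \<phi> b"
      using hol(1) that by (simp add: ab ac_simps)
    finally show ?thesis by (simp add: ab)
  qed
  ultimately show "\<exists>V. openin infinite_sphere V \<and> x \<in> V \<and>
      (\<forall>xs. length xs = 2 \<longrightarrow> set xs \<subseteq> V \<longrightarrow> \<phi> xs = holonomy \<phi> (hd xs) + holonomy \<phi> (last xs))" by blast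
qed

text \<open>
  Each point is joined to the pole by its contraction.
\<close>

lemma infinite_sphere_locally_constant:
  fixes f :: "(nat \<Rightarrow> real) \<Rightarrow> 'b"
  assumes f: "nearly infinite_sphere 2 (\<lambda>xs. f (hd xs) = f (last xs))" and x: "x \<in> topspace infinite_sphere"
  shows "f x = f pole"
proof -
  obtain n where n: "x \<in> topspace (nsphere n)" using infinite_sphere_nsphere [OF x] by blast
  have "continuous_map (top_of_set {0..1}) infinite_sphere (contract x)"
    using continuous_map_compose [OF continuous_map_contract_path [OF n] continuous_map_into_infinite_sphere]
    by (simp add: comp_def)
  from nearly_pullback [OF f this]
  have "nearly (top_of_set {0..1}) 2 (\<lambda>xs. f (contract x (hd xs)) = f (contract x (last xs)))"
  proof (rule nearly_mono)
    fix xs :: "real list"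
    assume "length xs = 2" and *: "f (hd (map (contract x) xs)) = f (last (map (contract x) xs))"
    then have "xs \<noteq> []" by auto
    with * show "f (contract x (hd xs)) = f (contract x (last xs))" by (simp add: hd_map last_map)
  qed
  then have "f (contract x 0) = f (contract x 1)"
    by (rule nearly_constant_on_connected) auto
  then show ?thesis using contract_0 [OF n] contract_1 by simp
qed

definition sphere_primitive :: "((nat \<Rightarrow> real) set list \<Rightarrow> bit) \<Rightarrow> ((nat \<Rightarrow> real) \<Rightarrow> bit) \<Rightarrow> bool" where
  "sphere_primitive \<phi> g \<longleftrightarrow> nearly infinite_sphere 2 (\<lambda>xs. \<phi> (map orbit xs) = g (hd xs) + g (last xs))"

lemma exists_sphere_primitive:
  assumes "\<phi> \<in> as_cocycles RP_infinity 1"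
  obtains g where "sphere_primitive \<phi> g"
proof
  have "(\<lambda>xs. \<phi> (map orbit xs)) \<in> as_cocycles infinite_sphere 1"
    using assms infinite_sphere.continuous_map_orbit unfolding RP_infinity_def by (rule cocycle_pullback)
  from infinite_sphere_degree_one [OF this]
  show "sphere_primitive \<phi> (holonomy (\<lambda>xs. \<phi> (map orbit xs)))" by (simp add: sphere_primitive_def)
qed

text \<open>
  The pullback of \<open>\<phi>\<close> is invariant under the antipodal map, so \<open>g\<close> and its reflection are both primitives.
\<close>

lemma sphere_primitive_parity:
  assumes g: "sphere_primitive \<phi> g" and x: "x \<in> topspace infinite_sphere"
  shows "g (- x) + g x = g (- pole) + g pole"
proof (rule infinite_sphere_locally_constant [OF _ x])
  have neg: "nearly infinite_sphere 2
      (\<lambda>xs. \<phi> (map orbit (map uminus xs)) = g (hd (map uminus xs)) + g (last (map uminus xs)))"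
    using g unfolding sphere_primitive_def by (rule nearly_pullback [OF _ continuous_map_infinite_sphere_neg])
  show "nearly infinite_sphere 2 (\<lambda>xs. g (- hd xs) + g (hd xs) = g (- last xs) + g (last xs))"
  proof (rule nearly_mono [OF nearly_conj [OF g [unfolded sphere_primitive_def] neg]])
    fix xs :: "(nat \<Rightarrow> real) list"
    assume "length xs = 2"
      and *: "\<phi> (map orbit xs) = g (hd xs) + g (last xs) \<and>
        \<phi> (map orbit (map uminus xs)) = g (hd (map uminus xs)) + g (last (map uminus xs))"
    then have "xs \<noteq> []" by auto
    moreover have "map orbit (map uminus xs) = map orbit xs" by simp
    ultimately have "g (hd xs) + g (last xs) = g (- hd xs) + g (- last xs)"
      using * by (metis hd_map last_map)
    then show "g (- hd xs) + g (hd xs) = g (- last xs) + g (last xs)"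
      by (cases "g (hd xs)"; cases "g (last xs)"; cases "g (- hd xs)"; cases "g (- last xs)") auto
  qed
qed

text \<open>
  The constant \<open>g (- x) + g x\<close> is the only invariant of a degree-one class of infinite projective space.
  Hence there are at most two classes.
\<close>

lemma cohomologous_zero_iff_even:
  assumes g: "sphere_primitive \<phi> g"
  shows "cohomologous RP_infinity 1 \<phi> (\<lambda>xs. 0) \<longleftrightarrow> g (- pole) = g pole"
proof
  assume "cohomologous RP_infinity 1 \<phi> (\<lambda>xs. 0)"
  have "\<exists>h. sphere_primitive \<phi> (\<lambda>x. h (orbit x))"
  proof -
    from cohomologousE [OF \<open>cohomologous RP_infinity 1 \<phi> (\<lambda>xs. 0)\<close>] obtain \<eta>
      where \<eta>: "nearly RP_infinity (Suc 1) (\<lambda>xs. \<phi> xs + 0 = as_delta \<eta> xs)" .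
    have "sphere_primitive \<phi> (\<lambda>x. \<eta> [orbit x])"
      unfolding sphere_primitive_def
    proof (rule nearly_mono)
      show "nearly infinite_sphere 2 (\<lambda>xs. \<phi> (map orbit xs) + 0 = as_delta \<eta> (map orbit xs))"
        using nearly_pullback [OF \<eta> [unfolded RP_infinity_def] infinite_sphere.continuous_map_orbit]
        by (simp add: numeral_2_eq_2)
      fix xs :: "(nat \<Rightarrow> real) list"
      assume "length xs = 2" and *: "\<phi> (map orbit xs) + 0 = as_delta \<eta> (map orbit xs)"
      moreover from this(1) obtain a b where "xs = [a, b]" by (rule list2E)
      ultimately show "\<phi> (map orbit xs) = \<eta> [orbit (hd xs)] + \<eta> [orbit (last xs)]" by (simp add: add.commute)
    qed
    then show ?thesis by (rule exI [of _ "\<lambda>y. \<eta> [y]"])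
  qed
  then obtain h where h: "sphere_primitive \<phi> (\<lambda>x. h (orbit x))" by blast
  have "g x + h (orbit x) = g pole + h (orbit pole)" if "x \<in> topspace infinite_sphere" for x
  proof (rule infinite_sphere_locally_constant [OF _ that])
    show "nearly infinite_sphere 2 (\<lambda>xs. g (hd xs) + h (orbit (hd xs)) = g (last xs) + h (orbit (last xs)))"
    proof (rule nearly_mono [OF nearly_conj [OF g [unfolded sphere_primitive_def] h [unfolded sphere_primitive_def]]])
      fix xs :: "(nat \<Rightarrow> real) list"
      assume "\<phi> (map orbit xs) = g (hd xs) + g (last xs) \<and>
        \<phi> (map orbit xs) = h (orbit (hd xs)) + h (orbit (last xs))"
      then have "g (hd xs) + g (last xs) = h (orbit (hd xs)) + h (orbit (last xs))" by metis
      then show "g (hd xs) + h (orbit (hd xs)) = g (last xs) + h (orbit (last xs))"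
        by (cases "g (hd xs)"; cases "g (last xs)"; cases "h (orbit (hd xs))"; cases "h (orbit (last xs))") auto
    qed
  qed
  from this [of "- pole"] show "g (- pole) = g pole"
    using pole_in_nsphere infinite_sphere.neg_topspace [of pole]
    by (auto simp: topspace_infinite_sphere)
next
  assume even: "g (- pole) = g pole"
  have g_even: "g (- x) = g x" if "x \<in> topspace infinite_sphere" for x
    using sphere_primitive_parity [OF g that] even by (simp add: bit_add_eq_0_iff)
  show "cohomologous RP_infinity 1 \<phi> (\<lambda>xs. 0)"
    unfolding RP_infinity_def
    by (rule infinite_sphere.even_primitive_cohomologous_zero [OF g [unfolded sphere_primitive_def] g_even])
qed

text \<open>
  The sum has finite support on the infinite sphere, whatever the dimension.
\<close>

definition dot :: "(nat \<Rightarrow> real) \<Rightarrow> (nat \<Rightarrow> real) \<Rightarrow> real" where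
  "dot x y = (\<Sum>j | x j \<noteq> 0. x j * y j)"

lemma dot_eq: "x \<in> topspace (nsphere n) \<Longrightarrow> dot x y = (\<Sum>j\<le>n. x j * y j)"
  unfolding dot_def by (rule sum_support) (simp add: topspace_nsphere)

text \<open>
  Unit vectors satisfy \<open>\<parallel>y - z\<parallel>\<^sup>2 = 2 - 2 * dot y z\<close>. Both squared distances to \<open>x\<close> are below \<open>1 / 2\<close>, so that
  between \<open>y\<close> and \<open>z\<close> is below \<open>2\<close>.
\<close>

lemma dot_positive_of_near:
  assumes x: "x \<in> topspace infinite_sphere" and y: "y \<in> topspace infinite_sphere"
    and z: "z \<in> topspace infinite_sphere" and xy: "3 / 4 < dot x y" and xz: "3 / 4 < dot x z"
  shows "0 < dot y z"
proof -
  obtain l m n where lmn: "x \<in> topspace (nsphere l)" "y \<in> topspace (nsphere m)" "z \<in> topspace (nsphere n)"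
    using x y z by (auto simp: topspace_infinite_sphere)
  define N where "N = max l (max m n)"
  have N: "x \<in> topspace (nsphere N)" "y \<in> topspace (nsphere N)" "z \<in> topspace (nsphere N)"
    by (rule subsetD [OF nsphere_mono lmn(1)], simp add: N_def)
      (rule subsetD [OF nsphere_mono lmn(2)], simp add: N_def,
        rule subsetD [OF nsphere_mono lmn(3)], simp add: N_def)
  have one: "(\<Sum>j\<le>N. (x j)\<^sup>2) = 1" "(\<Sum>j\<le>N. (y j)\<^sup>2) = 1" "(\<Sum>j\<le>N. (z j)\<^sup>2) = 1"
    using N by (auto simp: topspace_nsphere)
  have sq: "(\<Sum>j\<le>N. (a j - b j)\<^sup>2) = (\<Sum>j\<le>N. (a j)\<^sup>2) + (\<Sum>j\<le>N. (b j)\<^sup>2) - 2 * (\<Sum>j\<le>N. a j * b j)"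
    for a b :: "nat \<Rightarrow> real"
    by (simp add: power2_diff sum.distrib sum_subtractf sum_distrib_left mult.assoc)
  have "(\<Sum>j\<le>N. (y j - z j)\<^sup>2) \<le> (\<Sum>j\<le>N. 2 * (x j - y j)\<^sup>2 + 2 * (x j - z j)\<^sup>2)"
  proof (rule sum_mono)
    fix j
    have "0 \<le> ((x j - y j) + (x j - z j))\<^sup>2" by simp
    then show "(y j - z j)\<^sup>2 \<le> 2 * (x j - y j)\<^sup>2 + 2 * (x j - z j)\<^sup>2"
      by (simp add: power2_eq_square algebra_simps)
  qed
  also have "\<dots> = 2 * (\<Sum>j\<le>N. (x j - y j)\<^sup>2) + 2 * (\<Sum>j\<le>N. (x j - z j)\<^sup>2)"
    by (simp add: sum.distrib sum_distrib_left)
  finally show ?thesis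
    using xy xz unfolding sq one dot_eq [OF N(1)] dot_eq [OF N(2)] by simp
qed

lemma nearly_dot_positive: "nearly infinite_sphere 2 (\<lambda>xs. 0 < dot (hd xs) (last xs))"
proof (rule nearlyI)
  fix x assume x: "x \<in> topspace infinite_sphere"
  obtain m where m: "x \<in> topspace (nsphere m)" using infinite_sphere_nsphere [OF x] by blast
  have dx: "dot x = (\<lambda>y. \<Sum>j\<le>m. x j * y j)" using dot_eq [OF m] by blast
  have "continuous_map infinite_sphere euclideanreal (dot x)"
    unfolding dx
    by (intro continuous_map_from_infinite_sphere continuous_intros continuous_map_nsphere_projection) auto
  from openin_continuous_map_preimage [OF this, of "{3/4<..}"]
  have op: "openin infinite_sphere {y \<in> topspace infinite_sphere. dot x y \<in> {3/4<..}}" by simp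
  have "dot x x = 1" using m unfolding dx by (simp add: topspace_nsphere power2_eq_square)
  moreover have "0 < dot (hd xs) (last xs)"
    if "length xs = 2" "set xs \<subseteq> {y \<in> topspace infinite_sphere. dot x y \<in> {3/4<..}}" for xs
  proof -
    obtain a b where ab: "xs = [a, b]" using \<open>length xs = 2\<close> by (rule list2E)
    then show ?thesis using that(2) dot_positive_of_near [OF x, of a b] by simp
  qed
  ultimately show "\<exists>U. openin infinite_sphere U \<and> x \<in> U \<and> (\<forall>xs. length xs = 2 \<longrightarrow> set xs \<subseteq> U \<longrightarrow> 0 < dot (hd xs) (last xs))"
    using op x by (intro exI [of _ "{y \<in> topspace infinite_sphere. dot x y \<in> {3/4<..}}"]) auto
qed

lemma infinite_sphere_nonzero: "x \<in> topspace infinite_sphere \<Longrightarrow> - x \<noteq> x"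
proof
  assume "x \<in> topspace infinite_sphere" and neg: "- x = x"
  then obtain n where n: "x \<in> topspace (nsphere n)" using infinite_sphere_nsphere by blast
  have "x i = 0" for i using fun_cong [OF neg, of i] by simp
  then show False using n by (simp add: topspace_nsphere)
qed

text \<open>
  The nonzero class exists because any odd function, continuous or not, has a coboundary that
  is invariant under the antipodal map and therefore descends; it is nonzero because the
  function is odd. It is unique because the sum of two such classes has an even primitive.
\<close>

proposition RP_omega_class:
  obtains w g where "w \<in> as_cocycles RP_infinity 1" "RP_omega = as_class RP_infinity 1 w" "sphere_primitive w g"
    "\<And>x. x \<in> topspace infinite_sphere \<Longrightarrow> g (- x) = g x + 1"
proof -
  obtain g :: "(nat \<Rightarrow> real) \<Rightarrow> bit" where g: "\<And>x. - x \<noteq> x \<Longrightarrow> g (- x) = g x + 1"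
    using infinite_sphere.exists_odd_function by blast
  have g_odd: "g (- x) = g x + 1" if "x \<in> topspace infinite_sphere" for x
    using g infinite_sphere_nonzero [OF that] by blast
  define F where "F xs = as_delta (\<lambda>ys. g (hd ys)) xs * (if length xs = 2 then 1 else 0)" for xs
  have F2: "F xs = g (hd xs) + g (last xs)" if "length xs = 2" for xs
  proof -
    obtain a b where "xs = [a, b]" using \<open>length xs = 2\<close> by (rule list2E)
    then show ?thesis by (simp add: F_def add.commute)
  qed
  obtain w where w: "nearly infinite_sphere 2 (\<lambda>xs. w (map orbit xs) = F xs)"
  proof (rule infinite_sphere.invariant_cochain_descends [of "\<lambda>x y. 0 < dot x y" F 2])
    show "nearly infinite_sphere 2 (\<lambda>xs. 0 < dot (hd xs) (last xs))" by (rule nearly_dot_positive)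
    show "\<not> 0 < dot x (- y)" if "0 < dot x y" for x y
      using that by (simp add: dot_def sum_negf)
    show "0 < dot (- x) (- y)" if "0 < dot x y" for x y
      using that by (simp add: dot_def)
    show "F (map uminus xs) = F xs" if "set xs \<subseteq> topspace infinite_sphere" for xs
    proof (cases "length xs = 2")
      case True
      then obtain a b where "xs = [a, b]" by (rule list2E)
      then show ?thesis using that g_odd [of a] g_odd [of b] by (simp add: F_def ac_simps)
    next
      case False
      then show ?thesis by (simp add: F_def)
    qed
  qed
  have wg: "sphere_primitive w g"
    unfolding sphere_primitive_def by (rule nearly_mono [OF w]) (simp add: F2)
  have w_cocycle: "w \<in> as_cocycles RP_infinity 1"
    unfolding cocycles_iff RP_infinity_def
  proof (rule infinite_sphere.nearly_descend)
    have "nearly infinite_sphere 2 (\<lambda>xs. w (map orbit xs) = as_delta (\<lambda>ys. g (hd ys)) xs)"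
      by (rule nearly_mono [OF w]) (simp add: F_def)
    from nearly_delta [OF this]
    show "nearly infinite_sphere (1 + 2) (\<lambda>xs. as_delta w (map orbit xs) = 0)"
      by (simp add: as_delta_map as_delta_delta numeral_3_eq_3 numeral_2_eq_2)
  qed
  have "RP_omega = as_class RP_infinity 1 w"
    unfolding RP_omega_def
  proof (rule the_equality)
    have "\<not> cohomologous RP_infinity 1 w (\<lambda>xs. 0)"
      using cohomologous_zero_iff_even [OF wg] g_odd [of pole] pole_in_nsphere
      by (auto simp: topspace_infinite_sphere)
    then show "as_class RP_infinity 1 w \<in> as_cohomology RP_infinity 1 \<and> as_class RP_infinity 1 w \<noteq> as_zero RP_infinity 1"
      using w_cocycle by (simp add: as_cohomology_eq as_zero_eq as_class_eq_iff)
    fix a assume a: "a \<in> as_cohomology RP_infinity 1 \<and> a \<noteq> as_zero RP_infinity 1"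
    then obtain \<phi> where \<phi>: "\<phi> \<in> as_cocycles RP_infinity 1" "a = as_class RP_infinity 1 \<phi>"
      unfolding as_cohomology_eq by blast
    have n0: "\<not> cohomologous RP_infinity 1 \<phi> (\<lambda>xs. 0)"
      using a \<phi>(2) as_class_eq_iff [OF \<phi>(1) cocycle_zero] by (simp add: as_zero_eq)
    obtain f where f: "sphere_primitive \<phi> f" using exists_sphere_primitive [OF \<phi>(1)] .
    have f1: "f (- pole) + f pole = 1"
      using n0 cohomologous_zero_iff_even [OF f] bit_add_eq_0_iff [of "f (- pole)" "f pole"] by simp
    have g1: "g (- pole) + g pole = 1"
      using g_odd [of pole] pole_in_nsphere by (auto simp: topspace_infinite_sphere ac_simps)
    have "sphere_primitive (\<lambda>xs. \<phi> xs + w xs) (\<lambda>x. f x + g x)"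
      unfolding sphere_primitive_def
      by (rule nearly_mono [OF nearly_conj [OF f [unfolded sphere_primitive_def] wg [unfolded sphere_primitive_def]]])
        (simp add: ac_simps)
    from cohomologous_zero_iff_even [OF this]
    have "cohomologous RP_infinity 1 (\<lambda>xs. \<phi> xs + w xs) (\<lambda>xs. 0)"
      using f1 g1 by (cases "f pole"; cases "f (- pole)"; cases "g pole"; cases "g (- pole)") auto
    from cohomologous_add [OF this cohomologous_refl [of _ _ w]]
    have "cohomologous RP_infinity 1 \<phi> w" by (simp add: add.assoc)
    then show "a = as_class RP_infinity 1 w"
      using \<phi> w_cocycle by (simp add: as_class_eq_iff)
  qed
  then show ?thesis by (rule that [OF w_cocycle _ wg g_odd])
qed

section \<open>Bump functions for arbitrary open covers\<close>

text \<open>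
  A countable family of bump functions subordinate to \<open>C\<close>, each of them a sum of bumps with separated
  supports: \<open>sel n x\<close> is the index of the bump of \<open>w n\<close> that is active at \<open>x\<close>, and it does not change
  within the supports of radius \<open>w n\<close>. Such a family replaces a locally finite partition of unity and is
  much easier to obtain on a space that is not separable.
\<close>

definition bump_system ::
  "('i \<Rightarrow> 'a::metric_space set) \<Rightarrow> (nat \<Rightarrow> 'a \<Rightarrow> real) \<Rightarrow> (nat \<Rightarrow> 'a \<Rightarrow> 'i) \<Rightarrow> bool" where
  "bump_system C w sel \<longleftrightarrow>
     (\<forall>n x. 0 \<le> w n x \<and> w n x \<le> 1) \<and> (\<forall>n x y. \<bar>w n x - w n y\<bar> \<le> dist x y) \<and>
     (\<forall>n x. 0 < w n x \<longrightarrow> x \<in> C (sel n x)) \<and>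
     (\<forall>n x y. 0 < w n x \<longrightarrow> 0 < w n y \<longrightarrow> dist x y < w n x + w n y \<longrightarrow> sel n x = sel n y) \<and>
     (\<forall>i. \<forall>x\<in>C i. \<exists>n. 0 < w n x)"

text \<open>
  The method is that of Stone's theorem on the paracompactness of metric spaces. Well-order the indices
  and let \<open>H n i\<close> consist of the points that are deep inside \<open>C i\<close>, at depth \<open>2\<^sup>-\<^sup>n\<close>, and in no earlier set
  of the cover. For fixed \<open>n\<close> these sets have mutual distance at least \<open>2\<^sup>-\<^sup>n\<close>, so bumps of radius
  \<open>2\<^sup>-\<^sup>n / 3\<close> around them do not interfere.
\<close>

lemma bump_system_exists:
  fixes C :: "'i \<Rightarrow> 'a::real_normed_vector set"
  assumes op: "\<And>i. open (C i)"
  obtains w :: "nat \<Rightarrow> 'a \<Rightarrow> real" and sel :: "nat \<Rightarrow> 'a \<Rightarrow> 'i"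
  where "bump_system C w sel"
    "(\<forall>i. uminus ` C i = C i) \<longrightarrow> (\<forall>n x. w n (- x) = w n x \<and> sel n (- x) = sel n x)"
proof -
  obtain r :: "'i rel" where r: "well_order_on UNIV r"
    using well_order_on by blast
  define lt where "lt i j \<longleftrightarrow> (i, j) \<in> r - Id" for i j
  have wf: "wfp lt"
  proof -
    have "{(i, j). lt i j} = r - Id" by (auto simp: lt_def)
    then show ?thesis using r by (simp add: wfp_def well_order_on_def)
  qed
  have total: "lt i j \<or> lt j i" if "i \<noteq> j" for i j
    using r that by (auto simp: lt_def well_order_on_def linear_order_on_def total_on_def)
  define e where "e n = (1 / 2 :: real) ^ n" for n
  have e_pos: "0 < e n" and e_le: "e n \<le> 1" for n
    by (auto simp: e_def power_le_one)
  define H where "H n i = {x. ball x (e n) \<subseteq> C i \<and> (\<forall>j. lt j i \<longrightarrow> x \<notin> C j)}" for n i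
  have sep: "e n \<le> dist x y" if x: "x \<in> H n i" and y: "y \<in> H n j" and "i \<noteq> j" for n x y i j
  proof -
    from total [OF \<open>i \<noteq> j\<close>] show ?thesis
    proof
      assume "lt i j"
      then have "y \<notin> ball x (e n)" using x y by (auto simp: H_def)
      then show ?thesis by simp
    next
      assume "lt j i"
      then have "x \<notin> ball y (e n)" using x y by (auto simp: H_def)
      then show ?thesis by (simp add: dist_commute)
    qed
  qed
  define HH where "HH n = (\<Union>i. H n i)" for n
  define w where "w n x = (if HH n = {} then 0 else max 0 (e n / 3 - infdist x (HH n)))" for n x
  (* The radius e n / 2 leaves room for approximating the distance to H n i, which need not be attained,
   and still determines i. *)
  define sel where "sel n x = (SOME i. \<exists>h\<in>H n i. dist x h < e n / 2)" for n x
  have w_eq: "HH n \<noteq> {}" "w n x = e n / 3 - infdist x (HH n)" if "0 < w n x" for n x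
    using that by (auto simp: w_def split: if_splits)
  have near: "\<exists>i h. h \<in> H n i \<and> dist x h < infdist x (HH n) + e n / 6" if wx: "0 < w n x" for n x
  proof -
    have "Inf {dist x a | a. a \<in> HH n} < infdist x (HH n) + e n / 6"
      using w_eq(1) [OF wx] e_pos [of n] by (simp add: infdist_def setcompr_eq_image)
    then obtain a where "a \<in> HH n" "dist x a < infdist x (HH n) + e n / 6"
      using cInf_lessD [of "{dist x a | a. a \<in> HH n}"] w_eq(1) [OF wx] by blast
    then show ?thesis unfolding HH_def by blast
  qed
  have sel_eq: "sel n x = i" if h: "h \<in> H n i" "dist x h < e n / 2" for n x i h
  proof -
    have "\<exists>h\<in>H n (sel n x). dist x h < e n / 2"
      unfolding sel_def by (rule someI_ex) (use h in blast)
    then obtain h' where h': "h' \<in> H n (sel n x)" "dist x h' < e n / 2" by blast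
    have "dist h' h < e n"
      using h(2) h'(2) dist_triangle2 [of h' h x] by (simp add: dist_commute)
    then show ?thesis using sep [OF h'(1) h(1)] by force
  qed
  have w_le: "infdist x (HH n) < e n / 3" if "0 < w n x" for n x
    using w_eq(2) [OF that] that by simp
  have bumps: "bump_system C w sel"
    unfolding bump_system_def
  proof (intro conjI)
    have "0 \<le> w n x \<and> w n x \<le> 1" for n x
      using e_le [of n] e_pos [of n] infdist_nonneg [of x "HH n"] by (auto simp: w_def max_def)
    then show "\<forall>n x. 0 \<le> w n x \<and> w n x \<le> 1" by blast
    have "\<bar>w n x - w n y\<bar> \<le> dist x y" for n x y
      using infdist_triangle_abs [of x "HH n" y] unfolding w_def by auto
    then show "\<forall>n x y. \<bar>w n x - w n y\<bar> \<le> dist x y" by blast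
    have "x \<in> C (sel n x)" if w: "0 < w n x" for n x
    proof -
      obtain i h where h: "h \<in> H n i" "dist x h < infdist x (HH n) + e n / 6" using near [OF w] by blast
      have d: "dist x h < e n / 2" using h(2) w_le [OF w] by simp
      have "x \<in> ball h (e n)" using d e_pos [of n] by (simp add: dist_commute)
      then show ?thesis using sel_eq [OF h(1) d] h(1) by (auto simp: H_def)
    qed
    then show "\<forall>n x. 0 < w n x \<longrightarrow> x \<in> C (sel n x)" by blast
    have "sel n x = sel n y" if w: "0 < w n x" "0 < w n y" and d: "dist x y < w n x + w n y" for n x y
    proof -
      obtain i h where h: "h \<in> H n i" "dist x h < infdist x (HH n) + e n / 6" using near [OF w(1)] by blast
      obtain j k where k: "k \<in> H n j" "dist y k < infdist y (HH n) + e n / 6" using near [OF w(2)] by blast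
      have "dist h k \<le> dist x h + dist x y + dist y k"
        using dist_triangle [of h k x] dist_triangle [of x k y] by (simp add: dist_commute)
      also have "\<dots> < e n"
        using h(2) k(2) d w_eq(2) [OF w(1)] w_eq(2) [OF w(2)] by simp
      finally have "i = j" using sep [OF h(1) k(1)] by force
      moreover have "sel n x = i" using sel_eq [OF h(1)] h(2) w_le [OF w(1)] by simp
      moreover have "sel n y = j" using sel_eq [OF k(1)] k(2) w_le [OF w(2)] by simp
      ultimately show ?thesis by simp
    qed
    then show "\<forall>n x y. 0 < w n x \<longrightarrow> 0 < w n y \<longrightarrow> dist x y < w n x + w n y \<longrightarrow> sel n x = sel n y" by blast
    have "\<exists>n. 0 < w n x" if "x \<in> C i" for x i
    proof -
      have "\<exists>i. x \<in> C i \<and> (\<forall>j. lt j i \<longrightarrow> x \<notin> C j)"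
        using wf [unfolded wfp_eq_minimal, rule_format, of i "{i. x \<in> C i}"] that by auto
      then obtain i where i: "x \<in> C i" "\<And>j. lt j i \<Longrightarrow> x \<notin> C j" by blast
      obtain d where d: "d > 0" "ball x d \<subseteq> C i"
        using op [of i] i(1) by (meson openE)
      obtain n where "e n < d"
        using real_arch_pow_inv [OF d(1), of "1 / 2"] by (auto simp: e_def)
      then have "x \<in> H n i"
        using d(2) i unfolding H_def by (auto dest!: subset_ball [of "e n" d x, OF less_imp_le])
      then have "x \<in> HH n" by (auto simp: HH_def)
      then have "0 < w n x" using e_pos [of n] by (auto simp: w_def)
      then show ?thesis ..
    qed
    then show "\<forall>i. \<forall>x\<in>C i. \<exists>n. 0 < w n x" by blast
  qed
  show ?thesis
  proof (rule that [OF bumps])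
    show "(\<forall>i. uminus ` C i = C i) \<longrightarrow> (\<forall>n x. w n (- x) = w n x \<and> sel n (- x) = sel n x)"
    proof (intro impI allI)
      fix n and x :: 'a assume sym: "\<forall>i. uminus ` C i = C i"
      have symC: "- y \<in> C i \<longleftrightarrow> y \<in> C i" for y i
        using sym by (metis imageE imageI minus_minus)
      have "- y \<in> H n i" if y: "y \<in> H n i" for y i
      proof -
        have "ball (- y) (e n) \<subseteq> C i"
        proof
          fix z assume "z \<in> ball (- y) (e n)"
          then have "- z \<in> ball y (e n)"
            by (simp add: dist_norm norm_minus_commute add.commute)
          then show "z \<in> C i" using y symC by (auto simp: H_def)
        qed
        then show ?thesis using y symC by (auto simp: H_def)
      qed
      then have symH: "- y \<in> H n i \<longleftrightarrow> y \<in> H n i" for y i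
        by (metis minus_minus)
      have dist_neg: "dist (- x) (- h) = dist x h" for h
        by (simp only: dist_norm minus_diff_minus norm_minus_cancel)
      have "(\<lambda>h. dist (- x) h) ` HH n = (\<lambda>h. dist x h) ` HH n"
      proof
        show "(\<lambda>h. dist (- x) h) ` HH n \<subseteq> (\<lambda>h. dist x h) ` HH n"
          using symH dist_neg unfolding HH_def by (smt (verit) UN_iff image_iff minus_minus subsetI)
        show "(\<lambda>h. dist x h) ` HH n \<subseteq> (\<lambda>h. dist (- x) h) ` HH n"
          using symH dist_neg unfolding HH_def by (smt (verit) UN_iff image_iff minus_minus subsetI)
      qed
      then have "infdist (- x) (HH n) = infdist x (HH n)" by (simp add: infdist_def)
      moreover have "(\<exists>h\<in>H n i. dist (- x) h < e n / 2) = (\<exists>h\<in>H n i. dist x h < e n / 2)" for i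
        using symH dist_neg by (metis minus_minus)
      ultimately show "w n (- x) = w n x \<and> sel n (- x) = sel n x" by (simp add: w_def sel_def)
    qed
  qed
qed

section \<open>Existence of classifying maps\<close>

lemma continuous_map_local:
  assumes "\<And>x. x \<in> topspace X \<Longrightarrow> \<exists>N. openin X N \<and> x \<in> N \<and> continuous_map (subtopology X N) Y f"
  shows "continuous_map X Y f"
  unfolding continuous_map_def
proof (intro conjI allI impI)
  show "f \<in> topspace X \<rightarrow> topspace Y"
  proof
    fix x assume x: "x \<in> topspace X"
    then obtain N where "x \<in> N" "continuous_map (subtopology X N) Y f" using assms by blast
    then show "f x \<in> topspace Y"
      using continuous_map_image_subset_topspace [of "subtopology X N" Y f] x by auto
  qed
  fix U assume U: "openin Y U"
  show "openin X {x \<in> topspace X. f x \<in> U}"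
  proof (subst openin_subopen, intro ballI)
    fix x assume x: "x \<in> {x \<in> topspace X. f x \<in> U}"
    then obtain N where N: "openin X N" "x \<in> N" "continuous_map (subtopology X N) Y f" using assms by blast
    have "openin (subtopology X N) {x \<in> topspace (subtopology X N). f x \<in> U}"
      using openin_continuous_map_preimage [OF N(3) U] .
    then have "openin X {x \<in> topspace (subtopology X N). f x \<in> U}"
      using N(1) openin_trans_full by blast
    then show "\<exists>T. openin X T \<and> x \<in> T \<and> T \<subseteq> {x \<in> topspace X. f x \<in> U}"
      using x N(2) by (intro exI [of _ "{x \<in> topspace (subtopology X N). f x \<in> U}"]) auto
  qed
qed

lemma near_points_not_antipodal:
  fixes a x y :: "'a::real_normed_vector"
  assumes "norm (x - a) < norm a / 2" "norm (y - a) < norm a / 2"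
  shows "norm (x - y) < norm (x + y)"
proof -
  have "norm (x - y) \<le> norm (x - a) + norm (y - a)"
    using norm_triangle_ineq4 [of "x - a" "y - a"] by simp
  moreover have "2 * norm a \<le> norm (x + y) + norm (x - a) + norm (y - a)"
  proof -
    have "2 * norm a = norm ((x + y) - (x - a) - (y - a))"
      using norm_scaleR [of 2 a] by (simp add: scaleR_2)
    then show ?thesis
      using norm_triangle_ineq4 [of "(x + y) - (x - a)" "y - a"] norm_triangle_ineq4 [of "x + y" "x - a"] by linarith
  qed
  ultimately show ?thesis using assms by linarith
qed

text \<open>
  The sign of a bump tells which of \<open>sel x\<close> and \<open>- sel x\<close> is closer to \<open>x\<close>. It jumps only where the bump vanishes.
\<close>

lemma continuous_odd_bump:
  fixes w :: "'a::real_normed_vector \<Rightarrow> real" and sel :: "'a \<Rightarrow> 'a"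
  assumes w: "\<And>x. 0 \<le> w x" "\<And>x y. \<bar>w x - w y\<bar> \<le> dist x y"
    and sel: "\<And>x. 0 < w x \<Longrightarrow> norm (x - sel x) \<noteq> norm (x + sel x)"
    and loc: "\<And>x y. \<lbrakk>0 < w x; 0 < w y; dist x y < w x + w y\<rbrakk> \<Longrightarrow> sel x = sel y"
  shows "continuous_on UNIV (\<lambda>x. if norm (x - sel x) < norm (x + sel x) then w x else - w x)"
    (is "continuous_on UNIV ?f")
proof (rule continuous_at_imp_continuous_on, rule ballI)
  fix x
  have wc: "continuous_on UNIV w"
    by (rule lipschitz_on_continuous_on [of 1]) (use w(2) in \<open>auto intro!: lipschitz_onI simp: dist_real_def\<close>)
  show "isCont ?f x"
  proof (cases "0 < w x")
    case False
    then have wx: "w x = 0" using w(1) [of x] by simp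
    have abs: "norm (?f y) \<le> w y" for y using w(1) [of y] by simp
    have "(w \<longlongrightarrow> 0) (at x)"
      using wc wx unfolding continuous_on_eq_continuous_at [OF open_UNIV] isCont_def by (metis UNIV_I)
    then have "(?f \<longlongrightarrow> 0) (at x)"
      by (rule Lim_null_comparison [rotated]) (use abs in auto)
    then show ?thesis using wx by (simp add: isCont_def)
  next
    case True
    let ?a = "sel x"
    define P where "P \<longleftrightarrow> norm (x - ?a) < norm (x + ?a)"
    let ?S = "{y. norm (y - ?a) < norm (y + ?a)}" and ?S' = "{y. norm (y + ?a) < norm (y - ?a)}"
    have "open ?S" "open ?S'" by (intro open_Collect_less continuous_intros)+
    moreover have "x \<in> (if P then ?S else ?S')"
      using sel [OF True] by (auto simp: P_def)
    ultimately have "\<forall>\<^sub>F y in nhds x. y \<in> (if P then ?S else ?S')"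
      by (intro eventually_nhds_in_open) auto
    moreover have "\<forall>\<^sub>F y in nhds x. y \<in> ball x (w x)"
      using True by (intro eventually_nhds_in_open) auto
    moreover have "\<forall>\<^sub>F y in nhds x. y \<in> {y. 0 < w y}"
      using True by (intro eventually_nhds_in_open open_Collect_less continuous_intros wc) auto
    ultimately have "\<forall>\<^sub>F y in nhds x. ?f y = (if P then w y else - w y)"
    proof eventually_elim
      case (elim y)
      have "sel x = sel y" by (rule loc [OF True]) (use elim in auto)
      then show ?case using elim(1) by (auto split: if_splits)
    qed
    then have "isCont ?f x \<longleftrightarrow> isCont (\<lambda>y. if P then w y else - w y) x"
      by (rule isCont_cong)
    moreover have "isCont (\<lambda>y. if P then w y else - w y) x"
      using wc by (cases P) (simp_all add: continuous_on_eq_continuous_at)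
    ultimately show ?thesis by simp
  qed
qed

text \<open>
  The cover by pairs of opposite balls gives countably many odd functions without a common zero. Damping
  each of them by the earlier ones makes the family locally finite, so that it maps locally into a
  finite-dimensional sphere, as the direct limit topology requires.
\<close>

proposition exists_odd_map_to_sphere:
  fixes A :: "'a::real_normed_vector set"
  assumes "0 \<notin> A"
  obtains F where "continuous_map (top_of_set A) infinite_sphere F" "\<And>u. u \<in> A \<Longrightarrow> F (- u) = - F u"
proof -
  define C where "C a = ball a (norm a / 2) \<union> ball (- a) (norm a / 2)" for a :: 'a
  have C_open: "open (C a)" for a by (auto simp: C_def)
  have C_sym: "uminus ` C a = C a" for a
  proof -
    have "- x \<in> C a" if "x \<in> C a" for x
      using that unfolding C_def by (auto simp: dist_norm norm_minus_commute add.commute)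
    then show ?thesis by (metis (no_types, lifting) equalityI image_iff image_subsetI minus_minus subsetI)
  qed
  obtain w sel where bumps: "bump_system C w sel"
    and sym: "(\<forall>i. uminus ` C i = C i) \<longrightarrow> (\<forall>n x. w n (- x) = w n x \<and> sel n (- x) = sel n x)"
    using bump_system_exists [of C, OF C_open] by metis
  have w0: "0 \<le> w n x" and w1: "w n x \<le> 1" and wl: "\<bar>w n x - w n y\<bar> \<le> dist x y"
    and wC: "0 < w n x \<Longrightarrow> x \<in> C (sel n x)"
    and ws: "\<lbrakk>0 < w n x; 0 < w n y; dist x y < w n x + w n y\<rbrakk> \<Longrightarrow> sel n x = sel n y"
    and wp: "x \<in> C a \<Longrightarrow> \<exists>n. 0 < w n x" for n x y a
    using bumps unfolding bump_system_def by blast+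
  have w_neg: "w n (- x) = w n x" and sel_neg: "sel n (- x) = sel n x" for n x
    using sym C_sym by auto
  have wc: "continuous_on UNIV (w n)" for n
    by (rule lipschitz_on_continuous_on [of 1]) (use wl in \<open>auto intro!: lipschitz_onI simp: dist_real_def\<close>)
  have sides: "norm (x - sel n x) \<noteq> norm (x + sel n x)" if "0 < w n x" for n x
  proof -
    let ?a = "sel n x"
    from wC [OF that] consider "x \<in> ball ?a (norm ?a / 2)" | "x \<in> ball (- ?a) (norm ?a / 2)"
      by (auto simp: C_def)
    then show ?thesis
    proof cases
      case 1
      then have "norm (x - ?a) < norm ?a / 2" by (simp add: dist_norm norm_minus_commute)
      moreover from this have "norm (?a - ?a) < norm ?a / 2" using norm_ge_zero [of "x - ?a"]
        by (simp only: diff_self norm_zero)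
      ultimately show ?thesis using near_points_not_antipodal [of x ?a ?a] by simp
    next
      case 2
      then have "norm (x - (- ?a)) < norm (- ?a) / 2" by (simp add: dist_norm norm_minus_commute add.commute)
      moreover from this have "norm (- ?a - (- ?a)) < norm (- ?a) / 2" using norm_ge_zero [of "x - (- ?a)"]
        by (simp only: diff_self norm_zero)
      ultimately show ?thesis using near_points_not_antipodal [of x "- ?a" "- ?a"] by simp
    qed
  qed
  define \<phi> where "\<phi> n x = (if norm (x - sel n x) < norm (x + sel n x) then w n x else - w n x)" for n x
  have \<phi>_cont: "continuous_on UNIV (\<phi> n)" for n
    unfolding \<phi>_def by (rule continuous_odd_bump [OF w0 wl sides ws])
  have \<phi>_odd: "\<phi> n (- x) = - \<phi> n x" for n x
  proof (cases "0 < w n x")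
    case True
    have "norm (- x - sel n x) = norm (x + sel n x)" "norm (- x + sel n x) = norm (x - sel n x)"
      by (metis minus_add_distrib norm_minus_cancel uminus_add_conv_diff diff_conv_add_uminus,
          metis norm_minus_commute uminus_add_conv_diff)
    then show ?thesis using sides [OF True] by (simp add: \<phi>_def sel_neg w_neg)
  next
    case False
    then show ?thesis using w0 [of n x] by (simp add: \<phi>_def w_neg)
  qed
  (* The first index with w n x > 0 survives, since the sum is then zero; near x all large n are
   suppressed by the factor n, as w is bounded by 1. *)
  define \<psi> where "\<psi> x n = \<phi> n x * max 0 (w n x - real n * (\<Sum>i<n. w i x))" for x n
  have \<psi>_cont: "continuous_on UNIV (\<lambda>x. \<psi> x n)" for n
    unfolding \<psi>_def by (intro continuous_intros \<phi>_cont wc)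
  have \<psi>_odd: "\<psi> (- x) = - \<psi> x" for x
    by (auto simp: \<psi>_def \<phi>_odd w_neg)
  have \<psi>_nonzero: "\<exists>n. \<psi> x n \<noteq> 0" if "x \<in> A" for x
  proof -
    have "x \<in> C x" using that assms by (auto simp: C_def)
    then obtain n where "0 < w n x" using wp by blast
    then obtain n where n: "0 < w n x" and min: "\<And>i. i < n \<Longrightarrow> \<not> 0 < w i x"
      using exists_least_iff [of "\<lambda>n. 0 < w n x"] by blast
    have "w i x = 0" if "i < n" for i using min [OF that] w0 [of i x] by simp
    then have "(\<Sum>i<n. w i x) = 0" by simp
    then show ?thesis using n by (intro exI [of _ n]) (auto simp: \<psi>_def \<phi>_def)
  qed
  have \<psi>_finite: "\<exists>N m. openin (top_of_set A) N \<and> x \<in> N \<and> (\<forall>y\<in>N. \<forall>n>m. \<psi> y n = 0)" if "x \<in> A" for x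
  proof -
    have "x \<in> C x" using that assms by (auto simp: C_def)
    then obtain k where k: "0 < w k x" using wp by blast
    let ?N = "A \<inter> {y. w k x / 2 < w k y}"
    have "open {y. w k x / 2 < w k y}" by (intro open_Collect_less continuous_intros wc)
    then have "openin (top_of_set A) ?N" by blast
    moreover obtain m0 :: nat where m0: "2 / w k x \<le> real m0" using real_arch_simple by blast
    have "\<psi> y n = 0" if y: "y \<in> ?N" and n: "n > max k m0" for y n
    proof -
      have "w k y \<le> (\<Sum>i<n. w i y)"
        using n by (intro member_le_sum) (auto simp: w0)
      moreover have "w k x / 2 < w k y" using y by simp
      ultimately have "w k x / 2 \<le> (\<Sum>i<n. w i y)" by simp
      moreover have "2 / w k x \<le> real n" using m0 n by simp
      ultimately have "(2 / w k x) * (w k x / 2) \<le> real n * (\<Sum>i<n. w i y)"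
        using k by (intro mult_mono) auto
      then have "1 \<le> real n * (\<Sum>i<n. w i y)" using k by simp
      then show ?thesis using w1 [of n y] by (simp add: \<psi>_def)
    qed
    ultimately show ?thesis
      using that k by (intro exI [of _ ?N] exI [of _ "max k m0"]) auto
  qed
  have "continuous_map (top_of_set A) infinite_sphere (\<lambda>x. unit (\<psi> x))"
  proof (rule continuous_map_local)
    fix x assume "x \<in> topspace (top_of_set A)"
    then obtain N m where N: "openin (top_of_set A) N" "x \<in> N" "\<forall>y\<in>N. \<forall>n>m. \<psi> y n = 0"
      using \<psi>_finite [of x] by auto
    have NA: "N \<subseteq> A" using openin_subset [OF N(1)] by simp
    have "continuous_map (top_of_set N) (nsphere m) (\<lambda>x. unit (\<psi> x))"
      by (rule continuous_map_unit)
        (use N NA \<psi>_nonzero continuous_on_subset [OF \<psi>_cont] in auto)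
    from continuous_map_compose [OF this continuous_map_into_infinite_sphere]
    have "continuous_map (subtopology (top_of_set A) N) infinite_sphere (\<lambda>x. unit (\<psi> x))"
      using NA by (simp add: comp_def subtopology_subtopology Int_absorb1)
    then show "\<exists>N. openin (top_of_set A) N \<and> x \<in> N \<and> continuous_map (subtopology (top_of_set A) N) infinite_sphere (\<lambda>x. unit (\<psi> x))"
      using N by blast
  qed
  moreover have "unit (\<psi> (- u)) = - unit (\<psi> u)" for u
    by (simp add: \<psi>_odd unit_minus)
  ultimately show ?thesis by (rule that)
qed

section \<open>The index of a set that is contractible in a larger set\<close>

lemma antipodal_space_top_of_set:
  fixes A :: "'a::real_normed_vector set"
  assumes "symmetric_set A"
  shows "antipodal_space (top_of_set A)"
proof
  have "- x \<in> A" if "x \<in> A" for x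
    using assms that unfolding symmetric_set_def by blast
  then show "continuous_map (top_of_set A) (top_of_set A) uminus"
    by (auto intro!: continuous_intros)
qed simp

lemma nearly_cup_power:
  assumes "nearly X 2 (\<lambda>xs. \<phi> xs = \<psi> xs)"
  shows "nearly X (Suc m) (\<lambda>xs. cup_power \<phi> m xs = cup_power \<psi> m xs)"
proof (rule nearlyI)
  fix x assume "x \<in> topspace X"
  from nearlyE [OF assms this] obtain U
    where U: "openin X U" "x \<in> U" "\<forall>xs. length xs = 2 \<longrightarrow> set xs \<subseteq> U \<longrightarrow> \<phi> xs = \<psi> xs" .
  have "cup_power \<phi> m xs = cup_power \<psi> m xs" if "length xs = Suc m" "set xs \<subseteq> U" for xs
    by (rule cup_power_cong) (use U(3) that in auto)
  then show "\<exists>U. openin X U \<and> x \<in> U \<and> (\<forall>xs. length xs = Suc m \<longrightarrow> set xs \<subseteq> U \<longrightarrow> cup_power \<phi> m xs = cup_power \<psi> m xs)"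
    using U by (intro exI [of _ U]) simp
qed

lemma as_delta_cup_power_exact:
  "length xs = m + 2 \<Longrightarrow> as_delta (cup_power (as_delta \<beta>) m) xs = 0"
proof (induction m arbitrary: xs)
  case 0
  then show ?case by (simp add: as_delta_def)
next
  case (Suc m)
  have "as_delta (cup_power (as_delta \<beta>) m) (take (Suc (Suc m)) xs) = 0"
    using Suc by simp
  then show ?case
    using Suc.prems by (simp add: as_delta_cup) (simp add: cup_def as_delta_delta)
qed

text \<open>
  Powers are formed by multiplication on the right; the transfer needs a factor on the left.
\<close>

lemma cup_power_Suc_left:
  "length xs = m + 2 \<Longrightarrow> cup 1 \<phi> (cup_power \<phi> m) xs = cup_power \<phi> (Suc m) xs"
proof (induction m arbitrary: xs)
  case 0
  then show ?case by (simp add: cup_def)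
next
  case (Suc m)
  have "cup_power \<phi> (Suc (Suc m)) xs = cup_power \<phi> (Suc m) (take (m + 2) xs) * \<phi> (drop (Suc m) xs)"
    unfolding cup_power.simps(2) [of \<phi> "Suc m"] cup_def [of "Suc m"] by simp
  also have "cup_power \<phi> (Suc m) (take (m + 2) xs) = cup 1 \<phi> (cup_power \<phi> m) (take (m + 2) xs)"
    using Suc.prems by (intro Suc.IH [symmetric]) simp
  also have "\<dots> = \<phi> (take 2 xs) * cup_power \<phi> m (take (Suc m) (drop 1 xs))"
    by (simp add: cup_def drop_take numeral_2_eq_2)
  finally have left: "cup_power \<phi> (Suc (Suc m)) xs =
      \<phi> (take 2 xs) * cup_power \<phi> m (take (Suc m) (drop 1 xs)) * \<phi> (drop (Suc m) xs)" .
  have right: "cup 1 \<phi> (cup_power \<phi> (Suc m)) xs =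
      \<phi> (take 2 xs) * (cup_power \<phi> m (take (Suc m) (drop 1 xs)) * \<phi> (drop (Suc m) xs))"
    by (simp add: cup_def numeral_2_eq_2)
  show ?case unfolding left right by (simp only: mult.assoc)
qed

lemma cohomologousI_positive:
  assumes "0 < q" and near: "nearly X (Suc q) (\<lambda>xs. \<phi> xs + \<psi> xs = as_delta \<eta> xs)"
  shows "cohomologous X q \<phi> \<psi>"
proof (rule cohomologousI [of "\<lambda>xs. if xs = [] then 0 else \<eta> xs"])
  show "nearly X (Suc q) (\<lambda>xs. \<phi> xs + \<psi> xs = as_delta (\<lambda>xs. if xs = [] then 0 else \<eta> xs) xs)"
  proof (rule nearly_mono [OF near])
    fix xs :: "'a list"
    assume len: "length xs = Suc q" and eq: "\<phi> xs + \<psi> xs = as_delta \<eta> xs"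
    have "as_delta (\<lambda>xs. if xs = [] then 0 else \<eta> xs) xs = as_delta \<eta> xs"
      using len \<open>0 < q\<close> by (intro as_delta_cong) auto
    with eq show "\<phi> xs + \<psi> xs = as_delta (\<lambda>xs. if xs = [] then 0 else \<eta> xs) xs" by simp
  qed
qed simp

text \<open>
  The class of \<open>v\<close> is the characteristic class of the double cover of the orbit space by \<open>X\<close>: on the cover
  it has a primitive that distinguishes the two points of each orbit.
\<close>

definition odd_primitive :: "'a::uminus topology \<Rightarrow> ('a set list \<Rightarrow> bit) \<Rightarrow> ('a \<Rightarrow> bit) \<Rightarrow> bool" where
  "odd_primitive X v G \<longleftrightarrow>
     nearly X 2 (\<lambda>xs. v (map orbit xs) = G (hd xs) + G (last xs)) \<and> (\<forall>u\<in>topspace X. G (- u) = G u + 1)"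

text \<open>
  The sum of two odd functions is even. Consequently the characteristic class does not depend on the
  classifying map from which it is obtained.
\<close>

lemma (in antipodal_space) odd_primitives_cohomologous:
  assumes "odd_primitive X v G" "odd_primitive X v' G'"
  shows "cohomologous (antipodal_quotient X) 1 v v'"
proof -
  have 1: "nearly X 2 (\<lambda>xs. v (map orbit xs) = G (hd xs) + G (last xs))"
    and 2: "nearly X 2 (\<lambda>xs. v' (map orbit xs) = G' (hd xs) + G' (last xs))"
    using assms by (auto simp: odd_primitive_def)
  have "cohomologous (antipodal_quotient X) 1 (\<lambda>xs. v xs + v' xs) (\<lambda>xs. 0)"
  proof (rule even_primitive_cohomologous_zero)
    show "nearly X 2 (\<lambda>xs. v (map orbit xs) + v' (map orbit xs) = (G (hd xs) + G' (hd xs)) + (G (last xs) + G' (last xs)))"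
      by (rule nearly_mono [OF nearly_conj [OF 1 2]]) (simp add: ac_simps)
    show "G (- x) + G' (- x) = G x + G' x" if "x \<in> topspace X" for x
    proof -
      have "G (- x) = G x + 1" "G' (- x) = G' x + 1" using assms that by (auto simp: odd_primitive_def)
      then show ?thesis by (simp add: ac_simps)
    qed
  qed
  from cohomologous_add [OF this cohomologous_refl [of _ _ v']]
  show ?thesis by (simp add: add.assoc)
qed

lemma nearly_close_points:
  fixes A :: "'a::real_normed_vector set"
  assumes "0 \<notin> A"
  shows "nearly (top_of_set A) 2 (\<lambda>xs. norm (hd xs - last xs) < norm (hd xs + last xs))"
proof (rule nearlyI)
  fix a assume "a \<in> topspace (top_of_set A)"
  then have a: "a \<in> A" by simp
  then have "a \<noteq> 0" using assms by blast
  have "norm (hd xs - last xs) < norm (hd xs + last xs)"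
    if "length xs = 2" "set xs \<subseteq> A \<inter> ball a (norm a / 2)" for xs
  proof -
    obtain x y where "xs = [x, y]" using \<open>length xs = 2\<close> by (rule list2E)
    then show ?thesis
      using that(2) near_points_not_antipodal [of x a y] by (simp add: dist_norm norm_minus_commute)
  qed
  then show "\<exists>U. openin (top_of_set A) U \<and> a \<in> U \<and>
      (\<forall>xs. length xs = 2 \<longrightarrow> set xs \<subseteq> U \<longrightarrow> norm (hd xs - last xs) < norm (hd xs + last xs))"
    using a \<open>a \<noteq> 0\<close> by (intro exI [of _ "A \<inter> ball a (norm a / 2)"]) (auto intro: openin_open_Int)
qed

lemma continuous_map_quotient_inclusion:
  fixes A Y :: "'a::real_normed_vector set"
  assumes "symmetric_set A" "symmetric_set Y" "A \<subseteq> Y"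
  shows "continuous_map (antipodal_quotient (top_of_set A)) (antipodal_quotient (top_of_set Y)) (\<lambda>y. y)"
proof -
  interpret A: antipodal_space "top_of_set A" using assms(1) by (rule antipodal_space_top_of_set)
  interpret Y: antipodal_space "top_of_set Y" using assms(2) by (rule antipodal_space_top_of_set)
  show ?thesis
    unfolding continuous_map_def
  proof (intro conjI allI impI)
    show "(\<lambda>y. y) \<in> topspace (antipodal_quotient (top_of_set A)) \<rightarrow> topspace (antipodal_quotient (top_of_set Y))"
      using assms(3) by (auto simp: A.topspace_quotient Y.topspace_quotient)
    fix V assume "openin (antipodal_quotient (top_of_set Y)) V"
    then have V: "openin (top_of_set Y) {x \<in> Y. orbit x \<in> V}" by (simp add: Y.openin_quotient)
    from V obtain T where T: "open T" "{x \<in> Y. orbit x \<in> V} = Y \<inter> T" unfolding openin_open by metis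
    have "A \<inter> {x \<in> Y. orbit x \<in> V} = A \<inter> T" unfolding T(2) using assms(3) by blast
    then have "openin (top_of_set A) (A \<inter> {x \<in> Y. orbit x \<in> V})"
      using T(1) by (simp add: openin_open_Int)
    also have "A \<inter> {x \<in> Y. orbit x \<in> V} =
        {x \<in> A. orbit x \<in> {y \<in> topspace (antipodal_quotient (top_of_set A)). y \<in> V}}"
      using assms(3) by (auto simp: A.topspace_quotient)
    finally show "openin (antipodal_quotient (top_of_set A)) {y \<in> topspace (antipodal_quotient (top_of_set A)). y \<in> V}"
      by (auto simp: A.openin_quotient A.topspace_quotient)
  qed
qed

text \<open>
  The transfer argument. With \<open>w = dG\<close> on the cover and \<open>w\<^sup>k\<^sup>+\<^sup>1 = d\<psi>\<close> on the orbit space of \<open>Y\<close>, the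
  cochain \<open>z = G w\<^sup>k + \<psi>\<close> is closed, and \<open>z\<close> plus its reflection equals \<open>w\<^sup>k\<close>. As \<open>A\<close> is contractible
  in \<open>Y\<close>, one has \<open>z = d\<eta>\<close> on \<open>A\<close>, so \<open>w\<^sup>k\<close> is the coboundary of the invariant cochain \<open>\<eta>\<close> plus its reflection. For
  \<open>k = 0\<close> the cocycle \<open>z\<close> would be constant on \<open>A\<close> although \<open>z u + z (- u) = 1\<close>.
\<close>

proposition nullhomotopic_cup_power_vanishes:
  fixes A Y :: "'a::real_normed_vector set" and h :: "'a \<times> real \<Rightarrow> 'a"
  assumes sym: "symmetric_set A" "symmetric_set Y" and AY: "A \<subseteq> Y" and nz: "0 \<notin> Y" and ne: "A \<noteq> {}"
    and h: "continuous_map (top_of_set (A \<times> {0..1})) (top_of_set Y) h"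
    and h0: "\<And>u. u \<in> A \<Longrightarrow> h (u, 0) = u" and h1: "\<And>u. u \<in> A \<Longrightarrow> h (u, 1) = p"
    and v: "odd_primitive (top_of_set Y) v G"
    and zero: "cohomologous (antipodal_quotient (top_of_set Y)) (Suc k) (cup_power v (Suc k)) (\<lambda>xs. 0)"
  shows "cohomologous (antipodal_quotient (top_of_set A)) k (cup_power v k) (\<lambda>xs. 0)"
proof -
  interpret A: antipodal_space "top_of_set A" using sym(1) by (rule antipodal_space_top_of_set)
  interpret Y: antipodal_space "top_of_set Y" using sym(2) by (rule antipodal_space_top_of_set)
  have G_odd: "G (- u) = G u + 1" if "u \<in> Y" for u using v that by (simp add: odd_primitive_def)
  have incl: "continuous_map (top_of_set A) (top_of_set Y) (\<lambda>x. x)" using AY by auto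
  define dG where "dG = as_delta (\<lambda>ys. G (hd ys))"
  have dG2: "dG xs = G (hd xs) + G (last xs)" if "length xs = 2" for xs
  proof -
    obtain a b where "xs = [a, b]" using \<open>length xs = 2\<close> by (rule list2E)
    then show ?thesis by (simp add: dG_def add.commute)
  qed
  have v_dG: "nearly (top_of_set Y) 2 (\<lambda>xs. v (map orbit xs) = dG xs)"
    by (rule nearly_mono [OF v [unfolded odd_primitive_def, THEN conjunct1]]) (simp add: dG2)
  have power_dG: "nearly (top_of_set Y) (Suc m) (\<lambda>xs. cup_power v m (map orbit xs) = cup_power dG m xs)" for m
    using nearly_cup_power [OF v_dG] by (simp add: cup_power_map)
  from cohomologousE [OF zero] obtain \<psi>
    where \<psi>: "nearly (antipodal_quotient (top_of_set Y)) (Suc (Suc k)) (\<lambda>ys. cup_power v (Suc k) ys + 0 = as_delta \<psi> ys)" .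
  define z where "z xs = cup 0 (\<lambda>ys. G (hd ys)) (cup_power dG k) xs + \<psi> (map orbit xs)" for xs
  have "nearly (top_of_set Y) (k + 2) (\<lambda>xs. as_delta z xs = 0)"
  proof -
    have "nearly (top_of_set Y) (Suc (Suc k)) (\<lambda>xs. as_delta z xs = 0)"
    proof (rule nearly_mono [OF nearly_conj [OF power_dG [of "Suc k"] nearly_pullback [OF \<psi> Y.continuous_map_orbit]]])
      fix xs :: "'a list"
      assume len: "length xs = Suc (Suc k)"
        and eq: "cup_power v (Suc k) (map orbit xs) = cup_power dG (Suc k) xs \<and>
          cup_power v (Suc k) (map orbit xs) + 0 = as_delta \<psi> (map orbit xs)"
      have "as_delta (cup_power dG k) xs = 0"
        unfolding dG_def using len by (intro as_delta_cup_power_exact) simp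
      then have "as_delta (cup 0 (\<lambda>ys. G (hd ys)) (cup_power dG k)) xs = cup 1 dG (cup_power dG k) xs"
        using len by (subst as_delta_cup) (simp_all add: dG_def, simp add: cup_def)
      also have "\<dots> = cup_power dG (Suc k) xs" using len by (intro cup_power_Suc_left) simp
      also have "\<dots> = as_delta \<psi> (map orbit xs)" using eq by (metis add_0_right)
      finally show "as_delta z xs = 0"
        by (simp add: z_def [abs_def] as_delta_add as_delta_map)
    qed
    then show ?thesis by simp
  qed
  then have z: "z \<in> as_cocycles (top_of_set Y) k" by (simp add: cocycles_iff)
  have dG_neg: "cup_power dG k (map uminus xs) = cup_power dG k xs" if xs: "set xs \<subseteq> Y" "length xs = Suc k" for xs
  proof -
    have "cup_power (\<lambda>ys. dG (map uminus ys)) k xs = cup_power dG k xs"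
    proof (rule cup_power_cong [OF _ xs(2)])
      fix ys assume ys: "length ys = 2" "set ys \<subseteq> set xs"
      from ys(1) obtain a b where ab: "ys = [a, b]" by (rule list2E)
      then have "a \<in> Y" "b \<in> Y" using ys(2) xs(1) by auto
      then show "dG (map uminus ys) = dG ys"
        using G_odd [of a] G_odd [of b] by (simp add: ab dG_def ac_simps)
    qed
    then show ?thesis by (simp add: cup_power_map)
  qed
  have z_neg: "z xs + z (map uminus xs) = cup_power dG k xs" if xs: "set xs \<subseteq> Y" "length xs = Suc k" for xs
  proof -
    obtain x ys where x: "xs = x # ys" using xs(2) by (cases xs) auto
    have "G (- x) = G x + 1" using G_odd xs(1) x by simp
    moreover have "z xs = G x * cup_power dG k xs + \<psi> (map orbit xs)"
      by (simp add: z_def cup_def x)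
    moreover have "z (map uminus xs) = G (- x) * cup_power dG k xs + \<psi> (map orbit xs)"
    proof -
      have "map orbit (map uminus xs) = map orbit xs" by simp
      moreover have "hd (take (Suc 0) (map uminus xs)) = - x" by (simp add: x)
      ultimately show ?thesis
        unfolding z_def cup_def drop_0 by (simp only: dG_neg [OF xs])
    qed
    ultimately show ?thesis by (simp add: ac_simps distrib_right)
  qed
  have hom: "cohomologous (top_of_set A) k z (\<lambda>xs. z (map (\<lambda>x. p) xs))"
  proof -
    have "cohomologous (top_of_set A) k z (\<lambda>xs. z (map (\<lambda>x. h (x, 0)) xs))"
    proof (rule cohomologous_eq)
      fix xs :: "'a list" assume "set xs \<subseteq> topspace (top_of_set A)"
      then have eq: "map (\<lambda>x. h (x, 0)) xs = xs" using h0 by (intro map_idI) auto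
      show "z xs = z (map (\<lambda>x. h (x, 0)) xs)" by (simp only: eq)
    qed
    also have "cohomologous (top_of_set A) k \<dots> (\<lambda>xs. z (map (\<lambda>x. h (x, 1)) xs))"
      by (rule homotopic_cohomologous [OF h z])
    also have "cohomologous (top_of_set A) k \<dots> (\<lambda>xs. z (map (\<lambda>x. p) xs))"
    proof (rule cohomologous_eq)
      fix xs :: "'a list" assume "set xs \<subseteq> topspace (top_of_set A)"
      then have eq: "map (\<lambda>x. h (x, 1)) xs = map (\<lambda>x. p) xs" using h1 by (intro map_cong) auto
      show "z (map (\<lambda>x. h (x, 1)) xs) = z (map (\<lambda>x. p) xs)" by (simp only: eq)
    qed
    finally show ?thesis .
  qed
  show ?thesis
  proof (cases "k = 0")
    case True
    obtain a where a: "a \<in> A" using ne by blast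
    have na: "- a \<in> A" using a A.neg_topspace [of a] by simp
    from cohomologousE [OF hom] obtain \<eta>
      where \<eta>: "\<eta> [] = 0" "nearly (top_of_set A) (Suc k) (\<lambda>xs. z xs + z (map (\<lambda>x. p) xs) = as_delta \<eta> xs)" .
    have "z [u] = z [p]" if u: "u \<in> A" for u
    proof -
      have "u \<in> topspace (top_of_set A)" using u by simp
      from nearlyE [OF \<eta>(2) this] obtain U where U: "u \<in> U"
        "\<forall>xs. length xs = Suc k \<longrightarrow> set xs \<subseteq> U \<longrightarrow> z xs + z (map (\<lambda>x. p) xs) = as_delta \<eta> xs" .
      have "z [u] + z (map (\<lambda>x. p) [u]) = as_delta \<eta> [u]"
        by (rule U(2) [rule_format]) (use U(1) True in simp_all)
      then show ?thesis using \<eta>(1) by (simp add: bit_add_eq_0_iff)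
    qed
    then have "z [a] + z [- a] = 0" using a na by simp
    moreover have "z [a] + z (map uminus [a]) = cup_power dG k [a]"
      by (rule z_neg) (use a AY True in auto)
    ultimately show ?thesis using True by simp
  next
    case False
    then have k: "0 < k" by simp
    have "p \<in> topspace (top_of_set Y)"
    proof -
      obtain a where a: "a \<in> A" using ne by blast
      then have "h (a, 1) \<in> Y" using continuous_map_image_subset_topspace [OF h] by auto
      then show ?thesis using h1 [OF a] by simp
    qed
    from cohomologous_trans [OF hom constant_map_cohomologous_zero [OF z k this]]
    obtain \<eta> where \<eta>: "nearly (top_of_set A) (Suc k) (\<lambda>xs. z xs + 0 = as_delta \<eta> xs)"
      by (rule cohomologousE)
    define E where "E ys = \<eta> ys + \<eta> (map uminus ys)" for ys
    have E_neg: "E (map uminus ys) = E ys" for ys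
      by (simp add: E_def add.commute comp_def)
    have near_E: "nearly (top_of_set A) (Suc k) (\<lambda>xs. cup_power dG k xs = as_delta E xs)"
    proof (rule nearly_mono [OF nearly_conj [OF \<eta> nearly_pullback [OF \<eta> A.neg_cont]]])
      fix xs :: "'a list"
      assume xs: "length xs = Suc k" "set xs \<subseteq> topspace (top_of_set A)"
        and eq: "z xs + 0 = as_delta \<eta> xs \<and> z (map uminus xs) + 0 = as_delta \<eta> (map uminus xs)"
      have "cup_power dG k xs = z xs + z (map uminus xs)"
        by (rule z_neg [symmetric]) (use xs AY in auto)
      also have "\<dots> = as_delta E xs"
        using eq by (simp add: E_def [abs_def] as_delta_add as_delta_map)
      finally show "cup_power dG k xs = as_delta E xs" .
    qed
    obtain E' where E': "nearly (top_of_set A) k (\<lambda>xs. E' (map orbit xs) = E xs)"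
    proof (rule A.invariant_cochain_descends [of "\<lambda>x y. norm (x - y) < norm (x + y)" E k])
      show "nearly (top_of_set A) 2 (\<lambda>xs. norm (hd xs - last xs) < norm (hd xs + last xs))"
        using nz AY by (intro nearly_close_points) auto
      show "norm (- x - - y) < norm (- x + - y)" if "norm (x - y) < norm (x + y)" for x y :: 'a
        using that by (metis minus_add_distrib minus_diff_minus norm_minus_cancel)
      show "E (map uminus xs) = E xs" for xs by (rule E_neg)
    qed auto
    have "nearly (top_of_set A) (Suc k) (\<lambda>xs. cup_power v k (map orbit xs) + 0 = as_delta E' (map orbit xs))"
    proof (rule nearly_mono [OF nearly_conj [OF nearly_conj [OF nearly_pullback [OF power_dG incl] near_E] nearly_delta [OF E']]])
      fix xs :: "'a list"
      assume "(cup_power v k (map orbit (map (\<lambda>x. x) xs)) = cup_power dG k (map (\<lambda>x. x) xs) \<and>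
          cup_power dG k xs = as_delta E xs) \<and> as_delta (\<lambda>xs. E' (map orbit xs)) xs = as_delta E xs"
      then show "cup_power v k (map orbit xs) + 0 = as_delta E' (map orbit xs)"
        by (simp add: as_delta_map)
    qed
    then have "nearly (antipodal_quotient (top_of_set A)) (Suc k) (\<lambda>ys. cup_power v k ys + 0 = as_delta E' ys)"
      by (rule A.nearly_descend)
    then show ?thesis by (rule cohomologousI_positive [OF k])
  qed
qed

lemma exists_classifying_map:
  fixes A :: "'a::real_normed_vector set"
  assumes sym: "symmetric_set A" and nz: "0 \<notin> A"
  obtains f where "classifying_map A f"
proof -
  interpret A: antipodal_space "top_of_set A" using sym by (rule antipodal_space_top_of_set)
  obtain F where F: "continuous_map (top_of_set A) infinite_sphere F" "\<And>u. u \<in> A \<Longrightarrow> F (- u) = - F u"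
    using exists_odd_map_to_sphere [OF nz] by metis
  define f where "f y = orbit (F (SOME x. x \<in> y))" for y
  have f: "f (orbit x) = orbit (F x)" if "x \<in> A" for x
  proof -
    have "(SOME y. y \<in> orbit x) \<in> orbit x" by (rule someI [of _ x]) (simp add: orbit_def)
    then have "(SOME y. y \<in> orbit x) = x \<or> (SOME y. y \<in> orbit x) = - x" by (simp add: orbit_def)
    then show ?thesis using F(2) [OF that] infinite_sphere.orbit_neg unfolding f_def by metis
  qed
  have "continuous_map (top_of_set A) RP_infinity (orbit \<circ> F)"
    using continuous_map_compose [OF F(1) infinite_sphere.continuous_map_orbit] by (simp add: RP_infinity_def)
  then have oF: "orbit (F x) \<in> topspace RP_infinity" "openin RP_infinity V \<Longrightarrow> openin (top_of_set A) {x \<in> A. orbit (F x) \<in> V}"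
    if "x \<in> A" for x V
    using that unfolding continuous_map_def by auto
  have "continuous_map (antipodal_quotient (top_of_set A)) RP_infinity f"
    unfolding continuous_map_def
  proof (intro conjI allI impI)
    show "f \<in> topspace (antipodal_quotient (top_of_set A)) \<rightarrow> topspace RP_infinity"
      using f oF(1) by (auto simp: A.topspace_quotient)
    fix V assume V: "openin RP_infinity V"
    have "{x \<in> A. orbit x \<in> {y \<in> topspace (antipodal_quotient (top_of_set A)). f y \<in> V}} = {x \<in> A. orbit (F x) \<in> V}"
      using f by (auto simp: A.topspace_quotient)
    moreover have "openin (top_of_set A) {x \<in> A. orbit (F x) \<in> V}"
      using oF(2) [OF _ V] by (cases "A = {}") auto
    ultimately show "openin (antipodal_quotient (top_of_set A)) {y \<in> topspace (antipodal_quotient (top_of_set A)). f y \<in> V}"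
      by (auto simp: A.openin_quotient A.topspace_quotient)
  qed
  then have "classifying_map A f"
    unfolding classifying_map_def
    using F f by (intro conjI exI [of _ F]) (auto simp: orbit_def)
  then show ?thesis by (rule that)
qed

lemma classifying_map_odd_primitive:
  assumes f: "classifying_map A f"
    and w: "sphere_primitive w g" "\<And>x. x \<in> topspace infinite_sphere \<Longrightarrow> g (- x) = g x + 1"
  obtains G where "odd_primitive (top_of_set A) (\<lambda>ys. w (map f ys)) G"
proof -
  obtain F where F: "continuous_map (top_of_set A) infinite_sphere F"
    "\<forall>u\<in>A. F (- u) = - F u" "\<forall>u\<in>A. f {u, - u} = {F u, - F u}"
    using f unfolding classifying_map_def by blast
  have "odd_primitive (top_of_set A) (\<lambda>ys. w (map f ys)) (\<lambda>u. g (F u))"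
    unfolding odd_primitive_def
  proof (intro conjI ballI)
    fix u assume "u \<in> topspace (top_of_set A)"
    then have u: "u \<in> A" by simp
    then have "F u \<in> topspace infinite_sphere"
      using continuous_map_image_subset_topspace [OF F(1)] by auto
    then show "g (F (- u)) = g (F u) + 1" using w(2) F(2) u by simp
  next
    show "nearly (top_of_set A) 2 (\<lambda>xs. w (map f (map orbit xs)) = g (F (hd xs)) + g (F (last xs)))"
    proof (rule nearly_mono [OF nearly_pullback [OF w(1) [unfolded sphere_primitive_def] F(1)]])
      fix xs :: "'a list"
      assume xs: "length xs = 2" "set xs \<subseteq> topspace (top_of_set A)"
        and eq: "w (map orbit (map F xs)) = g (hd (map F xs)) + g (last (map F xs))"
      have eq': "map f (map orbit xs) = map orbit (map F xs)"
        using xs(2) F(3) by (auto simp: orbit_def)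
      have ne: "xs \<noteq> []" using xs(1) by auto
      show "w (map f (map orbit xs)) = g (F (hd xs)) + g (F (last xs))"
        by (simp only: eq' eq hd_map [OF ne] last_map [OF ne])
    qed
  qed
  then show ?thesis by (rule that)
qed

text \<open>
  The \<open>q\<close>-th power of the characteristic class of \<open>A\<close> is nonzero; the index counts these \<open>q\<close> from 1.
\<close>

definition detects :: "'a::real_normed_vector set \<Rightarrow> nat \<Rightarrow> bool" where
  "detects A q \<longleftrightarrow> (\<exists>f. classifying_map A f \<and>
     as_induced (antipodal_quotient (top_of_set A)) q f (as_power RP_infinity RP_omega q)
       \<noteq> as_zero (antipodal_quotient (top_of_set A)) q)"

text \<open>
  A finite supremum of natural numbers is attained.
\<close>

lemma cohomological_index_attained:
  assumes "A \<noteq> {}" "detects A 0" "cohomological_index A < \<infinity>"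
  obtains k where "cohomological_index A = enat (Suc k)" "detects A k" "\<not> detects A (Suc k)"
proof -
  let ?S = "{enat m | m. m \<ge> 1 \<and> detects A (m - 1)}"
  have ind: "cohomological_index A = Sup ?S"
    using assms(1) by (simp add: cohomological_index_def detects_def)
  have ne: "enat 1 \<in> ?S" using assms(2) by force
  have fin: "finite ?S" using assms(3) ne unfolding ind Sup_enat_def by (auto split: if_splits)
  then have "Sup ?S = Max ?S" using ne unfolding Sup_enat_def by (auto split: if_splits)
  moreover have "Max ?S \<in> ?S" using fin ne by (intro Max_in) auto
  ultimately have "cohomological_index A \<in> ?S" using ind by simp
  then obtain m where m: "cohomological_index A = enat m" "m \<ge> 1" "detects A (m - 1)" by blast
  have "\<not> detects A m"
  proof
    assume "detects A m"
    then have "enat (Suc m) \<in> ?S" by (intro CollectI exI [of _ "Suc m"]) auto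
    then have "enat (Suc m) \<le> Sup ?S" by (rule Sup_upper)
    then show False using m(1) ind by simp
  qed
  then show ?thesis using that [of "m - 1"] m by (cases m) auto
qed

lemma
  assumes w: "w \<in> as_cocycles RP_infinity 1" "RP_omega = as_class RP_infinity 1 w" and f: "classifying_map A f"
  shows induced_power_nonzero_iff: "as_induced (antipodal_quotient (top_of_set A)) q f (as_power RP_infinity RP_omega q)
       \<noteq> as_zero (antipodal_quotient (top_of_set A)) q \<longleftrightarrow>
     \<not> cohomologous (antipodal_quotient (top_of_set A)) q (cup_power (\<lambda>ys. w (map f ys)) q) (\<lambda>ys. 0)"
    and classifying_pullback_cocycle: "(\<lambda>ys. w (map f ys)) \<in> as_cocycles (antipodal_quotient (top_of_set A)) 1"
proof -
  have cont: "continuous_map (antipodal_quotient (top_of_set A)) RP_infinity f"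
    using f by (simp add: classifying_map_def)
  show "(\<lambda>ys. w (map f ys)) \<in> as_cocycles (antipodal_quotient (top_of_set A)) 1"
    using w(1) cont by (rule cocycle_pullback)
  have p: "cup_power w q \<in> as_cocycles RP_infinity q" using w(1) by (rule cocycle_cup_power)
  have eq: "(\<lambda>ys. cup_power w q (map f ys)) = cup_power (\<lambda>ys. w (map f ys)) q"
    by (simp add: cup_power_map fun_eq_iff)
  have c: "cup_power (\<lambda>ys. w (map f ys)) q \<in> as_cocycles (antipodal_quotient (top_of_set A)) q"
    unfolding eq [symmetric] using p cont by (rule cocycle_pullback)
  have "as_induced (antipodal_quotient (top_of_set A)) q f (as_power RP_infinity RP_omega q) =
      as_class (antipodal_quotient (top_of_set A)) q (cup_power (\<lambda>ys. w (map f ys)) q)"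
    unfolding w(2) as_power_class [OF w(1)] as_induced_class [OF p cont] eq ..
  then show "as_induced (antipodal_quotient (top_of_set A)) q f (as_power RP_infinity RP_omega q)
       \<noteq> as_zero (antipodal_quotient (top_of_set A)) q \<longleftrightarrow>
     \<not> cohomologous (antipodal_quotient (top_of_set A)) q (cup_power (\<lambda>ys. w (map f ys)) q) (\<lambda>ys. 0)"
    using as_class_eq_iff [OF c cocycle_zero] by (simp add: as_zero_eq)
qed

text \<open>
  If \<open>k + 1\<close> is the index of \<open>Y\<close>, the \<open>(k + 1)\<close>-st power of the characteristic class vanishes on \<open>Y\<close>, and the
  transfer makes the \<open>k\<close>-th power vanish on \<open>A\<close>, whatever classifying map is used there.
\<close>

proposition index_not_preserved_by_nullhomotopic_inclusion:
  fixes A Y :: "'a::real_normed_vector set" and h :: "'a \<times> real \<Rightarrow> 'a"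
  assumes sym: "symmetric_set A" "symmetric_set Y" and AY: "A \<subseteq> Y" and nz: "0 \<notin> Y" and ne: "A \<noteq> {}"
    and h: "continuous_map (top_of_set (A \<times> {0..1})) (top_of_set Y) h"
    and h0: "\<And>u. u \<in> A \<Longrightarrow> h (u, 0) = u" and h1: "\<And>u. u \<in> A \<Longrightarrow> h (u, 1) = p"
    and fin: "cohomological_index Y < \<infinity>"
  shows "cohomological_index A \<noteq> cohomological_index Y"
proof
  assume eq: "cohomological_index A = cohomological_index Y"
  interpret A: antipodal_space "top_of_set A" using sym(1) by (rule antipodal_space_top_of_set)
  obtain w g where w: "w \<in> as_cocycles RP_infinity 1" "RP_omega = as_class RP_infinity 1 w" "sphere_primitive w g"
    "\<And>x. x \<in> topspace infinite_sphere \<Longrightarrow> g (- x) = g x + 1"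
    using RP_omega_class by metis
  have detects0: "detects B 0" if B: "symmetric_set B" "B \<noteq> {}" "0 \<notin> B" for B :: "'a set"
  proof -
    interpret B: antipodal_space "top_of_set B" using B(1) by (rule antipodal_space_top_of_set)
    obtain f where f: "classifying_map B f" using exists_classifying_map [OF B(1,3)] .
    obtain b where b: "b \<in> B" using B(2) by blast
    then have top: "orbit b \<in> topspace (antipodal_quotient (top_of_set B))" by (simp add: B.topspace_quotient)
    have "\<not> cohomologous (antipodal_quotient (top_of_set B)) 0 (cup_power (\<lambda>ys. w (map f ys)) 0) (\<lambda>ys. 0)"
    proof
      assume "cohomologous (antipodal_quotient (top_of_set B)) 0 (cup_power (\<lambda>ys. w (map f ys)) 0) (\<lambda>ys. 0)"
      then obtain \<eta> where \<eta>: "\<eta> [] = 0" "nearly (antipodal_quotient (top_of_set B)) (Suc 0)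
          (\<lambda>xs. cup_power (\<lambda>ys. w (map f ys)) 0 xs + 0 = as_delta \<eta> xs)"
        by (rule cohomologousE)
      from nearlyE [OF \<eta>(2) top] obtain U where "orbit b \<in> U" "\<forall>xs. length xs = Suc 0 \<longrightarrow> set xs \<subseteq> U \<longrightarrow>
          cup_power (\<lambda>ys. w (map f ys)) 0 xs + 0 = as_delta \<eta> xs" .
      from this(2) [rule_format, of "[orbit b]"] this(1) \<eta>(1) show False by simp
    qed
    then show ?thesis unfolding detects_def using induced_power_nonzero_iff [OF w(1,2) f] f by blast
  qed
  have neY: "Y \<noteq> {}" and nzA: "0 \<notin> A" using ne AY nz by auto
  obtain k where k: "cohomological_index Y = enat (Suc k)" "\<not> detects Y (Suc k)"
    using cohomological_index_attained [OF neY detects0 [OF sym(2) neY nz] fin] by metis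
  obtain k' where k': "cohomological_index A = enat (Suc k')" "detects A k'"
    using cohomological_index_attained [OF ne detects0 [OF sym(1) ne nzA]] fin eq by metis
  have "k' = k" using k k' eq by simp
  obtain f where f: "classifying_map Y f" using exists_classifying_map [OF sym(2) nz] .
  obtain G where G: "odd_primitive (top_of_set Y) (\<lambda>ys. w (map f ys)) G"
    using classifying_map_odd_primitive [OF f w(3,4)] .
  have zero: "cohomologous (antipodal_quotient (top_of_set Y)) (Suc k) (cup_power (\<lambda>ys. w (map f ys)) (Suc k)) (\<lambda>ys. 0)"
    using k(2) f induced_power_nonzero_iff [OF w(1,2) f] unfolding detects_def by blast
  have vanish: "cohomologous (antipodal_quotient (top_of_set A)) k (cup_power (\<lambda>ys. w (map f ys)) k) (\<lambda>ys. 0)"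
    by (rule nullhomotopic_cup_power_vanishes [OF sym AY nz ne h _ _ G zero]) (use h0 h1 in auto)
  obtain f' where f': "classifying_map A f'" and nonzero:
    "\<not> cohomologous (antipodal_quotient (top_of_set A)) k (cup_power (\<lambda>ys. w (map f' ys)) k) (\<lambda>ys. 0)"
    using k'(2) \<open>k' = k\<close> induced_power_nonzero_iff [OF w(1,2)] unfolding detects_def by blast
  obtain G' where G': "odd_primitive (top_of_set A) (\<lambda>ys. w (map f' ys)) G'"
    using classifying_map_odd_primitive [OF f' w(3,4)] .

  have "continuous_map (top_of_set A) (top_of_set Y) (\<lambda>x. x)" using AY by auto
  from nearly_pullback [OF G [unfolded odd_primitive_def, THEN conjunct1] this]
  have "odd_primitive (top_of_set A) (\<lambda>ys. w (map f ys)) G"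
    using G AY by (auto simp: odd_primitive_def)
  from A.odd_primitives_cohomologous [OF G' this]
  have "cohomologous (antipodal_quotient (top_of_set A)) 1 (\<lambda>ys. w (map f' ys)) (\<lambda>ys. w (map f ys))" .
  moreover have "(\<lambda>ys. w (map f ys)) \<in> as_cocycles (antipodal_quotient (top_of_set A)) 1"
    using cocycle_pullback [OF classifying_pullback_cocycle [OF w(1,2) f] continuous_map_quotient_inclusion [OF sym AY]] by simp
  ultimately have "cohomologous (antipodal_quotient (top_of_set A)) k
      (cup_power (\<lambda>ys. w (map f' ys)) k) (cup_power (\<lambda>ys. w (map f ys)) k)"
    using classifying_pullback_cocycle [OF w(1,2) f'] by (intro cohomologous_cup_power)
  then show False using cohomologous_trans [OF _ vanish] nonzero by blast
qed

section \<open>Locally Lipschitz selections\<close>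

lemma Lipschitz_halving_sum:
  fixes f :: "nat \<Rightarrow> 'a::metric_space \<Rightarrow> 'b::banach"
  assumes b: "\<And>n x. norm (f n x) \<le> 1" and l: "\<And>n x y. norm (f n x - f n y) \<le> dist x y"
  shows "summable (\<lambda>n. (1 / 2) ^ n *\<^sub>R f n x)"
    and "norm ((\<Sum>n. (1 / 2) ^ n *\<^sub>R f n x) - (\<Sum>n. (1 / 2) ^ n *\<^sub>R f n y)) \<le> 2 * dist x y"
proof -
  have geo: "summable (\<lambda>n. (1 / 2 :: real) ^ n)" by (simp add: summable_geometric)
  show s: "summable (\<lambda>n. (1 / 2) ^ n *\<^sub>R f n x)" for x
    by (rule summable_comparison_test' [OF geo, of 0]) (use b in \<open>simp add: mult_left_le\<close>)
  have le: "norm ((1 / 2) ^ n *\<^sub>R f n x - (1 / 2) ^ n *\<^sub>R f n y) \<le> (1 / 2) ^ n * dist x y" for n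
    using l [of n x y] by (simp add: mult_left_mono flip: scaleR_diff_right)
  have sd: "summable (\<lambda>n. (1 / 2 :: real) ^ n * dist x y)"
    using geo by (rule summable_mult2)
  have "(\<Sum>n. (1 / 2) ^ n *\<^sub>R f n x) - (\<Sum>n. (1 / 2) ^ n *\<^sub>R f n y)
      = (\<Sum>n. (1 / 2) ^ n *\<^sub>R f n x - (1 / 2) ^ n *\<^sub>R f n y)"
    using s by (simp add: suminf_diff)
  also have "norm \<dots> \<le> (\<Sum>n. (1 / 2) ^ n * dist x y)"
    using le by (rule norm_suminf_le [OF _ sd])
  also have "\<dots> = 2 * dist x y"
    using suminf_mult2 [OF geo, of "dist x y"] suminf_geometric [of "1 / 2 :: real"] by simp
  finally show "norm ((\<Sum>n. (1 / 2) ^ n *\<^sub>R f n x) - (\<Sum>n. (1 / 2) ^ n *\<^sub>R f n y)) \<le> 2 * dist x y" .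
qed

text \<open>
  Where a single vector serves a neighbourhood, the corresponding open cover has a bump system. The weighted
  mean of the selected vectors is an infinite convex combination of elements of \<open>K x\<close>; the numerator and the
  denominator are Lipschitz, and the denominator is positive.
\<close>

proposition locally_Lipschitz_selection:
  fixes K :: "'a::real_normed_vector \<Rightarrow> 'b::banach set"
  assumes cvx: "\<And>x. convex (K x)" and cl: "\<And>x. closed (K x)"
    and bnd: "\<And>x y. y \<in> K x \<Longrightarrow> norm y \<le> 1"
    and loc: "\<And>x. \<exists>y U. open U \<and> x \<in> U \<and> (\<forall>x'\<in>U. y \<in> K x')"
  obtains V where "\<And>x. V x \<in> K x"
    "\<And>x. \<exists>r>0. \<exists>L>0. \<forall>y\<in>ball x r. \<forall>z\<in>ball x r. norm (V y - V z) \<le> L * dist y z"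
proof -
  obtain w sel where "bump_system (\<lambda>y. interior {x'. y \<in> K x'}) w sel"
    using bump_system_exists [of "\<lambda>y. interior {x'. y \<in> K x'}", OF open_interior] by metis
  note w = this [unfolded bump_system_def, THEN conjunct1]
    this [unfolded bump_system_def, THEN conjunct2, THEN conjunct1]
    this [unfolded bump_system_def, THEN conjunct2, THEN conjunct2, THEN conjunct1]
    this [unfolded bump_system_def, THEN conjunct2, THEN conjunct2, THEN conjunct2, THEN conjunct1]
    this [unfolded bump_system_def, THEN conjunct2, THEN conjunct2, THEN conjunct2, THEN conjunct2]
  have w0: "0 \<le> w n x" and w1: "w n x \<le> 1" and wl: "\<bar>w n x - w n y\<bar> \<le> dist x y" for n x y
    using w(1,2) by auto
  note wC = w(3) [rule_format] and ws = w(4) [rule_format] and wp = w(5) [rule_format]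
  have sel: "sel n x \<in> K x" if "0 < w n x" for n x
    using wC [OF that] interior_subset by blast
  define g where "g n x = w n x *\<^sub>R sel n x" for n x
  have gw: "norm (g n x) \<le> w n x" for n x
  proof (cases "0 < w n x")
    case True
    then show ?thesis using bnd [OF sel [OF True]] by (simp add: g_def mult_left_le)
  qed (use w0 [of n x] in \<open>simp add: g_def\<close>)
  have g1: "norm (g n x) \<le> 1" for n x
    using gw w1 order_trans by blast
  have gl: "norm (g n x - g n y) \<le> dist x y" for n x y
  proof (cases "0 < w n x \<and> 0 < w n y \<and> sel n x = sel n y")
    case True
    then have "norm (g n x - g n y) = \<bar>w n x - w n y\<bar> * norm (sel n x)"
      by (simp add: g_def flip: scaleR_diff_left)
    also have "\<dots> \<le> \<bar>w n x - w n y\<bar>"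
      using True bnd [OF sel [of n x]] by (simp add: mult_left_le)
    finally show ?thesis using wl [of n x y] by simp
  next
    case False
    have "norm (g n x - g n y) \<le> w n x + w n y"
      using norm_triangle_ineq4 [of "g n x" "g n y"] gw [of n x] gw [of n y] by simp
    also have "\<dots> \<le> dist x y"
    proof (cases "0 < w n x \<and> 0 < w n y")
      case True
      then show ?thesis using False ws [of n x y] by force
    next
      case False
      then have "w n x = 0 \<or> w n y = 0" using w0 [of n x] w0 [of n y] by linarith
      then show ?thesis using wl [of n x y] w0 [of n x] w0 [of n y] by auto
    qed
    finally show ?thesis .
  qed
  define S where "S x = (\<Sum>n. (1 / 2) ^ n *\<^sub>R w n x)" for x
  define N where "N x = (\<Sum>n. (1 / 2) ^ n *\<^sub>R g n x)" for x
  have sw: "summable (\<lambda>n. (1 / 2) ^ n *\<^sub>R w n x)" and Sl: "\<bar>S x - S y\<bar> \<le> 2 * dist x y" for x y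
    using Lipschitz_halving_sum [of w x] Lipschitz_halving_sum(2) [of w x y] w0 w1 wl
    by (auto simp: S_def)
  have sg: "summable (\<lambda>n. (1 / 2) ^ n *\<^sub>R g n x)" and Nl: "norm (N x - N y) \<le> 2 * dist x y" for x y
    using Lipschitz_halving_sum [of g x] Lipschitz_halving_sum(2) [of g x y] g1 gl
    by (auto simp: N_def)
  have S_pos: "0 < S x" for x
  proof -
    obtain y U where "open U" "x \<in> U" "\<forall>x'\<in>U. y \<in> K x'" using loc by blast
    then have "x \<in> interior {x'. y \<in> K x'}" by (auto simp: interior_def)
    then obtain n where "0 < w n x" using wp by blast
    then show ?thesis
      unfolding S_def using w0 by (intro suminf_pos2 [OF sw, where i = n]) auto
  qed
  have NS: "norm (N x) \<le> S x" for x
    unfolding N_def S_def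
    by (rule norm_suminf_le [OF _ sw]) (use gw in \<open>simp add: mult_left_mono\<close>)
  define V where "V x = N x /\<^sub>R S x" for x
  have "V x \<in> K x" for x
  proof -
    define s where "s m = (\<Sum>n<m. (1 / 2) ^ n * w n x)" for m
    have s_lim: "s \<longlonglongrightarrow> S x"
      using summable_LIMSEQ [OF sw [of x]] by (simp add: s_def [abs_def] S_def)
    have "(\<lambda>m. inverse (s m) *\<^sub>R (\<Sum>n<m. (1 / 2) ^ n *\<^sub>R g n x)) \<longlonglongrightarrow> V x"
      unfolding V_def N_def
      by (intro tendsto_scaleR tendsto_inverse s_lim summable_LIMSEQ sg) (use S_pos [of x] in simp)
    moreover have "\<forall>\<^sub>F m in sequentially. inverse (s m) *\<^sub>R (\<Sum>n<m. (1 / 2) ^ n *\<^sub>R g n x) \<in> K x"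
      using order_tendstoD(1) [OF s_lim S_pos]
    proof eventually_elim
      case (elim m)
      define F where "F = {n. n < m \<and> 0 < w n x}"
      have fin: "finite F" by (simp add: F_def)
      have sub: "F \<subseteq> {..<m}" by (auto simp: F_def)
      have zero: "w n x = 0" if "n \<in> {..<m} - F" for n
      proof -
        have "\<not> 0 < w n x" using that by (simp add: F_def)
        then show ?thesis using w0 [where n = n and x = x] by linarith
      qed
      have sF: "(\<Sum>n\<in>F. (1 / 2) ^ n * w n x) = s m"
        unfolding s_def by (intro sum.mono_neutral_left sub ballI finite_lessThan) (simp add: zero)
      have gF: "(\<Sum>n\<in>F. (1 / 2) ^ n *\<^sub>R g n x) = (\<Sum>n<m. (1 / 2) ^ n *\<^sub>R g n x)"
        by (intro sum.mono_neutral_left sub ballI finite_lessThan) (simp add: zero g_def)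
      have "(\<Sum>n\<in>F. ((1 / 2) ^ n * w n x / s m) *\<^sub>R sel n x) \<in> K x"
      proof (rule convex_sum [OF fin cvx])
        show "(\<Sum>n\<in>F. (1 / 2) ^ n * w n x / s m) = 1"
          using sF elim by (simp flip: sum_divide_distrib)
        show "0 \<le> (1 / 2) ^ n * w n x / s m" for n
          using w0 [of n x] elim by simp
        show "sel n x \<in> K x" if "n \<in> F" for n
          using that by (auto simp: F_def intro: sel)
      qed
      also have "(\<Sum>n\<in>F. ((1 / 2) ^ n * w n x / s m) *\<^sub>R sel n x) =
          inverse (s m) *\<^sub>R (\<Sum>n\<in>F. (1 / 2) ^ n *\<^sub>R g n x)"
        by (simp add: scaleR_sum_right g_def field_simps)
      finally show ?case by (simp add: gF)
    qed
    ultimately show ?thesis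
      using Lim_in_closed_set [OF cl] by (metis sequentially_bot)
  qed
  moreover have "\<exists>r>0. \<exists>L>0. \<forall>y\<in>ball x r. \<forall>z\<in>ball x r. norm (V y - V z) \<le> L * dist y z" for x
  proof (intro exI conjI ballI)
    show "0 < S x / 4" "0 < 8 / S x" using S_pos [of x] by auto
    fix y z assume y: "y \<in> ball x (S x / 4)" and z: "z \<in> ball x (S x / 4)"
    have Sy: "S x / 2 \<le> S y" using Sl [of x y] y by (simp add: dist_commute)
    have "V y - V z = (N y - N z) /\<^sub>R S y + (inverse (S y) - inverse (S z)) *\<^sub>R N z"
      by (simp add: V_def algebra_simps)
    also have "norm \<dots> \<le> norm (N y - N z) / S y + \<bar>inverse (S y) - inverse (S z)\<bar> * S z"
      using norm_triangle_ineq [of "(N y - N z) /\<^sub>R S y" "(inverse (S y) - inverse (S z)) *\<^sub>R N z"]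
        mult_left_mono [OF NS [of z], of "\<bar>inverse (S y) - inverse (S z)\<bar>"] S_pos [of y]
      by (simp add: divide_inverse mult.commute)
    also have "\<bar>inverse (S y) - inverse (S z)\<bar> * S z = \<bar>S y - S z\<bar> / S y"
    proof -
      have "inverse (S y) - inverse (S z) = (S z - S y) / (S y * S z)"
        using S_pos [of y] S_pos [of z] by (simp add: field_simps)
      then show ?thesis using S_pos [of y] S_pos [of z] by (simp add: abs_mult abs_minus_commute)
    qed
    also have "norm (N y - N z) / S y + \<bar>S y - S z\<bar> / S y \<le> 4 * dist y z / S y"
      using Nl [of y z] Sl [of y z] S_pos [of y] by (simp add: divide_right_mono flip: add_divide_distrib)
    also have "\<dots> \<le> 4 * dist y z / (S x / 2)"
      using Sy S_pos [of x] by (intro divide_left_mono) auto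
    finally show "norm (V y - V z) \<le> 8 / S x * dist y z" by (simp add: mult.commute)
  qed
  ultimately show ?thesis by (rule that)
qed

section \<open>Polygonal flows and deformations\<close>

text \<open>
  Polygons do not get stuck: if the step lengths were summable, the vertices would converge, and the step
  length at the limit would be zero.
\<close>

lemma not_summable_steps:
  fixes z :: "nat \<Rightarrow> 'a::banach" and \<tau> :: "'a \<Rightarrow> real"
  assumes \<tau>: "continuous_on UNIV \<tau>" "\<And>x. 0 < \<tau> x"
    and z: "\<And>n. norm (z (Suc n) - z n) \<le> \<tau> (z (n + i))"
  shows "\<not> summable (\<lambda>n. \<tau> (z n))"
proof
  assume s: "summable (\<lambda>n. \<tau> (z n))"
  then have "summable (\<lambda>n. \<tau> (z (n + i)))" by (rule summable_ignore_initial_segment)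
  then have "summable (\<lambda>n. z (Suc n) - z n)"
    by (rule summable_comparison_test' [of _ 0]) (use z in simp)
  then obtain l where "(\<lambda>n. z (Suc n) - z n) sums l" by (auto simp: summable_def)
  then have "(\<lambda>n. z n - z 0) \<longlonglongrightarrow> l"
    by (simp add: sums_def sum_lessThan_telescope)
  then have "z \<longlonglongrightarrow> l + z 0"
    using tendsto_add [of "\<lambda>n. z n - z 0" l sequentially "\<lambda>n. z 0" "z 0"] by simp
  then have "(\<lambda>n. \<tau> (z n)) \<longlonglongrightarrow> \<tau> (l + z 0)"
    using continuous_on_tendsto_compose [OF \<tau>(1)] by (simp add: eventually_True)
  moreover have "(\<lambda>n. \<tau> (z n)) \<longlonglongrightarrow> 0" using s by (rule summable_LIMSEQ_zero)
  ultimately have "\<tau> (l + z 0) = 0" by (rule LIMSEQ_unique)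
  then show False using \<tau>(2) [of "l + z 0"] by simp
qed

text \<open>
  The polygon with the vertices \<open>x\<close>, \<open>x - \<tau> x *\<^sub>R V x\<close> and so on replaces the integral curve of \<open>- V\<close>. The last
  assumption makes full and partial steps injective with a Lipschitz inverse.
\<close>

locale polygonal_flow =
  fixes V :: "'a::banach \<Rightarrow> 'a" and \<tau> :: "'a \<Rightarrow> real"
  assumes V_le_1: "norm (V x) \<le> 1"
    and tau_pos: "0 < \<tau> x"
    and tau_cont: "continuous_on UNIV \<tau>"
    and V_cont: "continuous_on UNIV V"
    and contraction: "0 \<le> r \<Longrightarrow> norm (min r (\<tau> x) *\<^sub>R V x - min r (\<tau> y) *\<^sub>R V y) \<le> norm (x - y) / 2"
begin

text \<open>
  The second component is the time that is left. A state with no time left is a fixed point, so iterating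
  \<open>move\<close> follows the polygon up to the given time.
\<close>

definition move :: "'a \<times> real \<Rightarrow> 'a \<times> real" where
  "move p = (fst p - min (snd p) (\<tau> (fst p)) *\<^sub>R V (fst p), snd p - min (snd p) (\<tau> (fst p)))"

definition flow :: "'a \<Rightarrow> real \<Rightarrow> 'a" where
  "flow x t = fst ((move ^^ (LEAST n. snd ((move ^^ n) (x, t)) = 0)) (x, t))"

definition step :: "'a \<Rightarrow> 'a" where
  "step x = x - \<tau> x *\<^sub>R V x"

lemma move_done: "snd p = 0 \<Longrightarrow> move p = p"
  using tau_pos [of "fst p"] by (simp add: move_def prod_eq_iff)

lemma funpow_move_done:
  assumes "snd ((move ^^ n) p) = 0" "n \<le> m"
  shows "(move ^^ m) p = (move ^^ n) p"
  using assms(2) by (induction m rule: dec_induct) (simp_all add: assms(1) move_done)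

lemma snd_move: "0 \<le> snd p \<Longrightarrow> 0 \<le> snd (move p)"
  by (simp add: move_def)

lemma snd_funpow_move: "0 \<le> snd p \<Longrightarrow> 0 \<le> snd ((move ^^ n) p)"
  by (induction n) (simp_all add: snd_move)

lemma move_terminates:
  assumes "0 \<le> snd p"
  shows "\<exists>n. snd ((move ^^ n) p) = 0"
proof (rule ccontr)
  assume "\<not> ?thesis"
  then have ne: "snd ((move ^^ n) p) \<noteq> 0" for n by simp
  define z where "z n = fst ((move ^^ n) p)" for n
  have full: "min (snd ((move ^^ n) p)) (\<tau> (z n)) = \<tau> (z n)" for n
    using ne [of "Suc n"] unfolding z_def by (auto simp: move_def min_def)
  have z_Suc: "z (Suc n) = z n - \<tau> (z n) *\<^sub>R V (z n)" for n
    using full [of n] by (simp add: z_def move_def)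
  have snd_Suc: "snd ((move ^^ Suc n) p) = snd ((move ^^ n) p) - \<tau> (z n)" for n
    using full [of n] by (simp add: z_def move_def)
  have sum: "(\<Sum>k<n. \<tau> (z k)) = snd p - snd ((move ^^ n) p)" for n
    by (induction n) (use snd_Suc in \<open>simp_all del: funpow.simps add: funpow_0\<close>)
  have "summable (\<lambda>n. \<tau> (z n))"
  proof (rule summableI_nonneg_bounded)
    show "0 \<le> \<tau> (z n)" for n by (rule less_imp_le [OF tau_pos])
    show "(\<Sum>k<n. \<tau> (z k)) \<le> snd p" for n
      using sum [of n] snd_funpow_move [OF assms, of n] by linarith
  qed
  moreover have "norm (z (Suc n) - z n) \<le> \<tau> (z (n + 0))" for n
    using V_le_1 [of "z n"] tau_pos [of "z n"] by (simp add: z_Suc mult_left_le)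
  then have "\<not> summable (\<lambda>n. \<tau> (z n))"
    by (rule not_summable_steps [OF tau_cont tau_pos])
  ultimately show False by contradiction
qed

lemma flow_eq:
  assumes "snd ((move ^^ n) (x, t)) = 0"
  shows "flow x t = fst ((move ^^ n) (x, t))"
proof -
  let ?m = "LEAST n. snd ((move ^^ n) (x, t)) = 0"
  have "snd ((move ^^ ?m) (x, t)) = 0" using assms by (rule LeastI)
  moreover have "?m \<le> n" using assms by (rule Least_le)
  ultimately show ?thesis
    unfolding flow_def by (simp only: funpow_move_done [of ?m _ n])
qed

lemma flow_0: "flow x 0 = x"
  using flow_eq [of 0 x 0] by simp

lemma flow_move:
  assumes "0 \<le> t"
  shows "flow x t = flow (fst (move (x, t))) (snd (move (x, t)))"
proof -
  obtain n where n: "snd ((move ^^ n) (x, t)) = 0" using move_terminates [of "(x, t)"] assms by auto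
  then have "(move ^^ Suc n) (x, t) = (move ^^ n) (x, t)" by (intro funpow_move_done) auto
  then have eq: "(move ^^ n) (move (x, t)) = (move ^^ n) (x, t)" by (simp add: funpow_swap1)
  show ?thesis
    using flow_eq [OF n] flow_eq [of n "fst (move (x, t))" "snd (move (x, t))"] n eq by simp
qed

text \<open>
  The predicate also sees the remaining time, which gives estimates in terms of the elapsed time.
\<close>

lemma flow_invariant:
  assumes step: "\<And>x s m. \<lbrakk>P x s; 0 \<le> m; m \<le> s; m \<le> \<tau> x\<rbrakk> \<Longrightarrow> P (x - m *\<^sub>R V x) (s - m)"
    and "P x t" "0 \<le> t"
  shows "P (flow x t) 0"
proof -
  have "P (fst ((move ^^ n) (x, t))) (snd ((move ^^ n) (x, t))) \<and> 0 \<le> snd ((move ^^ n) (x, t))" for n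
  proof (induction n)
    case (Suc n)
    let ?p = "(move ^^ n) (x, t)" and ?m = "min (snd ((move ^^ n) (x, t))) (\<tau> (fst ((move ^^ n) (x, t))))"
    have "P (fst ?p - ?m *\<^sub>R V (fst ?p)) (snd ?p - ?m)"
      using Suc tau_pos [of "fst ?p"] by (intro step) auto
    then have "P (fst (move ?p)) (snd (move ?p))" by (simp only: move_def fst_conv snd_conv)
    then show ?case using Suc snd_move [of ?p] by simp
  qed (use assms in simp)
  moreover obtain n where n: "snd ((move ^^ n) (x, t)) = 0"
    using move_terminates [of "(x, t)"] assms by auto
  ultimately show ?thesis using flow_eq [OF n] by metis
qed

lemma continuous_on_funpow_move:
  "continuous_on (UNIV \<times> {0..}) (move ^^ n)"
proof (induction n)
  case (Suc n)
  have "continuous_on UNIV move"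
    unfolding move_def
    by (intro continuous_intros continuous_on_compose2 [OF tau_cont] continuous_on_compose2 [OF V_cont]) auto
  then show ?case
    using Suc by (simp add: comp_def) (rule continuous_on_compose2, auto)
qed (simp add: continuous_on_id)

text \<open>
  At a given point finitely many moves use up the time. Nearby one further move suffices: the
  remaining time is then shorter than a full step.
\<close>

lemma continuous_on_flow: "continuous_on (UNIV \<times> {0..}) (\<lambda>(x, t). flow x t)"
  unfolding continuous_on_eq_continuous_within
proof
  fix p :: "'a \<times> real" assume p: "p \<in> UNIV \<times> {0..}"
  then obtain n where n: "snd ((move ^^ n) p) = 0" using move_terminates [of p] by auto
  let ?d = "\<lambda>p. \<tau> (fst ((move ^^ n) p)) - snd ((move ^^ n) p)"
  define T where "T = (UNIV \<times> {0..}) \<inter> ?d -` {0<..}"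
  have cont: "continuous_on (UNIV \<times> {0..}) ?d"
    by (intro continuous_intros continuous_on_funpow_move continuous_on_compose2 [OF tau_cont]) auto
  have op: "openin (top_of_set (UNIV \<times> {0..})) T"
    unfolding T_def by (rule continuous_openin_preimage_gen [OF cont open_greaterThan])
  have pT: "p \<in> T" using p n tau_pos by (simp add: T_def)
  have eq: "(\<lambda>p. fst ((move ^^ Suc n) p)) q = (\<lambda>(x, t). flow x t) q" if "q \<in> T" for q
  proof -
    have "snd ((move ^^ Suc n) q) = 0" using that by (simp add: T_def move_def)
    then show ?thesis by (cases q) (simp only: flow_eq prod.case)
  qed
  have ct: "continuous (at p within UNIV \<times> {0..}) (\<lambda>p. fst ((move ^^ Suc n) p))"
    using continuous_on_fst [OF continuous_on_funpow_move] p
    unfolding continuous_on_eq_continuous_within by blast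
  show "continuous (at p within UNIV \<times> {0..}) (\<lambda>(x, t). flow x t)"
    by (rule continuous_transform_within_openin [OF ct op pT]) (rule eq)
qed

lemma step_contraction: "norm (\<tau> x *\<^sub>R V x - \<tau> y *\<^sub>R V y) \<le> norm (x - y) / 2"
proof -
  have "0 \<le> max (\<tau> x) (\<tau> y)" using tau_pos [of x] by simp
  from contraction [OF this, of x y] show ?thesis by (simp add: min.absorb2)
qed

lemma ex1_step: "\<exists>!x. step x = y"
proof -
  have "\<exists>!x. y + \<tau> x *\<^sub>R V x = x"
    by (rule banach_fix_type [of "1 / 2"]) (use step_contraction in \<open>simp_all add: dist_norm\<close>)
  moreover have "step x = y \<longleftrightarrow> y + \<tau> x *\<^sub>R V x = x" for x
    by (auto simp: step_def algebra_simps)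
  ultimately show ?thesis by simp
qed

text \<open>
  A full step is the identity minus a contraction, hence a bijection by Banach's fixed point theorem.
\<close>

definition unstep :: "'a \<Rightarrow> 'a" where
  "unstep y = (THE x. step x = y)"

lemma step_unstep: "step (unstep y) = y"
  unfolding unstep_def using ex1_step by (rule theI')

lemma unstep_step: "unstep (step x) = x"
  unfolding unstep_def using ex1_step by (rule the1_equality) simp

lemma norm_unstep_le: "norm (unstep x - unstep y) \<le> 2 * norm (x - y)"
proof -
  have "unstep x - unstep y = (x - y) + (\<tau> (unstep x) *\<^sub>R V (unstep x) - \<tau> (unstep y) *\<^sub>R V (unstep y))"
    using step_unstep [of x] step_unstep [of y] by (simp add: step_def algebra_simps)
  then have "norm (unstep x - unstep y) \<le> norm (x - y) + norm (unstep x - unstep y) / 2"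
    using norm_triangle_le [OF add_left_mono [OF step_contraction]] by metis
  then show ?thesis by simp
qed

lemma continuous_on_unstep: "continuous_on UNIV (unstep ^^ n)"
proof (induction n)
  case (Suc n)
  have "2-lipschitz_on UNIV unstep"
    using norm_unstep_le by (intro lipschitz_onI) (auto simp: dist_norm)
  then show ?case
    using Suc by (simp add: comp_def) (rule continuous_on_compose2 [OF lipschitz_on_continuous_on], auto)
qed (simp add: continuous_on_id)

lemma unsteps_diverge: "\<exists>K. t < (\<Sum>k<K. \<tau> ((unstep ^^ Suc k) b))"
proof (rule ccontr)
  assume "\<not> ?thesis"
  then have le: "(\<Sum>k<K. \<tau> ((unstep ^^ Suc k) b)) \<le> t" for K by (simp add: not_less)
  define z where "z k = (unstep ^^ k) b" for k
  have "summable (\<lambda>k. \<tau> (z (k + 1)))"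
    by (rule summableI_nonneg_bounded [of _ t]) (use le in \<open>simp_all add: z_def less_imp_le [OF tau_pos]\<close>)
  then have "summable (\<lambda>k. \<tau> (z k))" by (rule summable_iff_shift [of "\<lambda>k. \<tau> (z k)" 1, THEN iffD1])
  moreover have "norm (z (Suc k) - z k) \<le> \<tau> (z (k + 1))" for k
  proof -
    have "z k = z (Suc k) - \<tau> (z (Suc k)) *\<^sub>R V (z (Suc k))"
      using step_unstep [of "z k"] by (simp add: z_def step_def)
    then have "norm (z (Suc k) - z k) = \<tau> (z (Suc k)) * norm (V (z (Suc k)))"
      using tau_pos [of "z (Suc k)"] by (metis abs_of_pos add_diff_cancel_left' diff_add_cancel norm_scaleR)
    then show ?thesis
      using V_le_1 [of "z (Suc k)"] tau_pos [of "z (Suc k)"] by (simp add: mult_left_le)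
  qed
  then have "\<not> summable (\<lambda>k. \<tau> (z k))"
    by (rule not_summable_steps [OF tau_cont tau_pos])
  ultimately show False by contradiction
qed

text \<open>
  Read backwards, the flow consists of one partial step of length \<open>r\<close> and \<open>n\<close> full steps.
\<close>

lemma flow_decompose:
  assumes "0 \<le> t"
  obtains b r n where "0 \<le> r" "r \<le> t" "x = (unstep ^^ n) b" "flow x t = b - min r (\<tau> b) *\<^sub>R V b"
    "(\<Sum>k<n. \<tau> ((unstep ^^ Suc k) b)) \<le> t"
proof -
  have "\<exists>b r n. 0 \<le> r \<and> r \<le> t \<and> x = (unstep ^^ n) b \<and> flow x t = b - min r (\<tau> b) *\<^sub>R V b \<and>
      (\<Sum>k<n. \<tau> ((unstep ^^ Suc k) b)) \<le> t"
    if "snd ((move ^^ N) (x, t)) = 0" "0 \<le> t" for N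
    using that
  proof (induction N arbitrary: x t)
    case 0
    then show ?case
      using flow_0 tau_pos [of x] by (intro exI [of _ x] exI [of _ 0] exI [of _ "0::nat"]) auto
  next
    case (Suc N)
    show ?case
    proof (cases "t \<le> \<tau> x")
      case True
      then have "flow x t = x - min t (\<tau> x) *\<^sub>R V x"
        using flow_move [OF Suc.prems(2), of x] flow_0 by (simp add: move_def)
      then show ?thesis
        using Suc.prems by (intro exI [of _ x] exI [of _ t] exI [of _ "0::nat"]) auto
    next
      case False
      then have mv: "move (x, t) = (step x, t - \<tau> x)" by (simp add: move_def step_def)
      then have "snd ((move ^^ N) (step x, t - \<tau> x)) = 0"
        using Suc.prems(1) by (simp add: funpow_swap1)
      from Suc.IH [OF this] False obtain b r n where
        b: "0 \<le> r" "r \<le> t - \<tau> x" "step x = (unstep ^^ n) b" "flow (step x) (t - \<tau> x) = b - min r (\<tau> b) *\<^sub>R V b"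
        "(\<Sum>k<n. \<tau> ((unstep ^^ Suc k) b)) \<le> t - \<tau> x" by auto
      have x: "x = (unstep ^^ Suc n) b" using unstep_step [of x] b(3) by simp
      have "flow x t = b - min r (\<tau> b) *\<^sub>R V b"
        using flow_move [OF Suc.prems(2), of x] mv b(4) by simp
      moreover have "(\<Sum>k<Suc n. \<tau> ((unstep ^^ Suc k) b)) \<le> t"
        using b(5) x by (simp del: funpow.simps)
      moreover have "r \<le> t" using b(2) tau_pos [of x] by simp
      ultimately show ?thesis using b(1) x by blast
    qed
  qed
  moreover obtain N where "snd ((move ^^ N) (x, t)) = 0"
    using move_terminates [of "(x, t)"] assms by auto
  ultimately show ?thesis using assms that by blast
qed

text \<open>
  Suppose that the endpoints converge. The partial steps may be assumed to have convergent lengths, and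
  then the points before the last step converge as well, since partial steps have Lipschitz inverses. Going
  back from their limit by full steps takes arbitrarily much time, which bounds the number of full steps;
  when this number is constant, the starting points converge too.
\<close>

proposition closed_flow_image:
  assumes C: "closed C" and t: "0 \<le> t"
  shows "closed ((\<lambda>x. flow x t) ` C)"
  unfolding closed_sequential_limits
proof (intro allI impI, elim conjE)
  fix y l assume y: "\<forall>j. y j \<in> (\<lambda>x. flow x t) ` C" and lim_y: "y \<longlonglongrightarrow> l"
  have "\<exists>x b r n. x \<in> C \<and> flow x t = y j \<and> 0 \<le> r \<and> r \<le> t \<and> x = (unstep ^^ n) b \<and>
      y j = b - min r (\<tau> b) *\<^sub>R V b \<and> (\<Sum>k<n. \<tau> ((unstep ^^ Suc k) b)) \<le> t" for j
  proof -
    obtain x where "x \<in> C" "flow x t = y j" using y by (metis imageE)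
    moreover obtain b r n where "0 \<le> r" "r \<le> t" "x = (unstep ^^ n) b" "flow x t = b - min r (\<tau> b) *\<^sub>R V b"
      "(\<Sum>k<n. \<tau> ((unstep ^^ Suc k) b)) \<le> t"
      using flow_decompose [OF t] by metis
    ultimately show ?thesis by metis
  qed
  then obtain x b r n where x: "\<And>j. x j \<in> C" "\<And>j. flow (x j) t = y j"
    and r: "\<And>j. 0 \<le> r j" "\<And>j. r j \<le> t" and xb: "\<And>j. x j = (unstep ^^ n j) (b j)"
    and yb: "\<And>j. y j = b j - min (r j) (\<tau> (b j)) *\<^sub>R V (b j)"
    and sm: "\<And>j. (\<Sum>k<n j. \<tau> ((unstep ^^ Suc k) (b j))) \<le> t"
    by metis
  have "\<exists>r0\<in>{0..t}. \<exists>s. strict_mono s \<and> (r \<circ> s) \<longlonglongrightarrow> r0"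
    using compact_Icc [of 0 t] r unfolding compact_def by simp
  then obtain r0 s where s: "strict_mono s" and lim_r: "(r \<circ> s) \<longlonglongrightarrow> r0" by blast
  have b_le: "norm (b i - b j) \<le> 2 * (norm (y i - y j) + \<bar>r i - r j\<bar>)" for i j
  proof -
    define u where "u = min (r i) (\<tau> (b i)) *\<^sub>R V (b i) - min (r i) (\<tau> (b j)) *\<^sub>R V (b j)"
    define v where "v = (min (r i) (\<tau> (b j)) - min (r j) (\<tau> (b j))) *\<^sub>R V (b j)"
    have "b i - b j = (y i - y j) + u + v"
      unfolding u_def v_def yb [of i] yb [of j] by (simp add: algebra_simps)
    then have "norm (b i - b j) \<le> norm (y i - y j) + norm u + norm v"
      by (metis norm_triangle_ineq norm_triangle_le add_right_mono)
    moreover have "norm u \<le> norm (b i - b j) / 2"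
      unfolding u_def by (rule contraction [OF r(1)])
    moreover have "norm v \<le> \<bar>r i - r j\<bar> * 1"
      unfolding v_def norm_scaleR by (intro mult_mono V_le_1) auto
    ultimately show ?thesis by simp
  qed
  have lim_ys: "(y \<circ> s) \<longlonglongrightarrow> l" using lim_y s by (rule LIMSEQ_subseq_LIMSEQ)
  have "Cauchy (b \<circ> s)"
  proof (rule metric_CauchyI)
    fix e :: real assume "0 < e"
    obtain M1 where M1: "\<And>i j. \<lbrakk>i \<ge> M1; j \<ge> M1\<rbrakk> \<Longrightarrow> dist ((y \<circ> s) i) ((y \<circ> s) j) < e / 4"
      using metric_CauchyD [OF LIMSEQ_imp_Cauchy [OF lim_ys], of "e / 4"] \<open>0 < e\<close> by auto
    obtain M2 where M2: "\<And>i j. \<lbrakk>i \<ge> M2; j \<ge> M2\<rbrakk> \<Longrightarrow> dist ((r \<circ> s) i) ((r \<circ> s) j) < e / 4"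
      using metric_CauchyD [OF LIMSEQ_imp_Cauchy [OF lim_r], of "e / 4"] \<open>0 < e\<close> by auto
    have "dist ((b \<circ> s) i) ((b \<circ> s) j) < e" if "i \<ge> max M1 M2" "j \<ge> max M1 M2" for i j
      using M1 [of i j] M2 [of i j] b_le [of "s i" "s j"] that by (simp add: dist_norm)
    then show "\<exists>M. \<forall>m\<ge>M. \<forall>n\<ge>M. dist ((b \<circ> s) m) ((b \<circ> s) n) < e" by blast
  qed
  then obtain b0 where lim_b: "(b \<circ> s) \<longlonglongrightarrow> b0"
    using Cauchy_convergent convergent_def by blast
  have lim_unstep: "(\<lambda>j. (unstep ^^ k) ((b \<circ> s) j)) \<longlonglongrightarrow> (unstep ^^ k) b0" for k
    using continuous_on_tendsto_compose [OF continuous_on_unstep lim_b] by simp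
  obtain K where K: "t < (\<Sum>k<K. \<tau> ((unstep ^^ Suc k) b0))" using unsteps_diverge by blast
  have "(\<lambda>j. \<Sum>k<K. \<tau> ((unstep ^^ Suc k) ((b \<circ> s) j))) \<longlonglongrightarrow> (\<Sum>k<K. \<tau> ((unstep ^^ Suc k) b0))"
    by (intro tendsto_sum continuous_on_tendsto_compose [OF tau_cont lim_unstep]) auto
  then have "\<forall>\<^sub>F j in sequentially. t < (\<Sum>k<K. \<tau> ((unstep ^^ Suc k) ((b \<circ> s) j)))"
    using K by (rule order_tendstoD)
  then have bd: "\<forall>\<^sub>F j in sequentially. n (s j) < K"
  proof eventually_elim
    case (elim j)
    show ?case
    proof (rule ccontr)
      assume "\<not> n (s j) < K"
      then have "(\<Sum>k<K. \<tau> ((unstep ^^ Suc k) (b (s j)))) \<le> (\<Sum>k<n (s j). \<tau> ((unstep ^^ Suc k) (b (s j))))"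
        by (intro sum_mono2) (auto simp: less_imp_le tau_pos)
      then show False using elim sm [of "s j"] by simp
    qed
  qed
  have "\<exists>N<K. \<not> (\<forall>\<^sub>F j in sequentially. n (s j) \<noteq> N)"
  proof (rule ccontr)
    assume "\<not> ?thesis"
    then have "\<forall>\<^sub>F j in sequentially. \<forall>N\<in>{..<K}. n (s j) \<noteq> N"
      by (intro eventually_ball_finite) auto
    with bd have "\<forall>\<^sub>F j in sequentially. False" by eventually_elim auto
    then show False by simp
  qed
  then obtain N where N: "\<not> (\<forall>\<^sub>F j in sequentially. n (s j) \<noteq> N)" by blast
  (* Restricting to the infinitely many j with N full steps, without choosing another subsequence. *)
  define F where "F = inf sequentially (principal {j. n (s j) = N})"
  have F: "F \<noteq> bot" using N by (simp add: F_def trivial_limit_def eventually_inf_principal)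
  have F_le: "F \<le> sequentially" by (simp add: F_def)
  have ev: "\<forall>\<^sub>F j in F. x (s j) = (unstep ^^ N) ((b \<circ> s) j)"
    unfolding F_def eventually_inf_principal using xb by (simp add: eventually_sequentially)
  have lim_x: "((\<lambda>j. x (s j)) \<longlongrightarrow> (unstep ^^ N) b0) F"
    by (rule Lim_transform_eventually [OF tendsto_mono [OF F_le lim_unstep [of N]]])
      (use ev in \<open>simp add: eq_commute\<close>)
  have in_C: "(unstep ^^ N) b0 \<in> C"
    by (rule Lim_in_closed_set [OF C _ F lim_x]) (simp add: x)
  have cont: "continuous_on UNIV (\<lambda>x. flow x t)"
  proof -
    have "continuous_on UNIV (\<lambda>x. (\<lambda>(x, t). flow x t) (x, t))"
      by (rule continuous_on_compose2 [OF continuous_on_flow]) (use t in \<open>auto intro!: continuous_intros\<close>)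
    then show ?thesis by simp
  qed
  have "((\<lambda>j. flow (x (s j)) t) \<longlongrightarrow> flow ((unstep ^^ N) b0) t) F"
    using continuous_on_tendsto_compose [OF cont lim_x] by simp
  then have "((\<lambda>j. (y \<circ> s) j) \<longlongrightarrow> flow ((unstep ^^ N) b0) t) F"
    by (simp add: x)
  moreover have "((\<lambda>j. (y \<circ> s) j) \<longlongrightarrow> l) F"
    using lim_ys F_le by (rule tendsto_mono [rotated])
  ultimately have "l = flow ((unstep ^^ N) b0) t"
    using tendsto_unique [OF F] by blast
  then show "l \<in> (\<lambda>x. flow x t) ` C" using in_C by blast
qed

end

text \<open>
  A Palais--Smale sequence at a level without critical points would converge to a critical point.
\<close>

lemma PS_gap:
  assumes C1: "C1_functional \<Phi> \<Phi>'" and PS: "PS_condition \<Phi> \<Phi>' (ereal c)"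
    and reg: "\<And>u. \<Phi> u = c \<Longrightarrow> \<Phi>' u \<noteq> 0" and e0: "0 < e0"
  obtains \<epsilon> where "0 < \<epsilon>" "\<epsilon> \<le> e0" "\<And>u. \<bar>\<Phi> u - c\<bar> \<le> 2 * \<epsilon> \<Longrightarrow> \<epsilon> \<le> norm (\<Phi>' u)"
proof (rule ccontr)
  assume no: "\<not> thesis"
  define d where "d n = min e0 (inverse (real (Suc n)))" for n
  have d: "0 < d n" "d n \<le> e0" for n using e0 by (auto simp: d_def)
  have d_lim: "d \<longlonglongrightarrow> 0"
    by (rule real_tendsto_sandwich [of "\<lambda>n. 0" _ _ "\<lambda>n. inverse (real (Suc n))"])
      (use d(1) less_imp_le LIMSEQ_inverse_real_of_nat in \<open>auto simp: d_def\<close>)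
  have "\<exists>u. \<bar>\<Phi> u - c\<bar> \<le> 2 * d n \<and> norm (\<Phi>' u) < d n" for n
    using no that [of "d n"] d [of n] by (meson not_le)
  then obtain u where u: "\<And>n. \<bar>\<Phi> (u n) - c\<bar> \<le> 2 * d n" "\<And>n. norm (\<Phi>' (u n)) < d n" by metis
  have "(\<lambda>n. \<Phi> (u n) - c) \<longlonglongrightarrow> 0"
    by (rule Lim_null_comparison [of _ "\<lambda>n. 2 * d n"])
      (use u(1) tendsto_mult_right_zero [OF d_lim, of 2] in auto)
  then have lim1: "(\<lambda>n. \<Phi> (u n)) \<longlonglongrightarrow> c" by (simp add: LIM_zero_iff)
  have lim2: "(\<lambda>n. \<Phi>' (u n)) \<longlonglongrightarrow> 0"
    by (rule Lim_null_comparison [OF _ d_lim]) (simp add: less_imp_le [OF u(2)])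
  have "\<exists>l r. strict_mono r \<and> (u \<circ> r) \<longlonglongrightarrow> l"
    using PS lim1 lim2 unfolding PS_condition_def by (simp add: lim1 tendsto_ereal)
  then obtain l r where r: "strict_mono r" and l: "(u \<circ> r) \<longlonglongrightarrow> l" by blast
  have "continuous_on UNIV \<Phi>"
    using C1 unfolding C1_functional_def
    by (meson continuous_at_imp_continuous_on has_derivative_continuous)
  then have "(\<lambda>n. \<Phi> ((u \<circ> r) n)) \<longlonglongrightarrow> \<Phi> l"
    by (rule continuous_on_tendsto_compose [OF _ l]) simp_all
  moreover have "(\<lambda>n. \<Phi> ((u \<circ> r) n)) \<longlonglongrightarrow> c"
    using LIMSEQ_subseq_LIMSEQ [OF lim1 r] by (simp add: comp_def)
  ultimately have "\<Phi> l = c" by (rule LIMSEQ_unique)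
  have "continuous_on UNIV \<Phi>'" using C1 by (simp add: C1_functional_def)
  then have "(\<lambda>n. \<Phi>' ((u \<circ> r) n)) \<longlonglongrightarrow> \<Phi>' l"
    by (rule continuous_on_tendsto_compose [OF _ l]) simp_all
  moreover have "(\<lambda>n. \<Phi>' ((u \<circ> r) n)) \<longlonglongrightarrow> 0"
    using LIMSEQ_subseq_LIMSEQ [OF lim2 r] by (simp add: comp_def)
  ultimately have "\<Phi>' l = 0" by (rule LIMSEQ_unique)
  with reg [OF \<open>\<Phi> l = c\<close>] show False by contradiction
qed

lemma exists_steep_direction:
  fixes f :: "'a::real_normed_vector \<Rightarrow>\<^sub>L real"
  assumes "0 \<le> \<alpha>" "\<alpha> < norm f"
  shows "\<exists>y. norm y \<le> 1 \<and> \<alpha> < f y"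
proof (rule ccontr)
  assume "\<not> ?thesis"
  then have le: "f y \<le> \<alpha>" if "norm y \<le> 1" for y using that by force
  have "norm (f x) \<le> \<alpha> * norm x" for x
  proof (cases "x = 0")
    case False
    have "f (x /\<^sub>R norm x) \<le> \<alpha>" "f (- x /\<^sub>R norm x) \<le> \<alpha>" using False by (auto intro!: le)
    then have "\<bar>f x\<bar> / norm x \<le> \<alpha>"
      using False by (simp add: blinfun.scaleR_right blinfun.minus_right divide_inverse mult.commute abs_if split: if_splits)
    then show ?thesis using False by (simp add: field_simps)
  qed simp
  then have "norm f \<le> \<alpha>" using assms(1) by (intro norm_blinfun_bound) auto
  with assms(2) show False by simp
qed

text \<open>
  The field \<open>V\<close> vanishes outside the band of width \<open>2 * \<epsilon>\<close> and has slope at least \<open>\<epsilon> / 2\<close> in the band of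
  width \<open>\<epsilon>\<close>. The condition \<open>\<epsilon> / 2 * norm y \<le> \<Phi>' u y\<close> is kept in the transition zone. The derivative varies
  by at most \<open>\<epsilon> / 4\<close> along a step, so \<open>\<Phi>\<close> never increases and decreases at rate \<open>\<epsilon> / 4\<close> in the inner band.
\<close>

proposition deformation:
  fixes \<Phi> :: "'a::banach \<Rightarrow> real"
  assumes C1: "C1_functional \<Phi> \<Phi>'" and PS: "PS_condition \<Phi> \<Phi>' (ereal c)"
    and reg: "\<And>u. \<Phi> u = c \<Longrightarrow> \<Phi>' u \<noteq> 0" and e0: "0 < e0"
  obtains \<epsilon> \<kappa> and \<eta> :: "'a \<Rightarrow> real \<Rightarrow> 'a" where "0 < \<epsilon>" "\<epsilon> \<le> e0" "0 < \<kappa>"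
    "continuous_on (UNIV \<times> {0..}) (\<lambda>(u, t). \<eta> u t)" "\<forall>u. \<eta> u 0 = u"
    "\<forall>u t. 0 \<le> t \<longrightarrow> \<Phi> u \<le> c - 2 * \<epsilon> \<longrightarrow> \<eta> u t = u"
    "\<forall>u t. 0 \<le> t \<longrightarrow> \<Phi> u \<le> c + \<epsilon> \<longrightarrow> \<Phi> (\<eta> u t) \<le> max (c - \<epsilon>) (\<Phi> u - \<kappa> * t)"
    "\<forall>C t. closed C \<longrightarrow> 0 \<le> t \<longrightarrow> closed ((\<lambda>u. \<eta> u t) ` C)"
proof -
  obtain \<epsilon> where \<epsilon>: "0 < \<epsilon>" "\<epsilon> \<le> e0" and gap: "\<And>u. \<bar>\<Phi> u - c\<bar> \<le> 2 * \<epsilon> \<Longrightarrow> \<epsilon> \<le> norm (\<Phi>' u)"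
    using PS_gap [OF C1 PS reg e0] by metis
  have der: "(\<Phi> has_derivative blinfun_apply (\<Phi>' u)) (at u)" for u
    using C1 by (simp add: C1_functional_def)
  have cont_\<Phi>': "continuous_on UNIV \<Phi>'" using C1 by (simp add: C1_functional_def)
  have cont_\<Phi>: "continuous_on UNIV \<Phi>"
    using der by (meson continuous_at_imp_continuous_on has_derivative_continuous)
  define K where "K u = {y. norm y \<le> 1 \<and> (2 * \<epsilon> \<le> \<bar>\<Phi> u - c\<bar> \<longrightarrow> y = 0) \<and>
      \<epsilon> / 2 * norm y \<le> \<Phi>' u y \<and> (\<bar>\<Phi> u - c\<bar> \<le> \<epsilon> \<longrightarrow> \<epsilon> / 2 \<le> \<Phi>' u y)}" for u
  have K_eq: "K u = cball 0 1 \<inter> (if 2 * \<epsilon> \<le> \<bar>\<Phi> u - c\<bar> then {0} else UNIV) \<inter>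
      {y. \<epsilon> / 2 * norm y - \<Phi>' u y \<le> 0} \<inter> (if \<bar>\<Phi> u - c\<bar> \<le> \<epsilon> then {y. \<epsilon> / 2 \<le> \<Phi>' u y} else UNIV)" for u
    by (auto simp: K_def)
  have "convex {y. \<epsilon> / 2 * norm y - \<Phi>' u y \<le> 0}" for u
  proof (rule convexI, clarify)
    fix x y and a b :: real
    assume x: "\<epsilon> / 2 * norm x - \<Phi>' u x \<le> 0" and y: "\<epsilon> / 2 * norm y - \<Phi>' u y \<le> 0" and ab: "0 \<le> a" "0 \<le> b"
    have "\<epsilon> / 2 * norm (a *\<^sub>R x + b *\<^sub>R y) \<le> \<epsilon> / 2 * (a * norm x + b * norm y)"
      using norm_triangle_ineq [of "a *\<^sub>R x" "b *\<^sub>R y"] ab \<epsilon>(1) by (intro mult_left_mono) auto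
    also have "\<dots> \<le> a * \<Phi>' u x + b * \<Phi>' u y"
      using mult_left_mono [of "\<epsilon> / 2 * norm x" "\<Phi>' u x" a] mult_left_mono [of "\<epsilon> / 2 * norm y" "\<Phi>' u y" b]
        x y ab by (simp add: algebra_simps)
    finally show "\<epsilon> / 2 * norm (a *\<^sub>R x + b *\<^sub>R y) - \<Phi>' u (a *\<^sub>R x + b *\<^sub>R y) \<le> 0"
      by (simp add: blinfun.add_right blinfun.scaleR_right)
  qed
  moreover have "convex {y. \<epsilon> / 2 \<le> \<Phi>' u y}" for u
  proof (rule convexI, clarify)
    fix x y and a b :: real
    assume x: "\<epsilon> / 2 \<le> \<Phi>' u x" and y: "\<epsilon> / 2 \<le> \<Phi>' u y" and ab: "0 \<le> a" "0 \<le> b" "a + b = 1"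
    have "\<epsilon> / 2 = a * (\<epsilon> / 2) + b * (\<epsilon> / 2)" using ab(3) by (metis distrib_right mult_1)
    also have "\<dots> \<le> a * \<Phi>' u x + b * \<Phi>' u y" using x y ab by (intro add_mono mult_left_mono)
    finally show "\<epsilon> / 2 \<le> \<Phi>' u (a *\<^sub>R x + b *\<^sub>R y)"
      by (simp add: blinfun.add_right blinfun.scaleR_right)
  qed
  ultimately have K_convex: "convex (K u)" for u
    unfolding K_eq by (intro convex_Int convex_cball) auto
  have K_closed: "closed (K u)" for u
    unfolding K_eq by (intro closed_Int closed_cball) (auto intro!: closed_Collect_le continuous_intros)
  have K_local: "\<exists>y U. open U \<and> u \<in> U \<and> (\<forall>u'\<in>U. y \<in> K u')" for u
  proof (cases "\<bar>\<Phi> u - c\<bar> < 2 * \<epsilon>")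
    case True
    then have "\<epsilon> / 2 < norm (\<Phi>' u)" using gap [of u] \<epsilon>(1) by simp
    then obtain y where y: "norm y \<le> 1" "\<epsilon> / 2 < \<Phi>' u y"
      using exists_steep_direction [of "\<epsilon> / 2" "\<Phi>' u"] \<epsilon>(1) by auto
    let ?U = "{u. \<bar>\<Phi> u - c\<bar> < 2 * \<epsilon>} \<inter> {u. \<epsilon> / 2 < \<Phi>' u y}"
    have "open ?U"
      by (intro open_Int open_Collect_less continuous_intros cont_\<Phi> cont_\<Phi>')
    moreover have "y \<in> K u'" if "u' \<in> ?U" for u'
    proof -
      have "\<epsilon> / 2 * norm y \<le> \<epsilon> / 2" using y(1) \<epsilon>(1) by (simp add: mult_left_le)
      then show ?thesis using that y(1) by (auto simp: K_def)
    qed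
    ultimately show ?thesis using True y(2) by (intro exI [of _ y] exI [of _ ?U]) auto
  next
    case False
    let ?U = "{u. \<epsilon> < \<bar>\<Phi> u - c\<bar>}"
    have "open ?U" by (intro open_Collect_less continuous_intros cont_\<Phi>)
    then show ?thesis
      using False \<epsilon>(1) by (intro exI [of _ 0] exI [of _ ?U]) (auto simp: K_def)
  qed
  obtain V where V: "\<And>u. V u \<in> K u"
    and V_lip: "\<And>u. \<exists>r>0. \<exists>L>0. \<forall>y\<in>ball u r. \<forall>z\<in>ball u r. norm (V y - V z) \<le> L * dist y z"
    using locally_Lipschitz_selection [of K, OF K_convex K_closed _ K_local] by (auto simp: K_def)
  have V1: "norm (V u) \<le> 1" for u using V [of u] by (simp add: K_def)
  define Q where "Q u r \<longleftrightarrow> (\<forall>x\<in>ball u r. \<forall>y\<in>ball u r. norm (V x - V y) \<le> dist x y / r \<and>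
      norm (\<Phi>' x - \<Phi>' y) \<le> \<epsilon> / 4)" for u and r :: real
  have Q_pos: "\<exists>r>0. Q u r" for u
  proof -
    obtain r L where r: "0 < r" "0 < L" "\<forall>y\<in>ball u r. \<forall>z\<in>ball u r. norm (V y - V z) \<le> L * dist y z"
      using V_lip by metis
    have "isCont \<Phi>' u" using cont_\<Phi>' by (simp add: continuous_on_eq_continuous_at)
    then obtain \<delta> where \<delta>: "0 < \<delta>" "\<And>x. dist x u < \<delta> \<Longrightarrow> dist (\<Phi>' x) (\<Phi>' u) < \<epsilon> / 8"
      unfolding continuous_at_eps_delta using \<epsilon>(1) by (metis divide_pos_pos zero_less_numeral)
    define \<rho> where "\<rho> = min (min r \<delta>) (1 / L)"
    have \<rho>: "0 < \<rho>" using r \<delta>(1) by (simp add: \<rho>_def)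
    have "Q u \<rho>"
      unfolding Q_def
    proof (intro ballI conjI)
      fix x y assume xy: "x \<in> ball u \<rho>" "y \<in> ball u \<rho>"
      have "norm (V x - V y) \<le> L * dist x y" using r(3) xy by (simp add: \<rho>_def)
      also have "L \<le> 1 / \<rho>"
      proof -
        have "\<rho> \<le> 1 / L" by (simp add: \<rho>_def)
        then show ?thesis using \<rho> r(2) by (simp add: field_simps)
      qed
      then have "L * dist x y \<le> 1 / \<rho> * dist x y" by (intro mult_right_mono) auto
      finally show "norm (V x - V y) \<le> dist x y / \<rho>" by simp
      have "dist (\<Phi>' x) (\<Phi>' u) < \<epsilon> / 8" "dist (\<Phi>' y) (\<Phi>' u) < \<epsilon> / 8"
        using xy by (intro \<delta>(2); simp add: \<rho>_def dist_commute)+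
      then have "dist (\<Phi>' x) (\<Phi>' y) \<le> \<epsilon> / 4"
        using dist_triangle2 [of "\<Phi>' x" "\<Phi>' y" "\<Phi>' u"] by simp
      then show "norm (\<Phi>' x - \<Phi>' y) \<le> \<epsilon> / 4" by (simp add: dist_norm)
    qed
    with \<rho> show ?thesis by blast
  qed
  have Q_mono: "Q v r'" if "Q u r" "0 < r'" "dist u v + r' \<le> r" for u v r r'
    unfolding Q_def
  proof (intro ballI)
    fix x y assume xy: "x \<in> ball v r'" "y \<in> ball v r'"
    have "x \<in> ball u r" "y \<in> ball u r"
      using xy that(3) dist_triangle [of u x v] dist_triangle [of u y v] by auto
    then have "norm (V x - V y) \<le> dist x y / r" and *: "norm (\<Phi>' x - \<Phi>' y) \<le> \<epsilon> / 4"
      using that(1) by (auto simp: Q_def)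
    moreover have "r' \<le> r" "0 < r" using that(2,3) zero_le_dist [of u v] by linarith+
    then have "dist x y / r \<le> dist x y / r'" using that(2) by (intro divide_left_mono) auto
    ultimately show "norm (V x - V y) \<le> dist x y / r' \<and> norm (\<Phi>' x - \<Phi>' y) \<le> \<epsilon> / 4" by simp
  qed
  have "\<exists>d. (\<forall>u. 0 < d u) \<and> (\<forall>u. Q u (d u)) \<and> (\<forall>u v. \<bar>d u - d v\<bar> \<le> dist u v)"
  proof (rule Lipschitz_radius [of UNIV Q])
    show "\<exists>r>0. Q x r" for x by (rule Q_pos)
    show "Q y r'" if "Q x r" "0 < r'" "dist x y + r' \<le> r" for x y r r'
      using that by (rule Q_mono)
  qed blast
  then obtain d where d: "\<And>u. 0 < d u" "\<And>u. Q u (d u)" "\<And>u v. \<bar>d u - d v\<bar> \<le> dist u v" by blast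
  (* V has Lipschitz constant 1 / d u on the ball of radius d u, so \<tau> V has Lipschitz constant 1 / 4 there;
   for points farther apart the trivial estimate suffices. *)
  define \<tau> where "\<tau> u = d u / 8" for u
  have V_cont: "continuous_on UNIV V"
  proof (rule continuous_at_imp_continuous_on, rule ballI)
    fix u
    obtain r L where r: "0 < r" "0 < L" "\<forall>y\<in>ball u r. \<forall>z\<in>ball u r. norm (V y - V z) \<le> L * dist y z"
      using V_lip by metis
    have "L-lipschitz_on (ball u r) V"
      using r by (intro lipschitz_onI) (auto simp: dist_norm)
    then have "continuous_on (ball u r) V" by (rule lipschitz_on_continuous_on)
    then show "isCont V u" using r(1) by (simp add: continuous_on_eq_continuous_at)
  qed
  interpret polygonal_flow V \<tau>
  proof
    show "norm (V x) \<le> 1" for x by (rule V1)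
    show "0 < \<tau> x" for x using d(1) by (simp add: \<tau>_def)
    show "continuous_on UNIV \<tau>"
    proof -
      have "1-lipschitz_on UNIV d"
        using d(3) by (intro lipschitz_onI) (auto simp: dist_real_def)
      then have "continuous_on UNIV d" by (rule lipschitz_on_continuous_on)
      then show ?thesis unfolding \<tau>_def by (intro continuous_intros) auto
    qed
    show "continuous_on UNIV V" by (rule V_cont)
    show "norm (min r (\<tau> x) *\<^sub>R V x - min r (\<tau> y) *\<^sub>R V y) \<le> norm (x - y) / 2" if r: "0 \<le> r" for r x y
    proof -
      have *: "norm (min r (\<tau> x) *\<^sub>R V x - min r (\<tau> y) *\<^sub>R V y) \<le> norm (x - y) / 2" if "d y \<le> d x" for x y
      proof (cases "dist x y < d x")
        case True
        then have VL: "norm (V x - V y) \<le> dist x y / d x"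
          using d(2) [of x] d(1) [of x] unfolding Q_def by simp
        have "min r (\<tau> x) *\<^sub>R V x - min r (\<tau> y) *\<^sub>R V y =
            min r (\<tau> x) *\<^sub>R (V x - V y) + (min r (\<tau> x) - min r (\<tau> y)) *\<^sub>R V y"
          by (simp add: algebra_simps)
        then have "norm (min r (\<tau> x) *\<^sub>R V x - min r (\<tau> y) *\<^sub>R V y) \<le>
            \<bar>min r (\<tau> x)\<bar> * norm (V x - V y) + \<bar>min r (\<tau> x) - min r (\<tau> y)\<bar> * norm (V y)"
          by (metis norm_scaleR norm_triangle_ineq)
        also have "\<dots> \<le> d x / 8 * (dist x y / d x) + (dist x y / 8) * 1"
        proof (intro add_mono mult_mono VL V1)
          show "\<bar>min r (\<tau> x)\<bar> \<le> d x / 8" using r d(1) [of x] by (auto simp: \<tau>_def)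
          show "\<bar>min r (\<tau> x) - min r (\<tau> y)\<bar> \<le> dist x y / 8"
            using d(3) [of x y] unfolding \<tau>_def by linarith
        qed (use d(1) [of x] in auto)
        also have "\<dots> \<le> dist x y / 2" using d(1) [of x] by simp
        finally show ?thesis by (simp only: dist_norm)
      next
        case False
        have "norm (min r (\<tau> x) *\<^sub>R V x - min r (\<tau> y) *\<^sub>R V y) \<le>
            \<bar>min r (\<tau> x)\<bar> * norm (V x) + \<bar>min r (\<tau> y)\<bar> * norm (V y)"
          by (metis norm_scaleR norm_triangle_ineq4)
        also have "\<dots> \<le> d x / 8 * 1 + d y / 8 * 1"
          using r d(1) [of x] d(1) [of y] by (intro add_mono mult_mono V1) (auto simp: \<tau>_def)
        also have "\<dots> \<le> dist x y / 2" using False \<open>d y \<le> d x\<close> zero_le_dist [of x y] by linarith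
        finally show ?thesis by (simp add: dist_norm)
      qed
      show ?thesis
        using * [of x y] * [of y x] by (cases "d y \<le> d x") (auto simp: norm_minus_commute)
    qed
  qed
  have descent: "\<Phi> (u - m *\<^sub>R V u) \<le> \<Phi> u - m * (\<Phi>' u (V u) - \<epsilon> / 4 * norm (V u))"
    if m: "0 \<le> m" "m \<le> \<tau> u" for u m
  proof (cases "m = 0")
    case False
    have "((\<lambda>r. \<Phi> (u - r *\<^sub>R V u)) has_real_derivative - \<Phi>' (u - r *\<^sub>R V u) (V u)) (at r)" for r
    proof -
      have "((\<lambda>r. \<Phi> (u - r *\<^sub>R V u)) has_derivative (\<lambda>h. \<Phi>' (u - r *\<^sub>R V u) (- (h *\<^sub>R V u)))) (at r)"
        by (rule has_derivative_compose [OF _ der, where f = "\<lambda>r. u - r *\<^sub>R V u"])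
          (auto intro!: derivative_eq_intros)
      moreover have "(\<lambda>h. \<Phi>' (u - r *\<^sub>R V u) (- (h *\<^sub>R V u))) = (*) (- \<Phi>' (u - r *\<^sub>R V u) (V u))"
        by (simp add: fun_eq_iff blinfun.minus_right blinfun.scaleR_right)
      ultimately show ?thesis by (simp add: has_field_derivative_def)
    qed
    then obtain r where r: "0 < r" "r < m"
      "\<Phi> (u - m *\<^sub>R V u) - \<Phi> (u - 0 *\<^sub>R V u) = (m - 0) * (- \<Phi>' (u - r *\<^sub>R V u) (V u))"
      using MVT2 [of 0 m "\<lambda>r. \<Phi> (u - r *\<^sub>R V u)" "\<lambda>r. - \<Phi>' (u - r *\<^sub>R V u) (V u)"] m False by auto
    have "norm (r *\<^sub>R V u) < d u"
    proof -
      have "norm (r *\<^sub>R V u) \<le> r * 1" using r V1 [of u] by (simp add: mult_left_le)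
      also have "\<dots> < d u" using r m d(1) [of u] by (simp add: \<tau>_def)
      finally show ?thesis .
    qed
    then have "norm (\<Phi>' u - \<Phi>' (u - r *\<^sub>R V u)) \<le> \<epsilon> / 4"
      using d(2) [of u] d(1) [of u] unfolding Q_def by (simp add: dist_norm)
    then have "norm ((\<Phi>' u - \<Phi>' (u - r *\<^sub>R V u)) (V u)) \<le> \<epsilon> / 4 * norm (V u)"
      by (meson mult_right_mono norm_blinfun norm_ge_zero order_trans)
    then have "\<Phi>' u (V u) - \<epsilon> / 4 * norm (V u) \<le> \<Phi>' (u - r *\<^sub>R V u) (V u)"
      unfolding real_norm_def blinfun.diff_left by linarith
    then have "m * (\<Phi>' u (V u) - \<epsilon> / 4 * norm (V u)) \<le> m * \<Phi>' (u - r *\<^sub>R V u) (V u)"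
      using m(1) by (rule mult_left_mono)
    moreover have "\<Phi> (u - m *\<^sub>R V u) = \<Phi> u - m * \<Phi>' (u - r *\<^sub>R V u) (V u)"
      using r(3) by simp
    ultimately show ?thesis by simp
  qed simp
  define good where "good u0 t u s \<longleftrightarrow> 0 \<le> s \<and> s \<le> t \<and> (\<Phi> u \<le> c - \<epsilon> \<or> \<Phi> u \<le> \<Phi> u0 - \<epsilon> / 4 * (t - s))" for u0 t u s
  have decrease: "\<Phi> (flow u0 t) \<le> max (c - \<epsilon>) (\<Phi> u0 - \<epsilon> / 4 * t)" if t: "0 \<le> t" and u0: "\<Phi> u0 \<le> c + \<epsilon>" for u0 t
  proof -
    have "good u0 t (flow u0 t) 0"
    proof (rule flow_invariant [OF _ _ t])
      show "good u0 t u0 t" using t by (simp add: good_def)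
      fix u s m assume g: "good u0 t u s" and m: "0 \<le> m" "m \<le> s" "m \<le> \<tau> u"
      have Vu: "\<epsilon> / 2 * norm (V u) \<le> \<Phi>' u (V u)" using V [of u] by (simp add: K_def)
      moreover have "\<epsilon> / 4 * norm (V u) \<le> \<epsilon> / 2 * norm (V u)" using \<epsilon>(1) by (intro mult_right_mono) auto
      ultimately have nonneg: "0 \<le> m * (\<Phi>' u (V u) - \<epsilon> / 4 * norm (V u))" using m(1) by simp
      have le: "\<Phi> (u - m *\<^sub>R V u) \<le> \<Phi> u" using descent [OF m(1,3)] nonneg by simp
      show "good u0 t (u - m *\<^sub>R V u) (s - m)"
      proof (cases "\<Phi> u \<le> c - \<epsilon>")
        case True
        then show ?thesis using g m le by (simp add: good_def)
      next
        case False
        then have u: "\<Phi> u \<le> \<Phi> u0 - \<epsilon> / 4 * (t - s)" "s \<le> t" using g by (auto simp: good_def)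
        have "0 \<le> \<epsilon> / 4 * (t - s)" using u(2) \<epsilon>(1) by simp
        then have "\<Phi> u \<le> c + \<epsilon>" using u(1) u0 by linarith
        then have "\<epsilon> / 2 \<le> \<Phi>' u (V u)" using False V [of u] by (simp add: K_def abs_le_iff)
        moreover have "\<epsilon> / 4 * norm (V u) \<le> \<epsilon> / 4" using V1 [of u] \<epsilon>(1) by (simp add: mult_left_le)
        ultimately have "m * (\<epsilon> / 4) \<le> m * (\<Phi>' u (V u) - \<epsilon> / 4 * norm (V u))"
          using m(1) by (intro mult_left_mono) auto
        then have "\<Phi> (u - m *\<^sub>R V u) \<le> \<Phi> u0 - \<epsilon> / 4 * (t - s) - m * (\<epsilon> / 4)"
          using descent [OF m(1,3)] u(1) by linarith
        also have "\<dots> = \<Phi> u0 - \<epsilon> / 4 * (t - (s - m))" by (simp add: field_simps)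
        finally show ?thesis using g m by (auto simp: good_def)
      qed
    qed
    then show ?thesis by (auto simp: good_def)
  qed
  have rest: "flow u t = u" if "0 \<le> t" "\<Phi> u \<le> c - 2 * \<epsilon>" for u t
  proof -
    have "2 * \<epsilon> \<le> \<bar>\<Phi> u - c\<bar>" using that(2) by simp
    then have "V u = 0" using V [of u] by (simp add: K_def)
    then show ?thesis
      using flow_invariant [of "\<lambda>x s. x = u" u t] that(1) by simp
  qed
  show ?thesis
  proof (rule that [of \<epsilon> "\<epsilon> / 4" flow])
    show "continuous_on (UNIV \<times> {0..}) (\<lambda>(u, t). flow u t)" by (rule continuous_on_flow)
    show "\<forall>C t. closed C \<longrightarrow> 0 \<le> t \<longrightarrow> closed ((\<lambda>u. flow u t) ` C)" using closed_flow_image by blast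
  qed (use \<epsilon> flow_0 rest decrease in auto)
qed

section \<open>Linking and the minimax level\<close>

lemma continuous_on_pair_arg:
  assumes "continuous_on (UNIV \<times> {0..}) (\<lambda>(u, t). \<sigma> u t)"
    and "continuous_on S f" "continuous_on S g" "\<And>x. x \<in> S \<Longrightarrow> 0 \<le> (g x :: real)"
  shows "continuous_on S (\<lambda>x. \<sigma> (f x) (g x))"
proof -
  have "continuous_on S (\<lambda>x. (\<lambda>(u, t). \<sigma> u t) (f x, g x))"
    by (rule continuous_on_compose2 [OF assms(1)]) (use assms in \<open>auto intro!: continuous_intros\<close>)
  then show ?thesis by simp
qed

locale scaled_space =
  fixes \<sigma> :: "'w::banach \<Rightarrow> real \<Rightarrow> 'w" and s :: real and I :: "'w \<Rightarrow> real"
  assumes scaling: "is_scaling \<sigma> s" and functional: "scaled_functional \<sigma> s I"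
begin

lemma scale_cont: "continuous_on (UNIV \<times> {0..}) (\<lambda>(u, t). \<sigma> u t)"
  using scaling unfolding is_scaling_def by (elim conjE)

lemma scale_scale: "\<lbrakk>0 \<le> t; 0 \<le> t'\<rbrakk> \<Longrightarrow> \<sigma> (\<sigma> u t) t' = \<sigma> u (t * t')"
proof -
  have "\<forall>u. \<forall>t1\<ge>0. \<forall>t2\<ge>0. \<sigma> (\<sigma> u t1) t2 = \<sigma> u (t1 * t2)"
    using scaling unfolding is_scaling_def by (elim conjE)
  then show "\<lbrakk>0 \<le> t; 0 \<le> t'\<rbrakk> \<Longrightarrow> \<sigma> (\<sigma> u t) t' = \<sigma> u (t * t')" by simp
qed

lemma scale_0 [simp]: "\<sigma> u 0 = 0" and scale_1 [simp]: "\<sigma> u 1 = u"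
proof -
  have "\<forall>u. \<sigma> u 0 = 0 \<and> \<sigma> u 1 = u"
    using scaling unfolding is_scaling_def by (elim conjE)
  then show "\<sigma> u 0 = 0" "\<sigma> u 1 = u" by simp_all
qed

lemma s_pos: "0 < s"
  using scaling unfolding is_scaling_def by (elim conjE)

lemma I_cont: "continuous_on UNIV I"
  and I_even: "I (- u) = I u"
  and I_scale: "0 \<le> t \<Longrightarrow> I (\<sigma> u t) = t powr s * I u"
  and I_pos: "u \<noteq> 0 \<Longrightarrow> 0 < I u"
  using functional by (simp_all add: scaled_functional_def)

lemma I_0 [simp]: "I 0 = 0"
  using I_scale [of 0 0] by simp

lemma I_nonneg: "0 \<le> I u"
  using I_pos [of u] by (cases "u = 0") auto

text \<open>
  Every nonzero point is \<open>\<sigma> u t\<close> for exactly one \<open>u\<close> on the unit level of \<open>I\<close> and one \<open>t > 0\<close>; \<open>proj\<close> and \<open>radius\<close>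
  recover \<open>u\<close> and \<open>t\<close> by homogeneity.
\<close>

definition radius :: "'w \<Rightarrow> real" where
  "radius x = I x powr (1 / s)"

definition proj :: "'w \<Rightarrow> 'w" where
  "proj x = \<sigma> x (I x powr (- (1 / s)))"

lemma radius_cont: "continuous_on UNIV radius"
  unfolding radius_def
  by (rule continuous_on_powr') (use I_cont I_nonneg s_pos in \<open>auto intro!: continuous_intros\<close>)

lemma proj_cont: "continuous_on (- {0}) proj"
  unfolding proj_def
proof (rule continuous_on_pair_arg [OF scale_cont])
  show "continuous_on (- {0}) (\<lambda>x. I x powr (- (1 / s)))"
    using I_pos by (intro continuous_on_powr continuous_intros continuous_on_subset [OF I_cont]) fastforce+
qed (auto intro: continuous_intros)

lemma I_proj: "x \<noteq> 0 \<Longrightarrow> I (proj x) = 1"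
  using I_pos [of x] s_pos by (simp add: proj_def I_scale powr_powr powr_neg_one)

lemma scale_proj: "x \<noteq> 0 \<Longrightarrow> \<sigma> (proj x) (radius x) = x"
  using I_pos [of x] by (simp add: proj_def radius_def scale_scale flip: powr_add)

lemma radius_scale: "\<lbrakk>I u = 1; 0 \<le> t\<rbrakk> \<Longrightarrow> radius (\<sigma> u t) = t"
  using s_pos by (simp add: radius_def I_scale powr_powr)

lemma proj_scale: "\<lbrakk>I u = 1; 0 < t\<rbrakk> \<Longrightarrow> proj (\<sigma> u t) = u"
  using s_pos by (simp add: proj_def I_scale powr_powr scale_scale powr_neg_one)

lemma symmetric_unit_level: "symmetric_set (unit_level I)"
  unfolding symmetric_set_def unit_level_def using I_even
  by (metis (no_types, lifting) equalityI image_eqI image_subsetI mem_Collect_eq minus_minus subsetI)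

definition cone :: "'w set \<Rightarrow> real \<Rightarrow> 'w set" where
  "cone A0 R = {\<sigma> u t | u t. u \<in> A0 \<and> 0 \<le> t \<and> t \<le> R}"

lemma cone_I: "\<lbrakk>u \<in> A0; 0 \<le> t; t \<le> R\<rbrakk> \<Longrightarrow> \<sigma> u t \<in> cone A0 R"
  by (auto simp: cone_def)

lemma cone_decompose:
  assumes "A0 \<subseteq> unit_level I" "x \<in> cone A0 R" "x \<noteq> 0"
  shows "proj x \<in> A0" "0 < radius x" "radius x \<le> R"
proof -
  obtain u t where x: "x = \<sigma> u t" "u \<in> A0" "0 \<le> t" "t \<le> R" using assms(2) by (auto simp: cone_def)
  have t: "0 < t" using x assms(3) by (cases "t = 0") auto
  have u: "I u = 1" using assms(1) x(2) by (auto simp: unit_level_def)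
  show "proj x \<in> A0" "0 < radius x" "radius x \<le> R"
    using x t u by (simp_all add: proj_scale radius_scale)
qed

text \<open>
  Away from the apex, membership in the cone is a closed condition on \<open>proj\<close> and \<open>radius\<close>; the apex belongs
  to the cone.
\<close>

lemma closed_cone:
  assumes A0: "A0 \<subseteq> unit_level I" "closed A0" "A0 \<noteq> {}" and R: "0 < R"
  shows "closed (cone A0 R)"
  unfolding closed_sequential_limits
proof (intro allI impI, elim conjE)
  fix x l assume x: "\<forall>n. x n \<in> cone A0 R" and lim: "x \<longlonglongrightarrow> l"
  show "l \<in> cone A0 R"
  proof (cases "l = 0")
    case True
    obtain u where "u \<in> A0" using A0(3) by blast
    then show ?thesis using cone_I [of u A0 0 R] R True by simp
  next
    case False
    then have ev: "\<forall>\<^sub>F n in sequentially. x n \<in> - {0}"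
      using topological_tendstoD [OF lim, of "- {0}"] by (simp add: open_Compl)
    have "(\<lambda>n. proj (x n)) \<longlonglongrightarrow> proj l"
      by (rule continuous_on_tendsto_compose [OF proj_cont lim]) (use False ev in auto)
    moreover have "\<forall>\<^sub>F n in sequentially. proj (x n) \<in> A0"
      using ev by eventually_elim (use x cone_decompose(1) [OF A0(1)] in auto)
    ultimately have "proj l \<in> A0"
      by (rule Lim_in_closed_set [OF A0(2) _ sequentially_bot, rotated])
    moreover have "radius l \<le> R"
    proof (rule tendsto_upperbound)
      show "(\<lambda>n. radius (x n)) \<longlonglongrightarrow> radius l"
        by (rule continuous_on_tendsto_compose [OF radius_cont lim]) auto
      show "\<forall>\<^sub>F n in sequentially. radius (x n) \<le> R"
        using ev by eventually_elim (use x cone_decompose(3) [OF A0(1)] in auto)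
    qed simp
    moreover have "0 \<le> radius l" by (simp add: radius_def)
    ultimately have "\<sigma> (proj l) (radius l) \<in> cone A0 R" by (intro cone_I)
    then show ?thesis by (simp add: scale_proj [OF False])
  qed
qed

text \<open>
  A map of the cone that fixes the rim and avoids the cone over \<open>B0\<close> would, after projection, contract \<open>A0\<close>
  in the complement of \<open>B0\<close>.
\<close>

proposition linking:
  assumes A0: "A0 \<subseteq> unit_level I" "A0 \<noteq> {}" "symmetric_set A0"
    and B0: "B0 \<subseteq> unit_level I" "B0 \<noteq> {}" "symmetric_set B0" and disj: "A0 \<inter> B0 = {}"
    and ind: "cohomological_index A0 = cohomological_index (unit_level I - B0)"
      "cohomological_index (unit_level I - B0) < \<infinity>"
    and R: "0 < R" and \<gamma>: "continuous_on (cone A0 R) \<gamma>" "\<And>u. u \<in> A0 \<Longrightarrow> \<gamma> (\<sigma> u R) = \<sigma> u R"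
  shows "\<exists>x\<in>cone A0 R. \<exists>u\<in>B0. \<exists>t\<ge>0. \<gamma> x = \<sigma> u t"
proof (rule ccontr)
  assume "\<not> ?thesis"
  then have avoid: "\<gamma> x \<noteq> \<sigma> u t" if "x \<in> cone A0 R" "u \<in> B0" "0 \<le> t" for x u t
    using that by blast
  let ?Y = "unit_level I - B0"
  have nz: "\<gamma> x \<noteq> 0" if "x \<in> cone A0 R" for x
    using avoid [OF that] B0(2) scale_0 by (metis all_not_in_conv order_refl)
  have projY: "proj (\<gamma> x) \<in> ?Y" if x: "x \<in> cone A0 R" for x
  proof -
    have "proj (\<gamma> x) \<notin> B0"
    proof
      assume "proj (\<gamma> x) \<in> B0"
      from avoid [OF x this, of "radius (\<gamma> x)"] show False
        using scale_proj [OF nz [OF x]] by (simp add: radius_def)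
    qed
    then show ?thesis using I_proj [OF nz [OF x]] by (simp add: unit_level_def)
  qed
  define h where "h = (\<lambda>(u, r). proj (\<gamma> (\<sigma> u (R * (1 - r)))))"
  have in_cone: "\<sigma> u (R * (1 - r)) \<in> cone A0 R" if "u \<in> A0" "r \<in> {0..1}" for u r
    using that R by (intro cone_I) (auto simp: mult_left_le)
  have "continuous_on (A0 \<times> {0..1}) h"
  proof -
    have "continuous_on (A0 \<times> {0..1}) (\<lambda>p. \<sigma> (fst p) (R * (1 - snd p)))"
      by (rule continuous_on_pair_arg [OF scale_cont]) (use R in \<open>auto intro!: continuous_intros\<close>)
    then have "continuous_on (A0 \<times> {0..1}) (\<lambda>p. \<gamma> (\<sigma> (fst p) (R * (1 - snd p))))"
      by (rule continuous_on_compose2 [OF \<gamma>(1)]) (use in_cone in auto)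
    then have "continuous_on (A0 \<times> {0..1}) (\<lambda>p. proj (\<gamma> (\<sigma> (fst p) (R * (1 - snd p)))))"
      by (rule continuous_on_compose2 [OF proj_cont]) (use nz in_cone in auto)
    then show ?thesis by (simp add: h_def case_prod_unfold)
  qed
  then have h: "continuous_map (top_of_set (A0 \<times> {0..1})) (top_of_set ?Y) h"
    using projY in_cone by (auto simp: h_def)
  have "cohomological_index A0 \<noteq> cohomological_index ?Y"
  proof (rule index_not_preserved_by_nullhomotopic_inclusion [OF A0(3) _ _ _ A0(2) h _ _ ind(2)])
    show "symmetric_set ?Y"
      using symmetric_unit_level B0(3) unfolding symmetric_set_def by (simp add: image_set_diff)
    show "A0 \<subseteq> ?Y" using A0(1) disj by blast
    show "0 \<notin> ?Y" by (simp add: unit_level_def)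
    show "h (u, 0) = u" if u: "u \<in> A0" for u
    proof -
      have "I u = 1" using u A0(1) by (auto simp: unit_level_def)
      then show ?thesis using proj_scale R \<gamma>(2) [OF u] by (simp add: h_def)
    qed
    show "h (u, 1) = proj (\<gamma> 0)" for u by (simp add: h_def)
  qed
  then show False using ind(1) by simp
qed

end

theorem theorem1p5:
  fixes \<sigma> :: "'w::banach \<Rightarrow> real \<Rightarrow> 'w"
    and s R :: real
    and I \<Phi> :: "'w \<Rightarrow> real"
    and \<Phi>' :: "'w \<Rightarrow> ('w \<Rightarrow>\<^sub>L real)"
    and A0 B0 M X A B :: "'w set"
    and c :: ereal
  assumes "reflexive_space TYPE('w)"
    and "is_scaling \<sigma> s"
    and "scaled_functional \<sigma> s I"
    and "M = unit_level I"
    and "bounded M"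
    and "meets_rays_once M"
    and "C1_functional \<Phi> \<Phi>'"
    and "A0 \<subseteq> M" "A0 \<noteq> {}" "closed A0" "symmetric_set A0"
    and "B0 \<subseteq> M" "B0 \<noteq> {}" "closed B0" "symmetric_set B0"
    and "A0 \<inter> B0 = {}"
    and "cohomological_index A0 = cohomological_index (M - B0)"
    and "cohomological_index (M - B0) < \<infinity>"
    and "R > 0"
    and "X = {\<sigma> u t | u t. u \<in> A0 \<and> 0 \<le> t \<and> t \<le> R}"
    and "A = {\<sigma> u R | u. u \<in> A0}"
    and "B = {\<sigma> u t | u t. u \<in> B0 \<and> 0 \<le> t}"
    and "(SUP u\<in>A. ereal (\<Phi> u)) \<le> (INF u\<in>B. ereal (\<Phi> u))"
    and "(SUP u\<in>X. ereal (\<Phi> u)) < \<infinity>"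
    and "c = minimax_level \<Phi> X A"
    and "PS_condition \<Phi> \<Phi>' c"
  shows "critical_value \<Phi> \<Phi>' c"
proof -
  note C1 = assms(7) and M = assms(4) and R = assms(19) and A_def = assms(21) and B_def = assms(22)
  interpret scaled_space \<sigma> s I using assms(2,3) by unfold_locales
  have A0: "A0 \<subseteq> unit_level I" and B0: "B0 \<subseteq> unit_level I" using assms(4,8,12) by auto
  have I_A0: "I u = 1" if "u \<in> A0" for u using that A0 by (auto simp: unit_level_def)
  have I_B0: "I u = 1" if "u \<in> B0" for u using that B0 by (auto simp: unit_level_def)
  have X: "X = cone A0 R" using assms(20) by (simp add: cone_def)
  have AX: "A \<subseteq> X" unfolding X A_def using R cone_I by fastforce
  have link: "\<exists>x\<in>X. \<gamma> x \<in> B" if "continuous_on X \<gamma>" "\<forall>u\<in>A. \<gamma> u = u" for \<gamma>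
  proof -
    have "\<exists>x\<in>cone A0 R. \<exists>u\<in>B0. \<exists>t\<ge>0. \<gamma> x = \<sigma> u t"
      by (rule linking) (use assms A0 B0 that in \<open>auto simp: X\<close>)
    then show ?thesis by (auto simp: X B_def)
  qed
  define supA where "supA = (SUP u\<in>A. ereal (\<Phi> u))"
  define infB where "infB = (INF u\<in>B. ereal (\<Phi> u))"
  have sup_le_inf: "supA \<le> infB" using assms(23) by (simp add: supA_def infB_def)
  have A_ne: "A \<noteq> {}" using assms(9) by (auto simp: A_def)
  have inf_le_c: "infB \<le> c"
    unfolding assms(25) minimax_level_def
  proof (rule INF_greatest)
    fix \<gamma> assume "\<gamma> \<in> admissible_maps X A"
    then obtain x where x: "x \<in> X" "\<gamma> x \<in> B" using link by (auto simp: admissible_maps_def)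
    have "infB \<le> ereal (\<Phi> (\<gamma> x))" unfolding infB_def using x(2) by (rule INF_lower)
    also have "\<dots> \<le> (SUP u\<in>\<gamma> ` X. ereal (\<Phi> u))" using x(1) by (intro SUP_upper) auto
    finally show "infB \<le> (SUP u\<in>\<gamma> ` X. ereal (\<Phi> u))" .
  qed
  have "closed X" unfolding X using A0 assms(10,9) R by (rule closed_cone)
  then have "(\<lambda>x. x) \<in> admissible_maps X A" by (simp add: admissible_maps_def continuous_on_id)
  then have "c \<le> (SUP u\<in>(\<lambda>x. x) ` X. ereal (\<Phi> u))"
    unfolding assms(25) minimax_level_def by (rule INF_lower)
  then have c_less: "c < \<infinity>" using assms(24) unfolding image_ident by (rule order_le_less_trans)
  obtain a where "a \<in> A" using A_ne by blast
  then have "ereal (\<Phi> a) \<le> supA" unfolding supA_def by (rule SUP_upper)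
  then have supA_greater: "- \<infinity> < supA" by (rule less_le_trans [rotated]) simp
  have sup_le_c: "supA \<le> c" using sup_le_inf inf_le_c by (rule order_trans)
  obtain c0 where c0: "c = ereal c0"
    using c_less supA_greater sup_le_c by (cases c) auto
  obtain a0 where a0: "supA = ereal a0"
    using c_less supA_greater sup_le_c by (cases supA) auto
  have le_a0: "\<Phi> u \<le> a0" if "u \<in> A" for u
    using SUP_upper [OF that, of "\<lambda>u. ereal (\<Phi> u)"] a0 by (simp add: supA_def)
  have PS: "PS_condition \<Phi> \<Phi>' (ereal c0)" using assms(26) c0 by simp
  show ?thesis
  proof (rule ccontr)
    assume "\<not> critical_value \<Phi> \<Phi>' c"
    then have reg: "\<Phi>' u \<noteq> 0" if "\<Phi> u = c0" for u
      using that c0 unfolding critical_value_def by auto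
    (* With this bound the deformation fixes A if \<Phi> is strictly below the level there. *)
    define e0 where "e0 = (if a0 < c0 then (c0 - a0) / 2 else 1)"
    have e0: "0 < e0" by (simp add: e0_def)
    obtain \<epsilon> \<kappa> \<eta> where \<epsilon>: "0 < \<epsilon>" "\<epsilon> \<le> e0" and \<kappa>: "0 < \<kappa>"
      and \<eta>_cont: "continuous_on (UNIV \<times> {0..}) (\<lambda>(u, t). \<eta> u t)" and \<eta>_0: "\<forall>u. \<eta> u 0 = u"
      and \<eta>_fix: "\<forall>u t. 0 \<le> t \<longrightarrow> \<Phi> u \<le> c0 - 2 * \<epsilon> \<longrightarrow> \<eta> u t = u"
      and \<eta>_le: "\<forall>u t. 0 \<le> t \<longrightarrow> \<Phi> u \<le> c0 + \<epsilon> \<longrightarrow> \<Phi> (\<eta> u t) \<le> max (c0 - \<epsilon>) (\<Phi> u - \<kappa> * t)"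
      and \<eta>_closed: "\<forall>C t. closed C \<longrightarrow> 0 \<le> t \<longrightarrow> closed ((\<lambda>u. \<eta> u t) ` C)"
      by (rule deformation [OF C1 PS _ e0]) (erule reg, rule that)
    (* The time that a descent from c0 + \<epsilon> to c0 - \<epsilon> takes at rate \<kappa>. *)
    define T where "T = 2 * \<epsilon> / \<kappa>"
    have T: "0 < T" "\<kappa> * T = 2 * \<epsilon>" using \<epsilon>(1) \<kappa> by (simp_all add: T_def)
    have "c < ereal (c0 + \<epsilon>)" using \<epsilon>(1) c0 by simp
    then obtain \<gamma> where \<gamma>: "\<gamma> \<in> admissible_maps X A" and sup_\<gamma>: "(SUP u\<in>\<gamma> ` X. ereal (\<Phi> u)) < ereal (c0 + \<epsilon>)"
      unfolding assms(25) minimax_level_def INF_less_iff by blast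
    have \<gamma>_cont: "continuous_on X \<gamma>" and \<gamma>_closed: "closed (\<gamma> ` X)" and \<gamma>_A: "\<And>u. u \<in> A \<Longrightarrow> \<gamma> u = u"
      using \<gamma> by (auto simp: admissible_maps_def)
    have \<gamma>_le: "\<Phi> (\<gamma> x) \<le> c0 + \<epsilon>" if "x \<in> X" for x
    proof -
      have "ereal (\<Phi> (\<gamma> x)) \<le> (SUP u\<in>\<gamma> ` X. ereal (\<Phi> u))" using that by (intro SUP_upper) auto
      then have "ereal (\<Phi> (\<gamma> x)) < ereal (c0 + \<epsilon>)" using sup_\<gamma> by (rule order_le_less_trans)
      then show ?thesis by simp
    qed
    have pushed: "\<Phi> (\<eta> (\<gamma> x) T) \<le> c0 - \<epsilon>" if "x \<in> X" for x
    proof -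
      have "\<Phi> (\<eta> (\<gamma> x) T) \<le> max (c0 - \<epsilon>) (\<Phi> (\<gamma> x) - \<kappa> * T)"
        using \<eta>_le \<gamma>_le [OF that] T(1) less_imp_le by blast
      then show ?thesis using \<gamma>_le [OF that] T(2) by simp
    qed
    show False
    proof (cases "a0 < c0")
      case True
      let ?\<gamma> = "\<lambda>x. \<eta> (\<gamma> x) T"
      have "?\<gamma> \<in> admissible_maps X A"
        unfolding admissible_maps_def
      proof (intro CollectI conjI ballI)
        show "continuous_on X ?\<gamma>"
          by (rule continuous_on_pair_arg [OF \<eta>_cont \<gamma>_cont]) (use T in auto)
        have "closed ((\<lambda>u. \<eta> u T) ` (\<gamma> ` X))" using \<eta>_closed \<gamma>_closed T(1) less_imp_le by blast
        then show "closed (?\<gamma> ` X)" by (simp add: image_image)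
        show "?\<gamma> u = u" if "u \<in> A" for u
        proof -
          have "\<Phi> u \<le> c0 - 2 * \<epsilon>" using le_a0 [OF that] \<epsilon>(2) True by (simp add: e0_def field_simps)
          then show ?thesis using \<eta>_fix T(1) \<gamma>_A [OF that] by simp
        qed
      qed
      then have "c \<le> (SUP u\<in>?\<gamma> ` X. ereal (\<Phi> u))"
        unfolding assms(25) minimax_level_def by (rule INF_lower)
      also have "\<dots> \<le> ereal (c0 - \<epsilon>)" by (rule SUP_least) (use pushed in auto)
      finally show False using \<epsilon>(1) c0 by simp
    next
      case False
      then have a0_c0: "a0 = c0" using sup_le_c a0 c0 by simp
      have B_ge: "c0 \<le> \<Phi> u" if "u \<in> B" for u
      proof -
        have "ereal c0 \<le> infB" using sup_le_inf a0 a0_c0 by simp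
        also have "\<dots> \<le> ereal (\<Phi> u)" unfolding infB_def using that by (rule INF_lower)
        finally show ?thesis by simp
      qed
      (* The inner half of the cone carries the deformed map; on the collar, points of the rim flow for a time
         that decreases from T to 0. *)
      define \<gamma>' where "\<gamma>' x = (if radius x \<le> R / 2 then \<eta> (\<gamma> (\<sigma> x 2)) T
          else \<eta> (\<sigma> x (R / radius x)) (T * (2 - 2 * radius x / R)))" for x
      have rad_le: "radius x \<le> R" if "x \<in> X" for x
        using cone_decompose(3) [OF A0, of x R] that R by (cases "x = 0") (auto simp: X radius_def)
      have inner: "\<sigma> x 2 \<in> X" if "x \<in> X" "radius x \<le> R / 2" for x
      proof -
        obtain u t where x: "x = \<sigma> u t" "u \<in> A0" "0 \<le> t" using \<open>x \<in> X\<close> by (auto simp: X cone_def)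
        then have "t \<le> R / 2" using that(2) radius_scale [OF I_A0] by simp
        then show ?thesis using x by (auto simp: X scale_scale intro!: cone_I)
      qed
      have outer: "\<sigma> x (R / radius x) \<in> A" if "x \<in> X" "R / 2 \<le> radius x" for x
      proof -
        have "x \<noteq> 0" using that(2) R by (auto simp: radius_def)
        then have d: "proj x \<in> A0" "0 < radius x" using cone_decompose [OF A0, of x R] that(1) by (auto simp: X)
        have "\<sigma> x (R / radius x) = \<sigma> (\<sigma> (proj x) (radius x)) (R / radius x)"
          using scale_proj [OF \<open>x \<noteq> 0\<close>] by simp
        also have "\<dots> = \<sigma> (proj x) R" using d R by (simp add: scale_scale)
        finally show ?thesis using d(1) by (auto simp: A_def)
      qed
      have rX: "continuous_on X radius" using radius_cont by (rule continuous_on_subset) simp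
      have "continuous_on X \<gamma>'"
        unfolding \<gamma>'_def
      proof (rule continuous_on_cases_le [OF _ _ rX])
        let ?X = "{x \<in> X. radius x \<le> R / 2}"
        have "continuous_on ?X (\<lambda>x. \<sigma> x 2)"
          by (rule continuous_on_pair_arg [OF scale_cont]) (auto intro: continuous_intros)
        then have "continuous_on ?X (\<lambda>x. \<gamma> (\<sigma> x 2))"
          by (rule continuous_on_compose2 [OF \<gamma>_cont]) (use inner in auto)
        then show "continuous_on ?X (\<lambda>x. \<eta> (\<gamma> (\<sigma> x 2)) T)"
          by (rule continuous_on_pair_arg [OF \<eta>_cont]) (use T in auto)
      next
        let ?X = "{x \<in> X. R / 2 \<le> radius x}"
        have r: "continuous_on ?X radius" using radius_cont by (rule continuous_on_subset) simp
        have nz: "radius x \<noteq> 0" if "x \<in> ?X" for x using that R by auto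
        have "continuous_on ?X (\<lambda>x. \<sigma> x (R / radius x))"
          by (rule continuous_on_pair_arg [OF scale_cont])
            (use nz r R in \<open>auto intro!: continuous_intros simp: radius_def\<close>)
        moreover have "continuous_on ?X (\<lambda>x. T * (2 - 2 * radius x / R))"
          using r R by (intro continuous_intros) auto
        moreover have "0 \<le> T * (2 - 2 * radius x / R)" if "x \<in> ?X" for x
          using rad_le [of x] that T(1) R by (simp add: field_simps)
        ultimately show "continuous_on ?X (\<lambda>x. \<eta> (\<sigma> x (R / radius x)) (T * (2 - 2 * radius x / R)))"
          by (rule continuous_on_pair_arg [OF \<eta>_cont])
      next
        fix x assume x: "x \<in> X" and half: "radius x = R / 2"
        have eqs: "R / radius x = 2" "T * (2 - 2 * radius x / R) = T" using R by (simp_all add: half)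
        have "\<sigma> x 2 \<in> A" using outer [OF x eq_refl [OF half [symmetric]]] unfolding eqs(1) .
        then show "\<eta> (\<gamma> (\<sigma> x 2)) T = \<eta> (\<sigma> x (R / radius x)) (T * (2 - 2 * radius x / R))"
          by (simp only: eqs \<gamma>_A)
      qed
      moreover have "\<forall>u\<in>A. \<gamma>' u = u"
      proof
        fix u assume "u \<in> A"
        then obtain v where "u = \<sigma> v R" "v \<in> A0" by (auto simp: A_def)
        then have "radius u = R" using radius_scale [OF I_A0] R by simp
        then show "\<gamma>' u = u" using R \<eta>_0 by (simp add: \<gamma>'_def)
      qed
      ultimately obtain x where x: "x \<in> X" "\<gamma>' x \<in> B" using link by blast
      then have ge: "c0 \<le> \<Phi> (\<gamma>' x)" using B_ge by simp
      show False
      proof (cases "radius x \<le> R / 2")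
        case True
        then have "\<Phi> (\<gamma>' x) \<le> c0 - \<epsilon>" using pushed [OF inner [OF x(1)]] by (simp add: \<gamma>'_def)
        then show False using ge \<epsilon>(1) by simp
      next
        case False
        let ?y = "\<sigma> x (R / radius x)" and ?t = "T * (2 - 2 * radius x / R)"
        have y: "?y \<in> A" using outer [OF x(1)] False by simp
        have \<gamma>'_x: "\<gamma>' x = \<eta> ?y ?t" using False by (simp add: \<gamma>'_def)
        have t0: "0 \<le> ?t" using rad_le [OF x(1)] T(1) R by (simp add: field_simps)
        have \<Phi>y: "\<Phi> ?y \<le> c0" using le_a0 [OF y] a0_c0 by simp
        have "\<Phi> (\<gamma>' x) \<le> max (c0 - \<epsilon>) (\<Phi> ?y - \<kappa> * ?t)"
          unfolding \<gamma>'_x using \<eta>_le t0 \<Phi>y \<epsilon>(1) by simp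
        then have "\<kappa> * ?t \<le> 0" using ge \<Phi>y \<epsilon>(1) by simp
        then have "\<not> 0 < ?t" using mult_pos_pos [OF \<kappa>, of ?t] by (metis not_le)
        then have t_eq: "?t = 0" using t0 by (metis antisym not_le)
        have "?y \<in> B" using x(2) \<eta>_0 unfolding \<gamma>'_x t_eq by simp
        then obtain u t where ut: "?y = \<sigma> u t" "u \<in> B0" "0 \<le> t" by (auto simp: B_def)
        obtain v where v: "?y = \<sigma> v R" "v \<in> A0" using y by (auto simp: A_def)
        have "t = R" using ut v radius_scale [OF I_A0 [OF v(2)], of R] radius_scale [OF I_B0 [OF ut(2)], of t] R by simp
        then have "u = v"
          using proj_scale [OF I_A0 [OF v(2)] R] proj_scale [OF I_B0 [OF ut(2)] R] ut(1) v(1) by metis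
        then show False using ut(2) v(2) assms(16) by blast
      qed
    qed
  qed
qed

end
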